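(* With $\mathbb G$ and $W^2_G(\mathbb R^d)$ as defined in the context, $\mathrm{Dom}\,\mathbb G=W^2_G(\mathbb R^d)$, and $\mathbb Gf=Gf$ (with $Gf$ understood in the distributional sense) for every $f\in\mathrm{Dom}\,\mathbb G$.
   Context: Let $d',d''\ge1$ be integers, $d=d'+d''$, and write $x=(x',x'')\in\mathbb R^d=\mathbb R^{d'}\times\mathbb R^{d''}$. Let $G=-\Delta_{x'}-|x'|^2\Delta_{x''}$, where $\Delta_{x'},\Delta_{x''}$ are the Laplacians on $\mathbb R^{d'},\mathbb R^{d''}$. Put $\mathbb R^{d''}_0=\mathbb R^{d''}\setminus\{0\}$, $\mathbb N=\{0,1,2,\dots\}$, and $|k|=k_1+\dots+k_{d'}$ for $k\in\mathbb N^{d'}$. $\langle\cdot,\cdot\rangle$ is the usual inner product in $L^2(\mathbb R^d)$. Hermite functions: $h_n(u)=(2^n n!\sqrt\pi)^{-1/2}H_n(u)e^{-u^2/2}$ on $\mathbb R$ ($H_n$ the Hermite polynomials), $h_k(x')=\prod_{j=1}^{d'}h_{k_j}(x'_j)$ for $k\in\mathbb N^{d'}$, and $h_{k,\tau}(x')=\tau^{d'/4}h_k(\tau^{1/2}x')$ for $\tau>0$; for each $\tau>0$ the family $\{h_{k,\tau}\}_k$ is an orthonormal basis of $L^2(\mathbb R^{d'})$. For $\xi''\in\mathbb R^{d''}_0$ and $g\in L^2(\mathbb R^{d'})$, $\mathcal H^{sc}_{\xi''}g(k)=\langle g,h_{k,|\xi''|}\rangle_{L^2(\mathbb R^{d'})}$.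 $\mathcal F''$ is the unitary Fourier transform on $L^2(\mathbb R^{d''})$, given for integrable functions by $\mathcal F''g(\xi'')=(2\pi)^{-d''/2}\int g(x'')e^{-i\xi''\cdot x''}dx''$. $L^2(\Gamma)=L^2(\mathbb N^{d'}\times\mathbb R^{d''})$ with respect to counting measure times Lebesgue measure. For $f\in L^2(\mathbb R^d)$, with $f_{x'}=f(x',\cdot)$, $\mathcal Gf(k,\xi'')=\mathcal H^{sc}_{\xi''}[x'\mapsto\mathcal F''f_{x'}(\xi'')](k)$. The map $\mathcal G:L^2(\mathbb R^d)\to L^2(\Gamma)$ is a unitary bijection with inverse $\mathcal G^{-1}$. Let $\Theta(k,\xi'')=(2|k|+d')|\xi''|$ on $\mathbb N^{d'}\times\mathbb R^{d''}_0$, and let $\mathbb M_\Theta F=\Theta F$ with domain $\{F\in L^2(\Gamma):\Theta F\in L^2(\Gamma)\}$. Define $\mathrm{Dom}\,\mathbb G=\{f\in L^2(\mathbb R^d):\Theta\,\mathcal Gf\in L^2(\Gamma)\}$ and $\mathbb G=\mathcal G^{-1}\circ\mathbb M_\Theta\circ\mathcal G$. $W^2_G(\mathbb R^d)=\{f\in L^2(\mathbb R^d):Gf\in L^2(\mathbb R^d)\}$, where $Gf\in L^2(\mathbb R^d)$ means that there exists $h\in L^2(\mathbb R^d)$ such that $\langle G\varphi,f\rangle=\langle\varphi,h\rangle$ for all $\varphi\in C_c^\infty(\mathbb R^d)$, and then $Gf:=h$. *)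

theory Defs
  imports "HOL-Analysis.Analysis"
begin

text \<open>
  Elements of an \<open>L\<^sup>2\<close> space are represented by measurable functions, two of them being identified
  when they agree almost everywhere. A map between \<open>L\<^sup>2\<close> spaces is a function on representatives
  that picks some representative of the value; only its almost-everywhere class is meaningful.
\<close>

definition L2 :: "'a measure \<Rightarrow> ('a \<Rightarrow> complex) set" where
  "L2 M = {f. f \<in> borel_measurable M \<and> integrable M (\<lambda>x. (norm (f x))\<^sup>2)}"

definition L2_inner :: "'a measure \<Rightarrow> ('a \<Rightarrow> complex) \<Rightarrow> ('a \<Rightarrow> complex) \<Rightarrow> complex" where
  "L2_inner M f g = (LINT x|M. f x * cnj (g x))"


section \<open>Fourier transform\<close>

definition fourier_integral :: "('a::euclidean_space \<Rightarrow> complex) \<Rightarrow> 'a \<Rightarrow> complex" where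
  "fourier_integral g \<xi> =
     of_real ((2 * pi) powr (- real DIM('a) / 2)) * (LINT x|lborel. g x * cis (- (\<xi> \<bullet> x)))"

text \<open>
  The unitary Fourier transform on \<open>L\<^sup>2\<close> is the extension by continuity: the \<open>L\<^sup>2\<close> limit of the
  Fourier integrals of the truncations of \<open>g\<close> to balls. The \<open>L\<^sup>2\<close> distance is written with the
  nonnegative integral, since the Bochner integral of a non-integrable function is \<open>0\<close>.
\<close>

definition is_fourier_L2 :: "('a::euclidean_space \<Rightarrow> complex) \<Rightarrow> ('a \<Rightarrow> complex) \<Rightarrow> bool" where
  "is_fourier_L2 g h \<longleftrightarrow> g \<in> L2 lborel \<and> h \<in> L2 lborel \<and>
     (\<lambda>n::nat. \<integral>\<^sup>+\<xi>. ennreal ((norm (fourier_integral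
         (\<lambda>x. if x \<in> cball 0 (real n) then g x else 0) \<xi> - h \<xi>))\<^sup>2) \<partial>lborel)
       \<longlonglongrightarrow> 0"

text \<open>
  For almost every \<open>x'\<close> the slice of \<open>f\<close> at \<open>x'\<close> is in \<open>L\<^sup>2\<close> and has a transform, determined only
  up to a null set depending on \<open>x'\<close>. To evaluate these transforms at a fixed \<open>\<xi>''\<close> as a function
  of \<open>x'\<close> one needs a jointly measurable choice, which is unique up to a null set of the product.
\<close>

definition partial_fourier ::
  "('a::euclidean_space \<times> 'b::euclidean_space \<Rightarrow> complex) \<Rightarrow> 'a \<times> 'b \<Rightarrow> complex" where
  "partial_fourier f =
     (SOME \<Phi>. \<Phi> \<in> L2 lborel \<and> (AE x' in lborel. is_fourier_L2 (\<lambda>x''. f (x', x'')) (\<lambda>\<xi>. \<Phi> (x', \<xi>))))"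


section \<open>Hermite functions\<close>

fun hermite_poly :: "nat \<Rightarrow> real \<Rightarrow> real" where
  "hermite_poly 0 u = 1"
| "hermite_poly (Suc 0) u = 2 * u"
| "hermite_poly (Suc (Suc n)) u =
     2 * u * hermite_poly (Suc n) u - 2 * real (Suc n) * hermite_poly n u"

definition hermite_fun :: "nat \<Rightarrow> real \<Rightarrow> real" where
  "hermite_fun n u = (2 ^ n * fact n * sqrt pi) powr (- 1 / 2) * hermite_poly n u * exp (- u\<^sup>2 / 2)"

definition hermite_multi :: "nat ^ 'm \<Rightarrow> real ^ 'm::finite \<Rightarrow> real" where
  "hermite_multi k x' = (\<Prod>j\<in>UNIV. hermite_fun (k $ j) (x' $ j))"

definition hermite_scaled :: "nat ^ 'm \<Rightarrow> real \<Rightarrow> real ^ 'm::finite \<Rightarrow> real" where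
  "hermite_scaled k \<tau> x' = \<tau> powr (real CARD('m) / 4) * hermite_multi k (sqrt \<tau> *\<^sub>R x')"

definition scaled_hermite_transform ::
  "real ^ 'n \<Rightarrow> (real ^ 'm \<Rightarrow> complex) \<Rightarrow> nat ^ 'm::finite \<Rightarrow> complex" where
  "scaled_hermite_transform \<xi>'' g k =
     L2_inner lborel g (\<lambda>x'. of_real (hermite_scaled k (norm \<xi>'') x'))"


section \<open>The transform diagonalising the Grushin operator\<close>

definition Gamma_measure :: "((nat ^ 'm::finite) \<times> (real ^ 'n::finite)) measure" where
  "Gamma_measure = count_space UNIV \<Otimes>\<^sub>M lborel"

definition calG ::
  "((real ^ 'm) \<times> (real ^ 'n) \<Rightarrow> complex) \<Rightarrow> (nat ^ 'm::finite) \<times> (real ^ 'n::finite) \<Rightarrow> complex" where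
  "calG f = (\<lambda>(k, \<xi>''). scaled_hermite_transform \<xi>'' (\<lambda>x'. partial_fourier f (x', \<xi>'')) k)"

definition calG_inv ::
  "((nat ^ 'm) \<times> (real ^ 'n) \<Rightarrow> complex) \<Rightarrow> (real ^ 'm::finite) \<times> (real ^ 'n::finite) \<Rightarrow> complex" where
  "calG_inv F = (SOME f. f \<in> L2 lborel \<and> (AE p in Gamma_measure. calG f p = F p))"

text \<open>The values of \<open>Theta\<close> on the null set \<open>\<xi>'' = 0\<close> are irrelevant.\<close>

definition Theta :: "(nat ^ 'm::finite) \<times> (real ^ 'n::finite) \<Rightarrow> real" where
  "Theta = (\<lambda>(k, \<xi>''). (2 * real (\<Sum>j\<in>UNIV. k $ j) + real CARD('m)) * norm \<xi>'')"

definition mult_Theta ::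
  "((nat ^ 'm) \<times> (real ^ 'n) \<Rightarrow> complex) \<Rightarrow> (nat ^ 'm::finite) \<times> (real ^ 'n::finite) \<Rightarrow> complex" where
  "mult_Theta F = (\<lambda>p. of_real (Theta p) * F p)"

definition Dom_bbG :: "((real ^ 'm::finite) \<times> (real ^ 'n::finite) \<Rightarrow> complex) set" where
  "Dom_bbG = {f \<in> L2 lborel. mult_Theta (calG f) \<in> L2 Gamma_measure}"

definition bbG ::
  "((real ^ 'm) \<times> (real ^ 'n) \<Rightarrow> complex) \<Rightarrow> (real ^ 'm::finite) \<times> (real ^ 'n::finite) \<Rightarrow> complex" where
  "bbG = calG_inv \<circ> mult_Theta \<circ> calG"


section \<open>The Grushin operator in the distributional sense\<close>

definition dir_deriv :: "'a \<Rightarrow> ('a::euclidean_space \<Rightarrow> complex) \<Rightarrow> 'a \<Rightarrow> complex" where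
  "dir_deriv v \<phi> x = frechet_derivative \<phi> (at x) v"

fun times_cont_differentiable :: "nat \<Rightarrow> ('a::euclidean_space \<Rightarrow> complex) \<Rightarrow> bool" where
  "times_cont_differentiable 0 \<phi> \<longleftrightarrow> continuous_on UNIV \<phi>"
| "times_cont_differentiable (Suc n) \<phi> \<longleftrightarrow>
     \<phi> differentiable_on UNIV \<and> (\<forall>v. times_cont_differentiable n (dir_deriv v \<phi>))"

definition test_functions :: "('a::euclidean_space \<Rightarrow> complex) set" where
  "test_functions =
     {\<phi>. (\<forall>n. times_cont_differentiable n \<phi>) \<and> compact (closure {x. \<phi> x \<noteq> 0})}"

definition grushin ::
  "((real ^ 'm) \<times> (real ^ 'n) \<Rightarrow> complex) \<Rightarrow> (real ^ 'm::finite) \<times> (real ^ 'n::finite) \<Rightarrow> complex" where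
  "grushin \<phi> = (\<lambda>(x', x'').
     - (\<Sum>i\<in>UNIV. dir_deriv (axis i 1, 0) (dir_deriv (axis i 1, 0) \<phi>) (x', x''))
     - of_real ((norm x')\<^sup>2) *
         (\<Sum>j\<in>UNIV. dir_deriv (0, axis j 1) (dir_deriv (0, axis j 1) \<phi>) (x', x'')))"

definition is_weak_grushin ::
  "((real ^ 'm::finite) \<times> (real ^ 'n::finite) \<Rightarrow> complex) \<Rightarrow> ((real ^ 'm) \<times> (real ^ 'n) \<Rightarrow> complex) \<Rightarrow> bool"
where
  "is_weak_grushin f h \<longleftrightarrow> h \<in> L2 lborel \<and>
     (\<forall>\<phi>\<in>test_functions. L2_inner lborel (grushin \<phi>) f = L2_inner lborel \<phi> h)"

definition W2_G :: "((real ^ 'm::finite) \<times> (real ^ 'n::finite) \<Rightarrow> complex) set" where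
  "W2_G = {f \<in> L2 lborel. \<exists>h. is_weak_grushin f h}"

definition weak_grushin ::
  "((real ^ 'm) \<times> (real ^ 'n) \<Rightarrow> complex) \<Rightarrow> (real ^ 'm::finite) \<times> (real ^ 'n::finite) \<Rightarrow> complex" where
  "weak_grushin f = (SOME h. is_weak_grushin f h)"

end

theory Submission
  imports Defs "HOL-Probability.Probability" "HOL-Real_Asymp.Real_Asymp"
begin

text \<open>
  The Hermite functions form an orthonormal basis of eigenfunctions of the Fourier transform, so
  everything about the two transforms can be read off from coefficients: a square-integrable
  function has \<open>h\<close> as its transform iff the coefficients of \<open>h\<close> are those of the function times
  \<open>(-i)^|k|\<close>. A measurable fibrewise Riesz-Fischer theorem then yields the partial transform and the
  unitarity of \<^const>\<open>calG\<close>.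

  Integration by parts against \<open>h_{k,|\<xi>|}(x') e^{-i \<xi> x''}\<close>, an eigenfunction of the Grushin operator
  with eigenvalue \<open>Theta\<close>, gives \<open>calG (G \<phi>) = Theta (calG \<phi>)\<close> for test functions, hence one inclusion.

  For the other inclusion test the weak equation with products \<open>a(x') b(x'')\<close>. Translating \<open>b\<close> and
  using uniqueness of the Fourier transform separates the frequencies: for every \<open>a\<close> and almost every
  \<open>\<xi>\<close> the slices at \<open>\<xi>\<close> satisfy the weak equation of the scaled harmonic oscillator tested with \<open>a\<close>.
  Only countably many \<open>a\<close> can be used for one \<open>\<xi>\<close>; the truncated Hermite functions with rational scale
  suffice, since the scales may converge to \<open>|\<xi>|^{1/2}\<close> while the truncation is removed.
  Comparing transforms, \<open>calG\<close> of the weak image of \<open>f\<close> is \<open>Theta (calG f)\<close>, which also identifies the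
  two operators by injectivity of \<open>calG\<close>.
\<close>

section \<open>Square-integrable functions and orthonormal expansions\<close>

text \<open>Two obstacles shape the proof. First, the modes h_{k,|\<xi>|}(x') e^(-i \<xi> x'') are
  neither compactly supported nor square integrable, so the weak equation cannot be tested with
  them. In x'' the character comes from translating a bump, after which the transform of the bump
  has to be divided out. It may vanish at \<xi>, so bumps of width proportional to 1/(n+1) are used
  for every n: at \<xi> their transforms are multiples of that of one fixed bump at \<xi>/(n+1),
  which tends to its nonzero integral. In x' the cutoff is bump(N u); each derivative falling on it
  costs a factor N, and one Gaussian dominates all scales near |\<xi>|^(1/2), so cutoff and scale go
  to their limits together. Second, \<open>partial_fourier\<close>, \<open>calG_inv\<close> and
  \<open>weak_grushin\<close> are choices, fixed at best up to null sets. Existence has to precede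
  every use, and each identity, even linearity, holds almost everywhere only.\<close>

definition L2_sq :: "'a measure \<Rightarrow> ('a \<Rightarrow> complex) \<Rightarrow> real" where
  "L2_sq M f = (LINT x|M. (norm (f x))\<^sup>2)"

lemma cnj_measurable [measurable]: "cnj \<in> borel_measurable borel"
  by (intro borel_measurable_continuous_onI continuous_intros)

lemma L2_measurable: "f \<in> L2 M \<Longrightarrow> f \<in> borel_measurable M"
  by (simp add: L2_def)

lemma L2_integrable: "f \<in> L2 M \<Longrightarrow> integrable M (\<lambda>x. (norm (f x))\<^sup>2)"
  by (simp add: L2_def)

lemma L2_sq_nonneg [simp]: "0 \<le> L2_sq M f"
  by (simp add: L2_sq_def)

lemma nn_integral_L2_sq:
  assumes "f \<in> L2 M" shows "(\<integral>\<^sup>+x. ennreal ((norm (f x))\<^sup>2) \<partial>M) = ennreal (L2_sq M f)"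
  unfolding L2_sq_def by (rule nn_integral_eq_integral[OF L2_integrable[OF assms]]) simp

lemma L2_iff_nn_integral:
  "f \<in> L2 M \<longleftrightarrow> f \<in> borel_measurable M \<and> (\<integral>\<^sup>+x. ennreal ((norm (f x))\<^sup>2) \<partial>M) < \<infinity>"
  unfolding L2_def by (auto simp: integrable_iff_bounded)

lemma L2_bound:
  assumes "f \<in> L2 M" "g \<in> borel_measurable M" "AE x in M. norm (g x) \<le> norm (f x)"
  shows "g \<in> L2 M"
proof -
  have "integrable M (\<lambda>x. (norm (g x))\<^sup>2)"
    by (rule Bochner_Integration.integrable_bound[OF L2_integrable[OF assms(1)]])
       (use assms in \<open>auto elim!: eventually_mono intro: power_mono\<close>)
  then show ?thesis using assms by (simp add: L2_def)
qed

lemma norm_add_sq_le: "(norm (a + b :: 'a::real_normed_vector))\<^sup>2 \<le> 2 * (norm a)\<^sup>2 + 2 * (norm b)\<^sup>2"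
proof -
  have "(norm (a + b))\<^sup>2 \<le> (norm a + norm b)\<^sup>2"
    by (intro power_mono norm_triangle_ineq) simp
  also have "\<dots> \<le> 2 * (norm a)\<^sup>2 + 2 * (norm b)\<^sup>2"
    using sum_squares_bound[of "norm a" "norm b"] by (simp add: power2_sum)
  finally show ?thesis .
qed

lemma L2_add: assumes "f \<in> L2 M" "g \<in> L2 M" shows "(\<lambda>x. f x + g x) \<in> L2 M"
proof -
  note [measurable] = assms[THEN L2_measurable]
  have "integrable M (\<lambda>x. 2 * (norm (f x))\<^sup>2 + 2 * (norm (g x))\<^sup>2)"
    using assms[THEN L2_integrable] by simp
  then have "integrable M (\<lambda>x. (norm (f x + g x))\<^sup>2)"
    by (rule Bochner_Integration.integrable_bound) (auto simp: norm_add_sq_le)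
  then show ?thesis by (simp add: L2_def)
qed

lemma L2_cmult: assumes "f \<in> L2 M" shows "(\<lambda>x. c * f x) \<in> L2 M"
  using assms by (auto simp: L2_def norm_mult power_mult_distrib intro!: borel_measurable_times)

lemma L2_zero [simp]: "(\<lambda>x. 0) \<in> L2 M"
  by (simp add: L2_def)

lemma L2_diff: assumes "f \<in> L2 M" "g \<in> L2 M" shows "(\<lambda>x. f x - g x) \<in> L2 M"
  using L2_add[OF assms(1) L2_cmult[OF assms(2), of "-1"]] by simp

lemma L2_sum: assumes "\<And>i. i \<in> A \<Longrightarrow> f i \<in> L2 M" shows "(\<lambda>x. \<Sum>i\<in>A. f i x) \<in> L2 M"
  using assms by (induction A rule: infinite_finite_induct) (auto intro: L2_add)

lemma L2_cnj: "f \<in> L2 M \<Longrightarrow> (\<lambda>x. cnj (f x)) \<in> L2 M"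
  by (auto simp: L2_def intro!: borel_measurable_continuous_on[where f=cnj] continuous_intros)

lemma L2_mult_integrable:
  assumes "f \<in> L2 M" "g \<in> L2 M" shows "integrable M (\<lambda>x. f x * g x)"
proof -
  note [measurable] = assms[THEN L2_measurable]
  have "integrable M (\<lambda>x. (norm (f x))\<^sup>2 + (norm (g x))\<^sup>2)"
    using assms[THEN L2_integrable] by simp
  moreover have "norm (f x * g x) \<le> (norm (f x))\<^sup>2 + (norm (g x))\<^sup>2" for x
    using sum_squares_bound[of "norm (f x)" "norm (g x)"]
      mult_nonneg_nonneg[OF norm_ge_zero[of "f x"] norm_ge_zero[of "g x"]]
    unfolding norm_mult by linarith
  ultimately show ?thesis
    by (intro Bochner_Integration.integrable_bound[where g="\<lambda>x. f x * g x"]) (auto intro: order_trans[OF _ abs_ge_self])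
qed

lemma L2_inner_integrable:
  "f \<in> L2 M \<Longrightarrow> g \<in> L2 M \<Longrightarrow> integrable M (\<lambda>x. f x * cnj (g x))"
  by (intro L2_mult_integrable L2_cnj)

lemma L2_inner_self: "L2_inner M f f = of_real (L2_sq M f)"
  by (simp add: L2_inner_def L2_sq_def complex_norm_square[symmetric] del: of_real_power)

lemma L2_inner_cnj: "cnj (L2_inner M f g) = L2_inner M g f"
  unfolding L2_inner_def by (simp add: mult.commute flip: Bochner_Integration.integral_cnj)

lemma L2_inner_add_left:
  "f \<in> L2 M \<Longrightarrow> g \<in> L2 M \<Longrightarrow> h \<in> L2 M \<Longrightarrow> L2_inner M (\<lambda>x. f x + g x) h = L2_inner M f h + L2_inner M g h"
  by (simp add: L2_inner_def distrib_right L2_inner_integrable)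

lemma L2_inner_diff_left:
  "f \<in> L2 M \<Longrightarrow> g \<in> L2 M \<Longrightarrow> h \<in> L2 M \<Longrightarrow> L2_inner M (\<lambda>x. f x - g x) h = L2_inner M f h - L2_inner M g h"
  by (simp add: L2_inner_def left_diff_distrib L2_inner_integrable)

lemma L2_inner_cmult_left: "L2_inner M (\<lambda>x. c * f x) h = c * L2_inner M f h"
  by (simp add: L2_inner_def mult.assoc)

lemma L2_inner_sum_left:
  assumes "\<And>i. i \<in> A \<Longrightarrow> f i \<in> L2 M" "h \<in> L2 M"
  shows "L2_inner M (\<lambda>x. \<Sum>i\<in>A. f i x) h = (\<Sum>i\<in>A. L2_inner M (f i) h)"
  using assms unfolding L2_inner_def
  by (simp add: sum_distrib_right Bochner_Integration.integral_sum L2_inner_integrable)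

lemma L2_inner_cong_AE:
  assumes "AE x in M. f x = f' x" "AE x in M. g x = g' x"
  assumes "f \<in> borel_measurable M" "f' \<in> borel_measurable M"
    "g \<in> borel_measurable M" "g' \<in> borel_measurable M"
  shows "L2_inner M f g = L2_inner M f' g'"
proof -
  have [measurable]: "(\<lambda>x. cnj (g x)) \<in> borel_measurable M" "(\<lambda>x. cnj (g' x)) \<in> borel_measurable M"
    using assms by (auto intro!: borel_measurable_continuous_on[where f=cnj] continuous_intros)
  show ?thesis
    unfolding L2_inner_def using assms by (intro integral_cong_AE) auto
qed

lemma L2_sq_cong_AE:
  assumes "AE x in M. f x = f' x" "f \<in> borel_measurable M" "f' \<in> borel_measurable M"
  shows "L2_sq M f = L2_sq M f'"
  unfolding L2_sq_def using assms by (intro integral_cong_AE) auto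

lemma L2_cong_AE:
  assumes "f \<in> L2 M" "g \<in> borel_measurable M" "AE x in M. g x = f x" shows "g \<in> L2 M"
  by (rule L2_bound[OF assms(1,2)]) (use assms(3) in auto)

lemma L2_sq_eq_0_iff: "f \<in> L2 M \<Longrightarrow> L2_sq M f = 0 \<longleftrightarrow> (AE x in M. f x = 0)"
  unfolding L2_sq_def by (subst integral_nonneg_eq_0_iff_AE) (auto simp: L2_integrable)

lemma L2_inner_Cauchy_Schwarz:
  assumes "f \<in> L2 M" "g \<in> L2 M"
  shows "(norm (L2_inner M f g))\<^sup>2 \<le> L2_sq M f * L2_sq M g"
proof -
  note [measurable] = assms[THEN L2_measurable]
  have "ennreal (norm (L2_inner M f g)) \<le> (\<integral>\<^sup>+x. ennreal (norm (f x * cnj (g x))) \<partial>M)"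
    unfolding L2_inner_def
    by (rule order_trans[OF ennreal_leI[OF integral_norm_bound]])
       (simp add: nn_integral_eq_integral[OF integrable_norm[OF L2_inner_integrable[OF assms]]])
  also have "\<dots> = (\<integral>\<^sup>+x. ennreal (norm (f x)) * ennreal (norm (g x)) \<partial>M)"
    by (simp add: norm_mult ennreal_mult)
  finally have "(ennreal (norm (L2_inner M f g)))\<^sup>2 \<le> (\<integral>\<^sup>+x. ennreal (norm (f x)) * ennreal (norm (g x)) \<partial>M)\<^sup>2"
    by (rule power_mono) simp
  also have "\<dots> \<le> (\<integral>\<^sup>+x. (ennreal (norm (f x)))\<^sup>2 \<partial>M) * (\<integral>\<^sup>+x. (ennreal (norm (g x)))\<^sup>2 \<partial>M)"
    by (rule Cauchy_Schwarz_nn_integral) auto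
  also have "\<dots> = ennreal (L2_sq M f * L2_sq M g)"
    using assms by (simp add: ennreal_power nn_integral_L2_sq ennreal_mult)
  finally show ?thesis by (simp add: ennreal_power)
qed

section \<open>Convergence and completeness in the space of square-integrable functions\<close>

lemma L2_inner_tendsto:
  assumes "\<And>n. s n \<in> L2 M" "f \<in> L2 M" "g \<in> L2 M" "(\<lambda>n. L2_sq M (\<lambda>x. s n x - f x)) \<longlonglongrightarrow> 0"
  shows "(\<lambda>n. L2_inner M (s n) g) \<longlonglongrightarrow> L2_inner M f g"
proof -
  have "(\<lambda>n. L2_sq M (\<lambda>x. s n x - f x) * L2_sq M g) \<longlonglongrightarrow> 0 * L2_sq M g"
    by (intro tendsto_intros assms)
  then have lim: "(\<lambda>n. L2_sq M (\<lambda>x. s n x - f x) * L2_sq M g) \<longlonglongrightarrow> 0" by simp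
  have "(\<lambda>n. (norm (L2_inner M (s n) g - L2_inner M f g))\<^sup>2) \<longlonglongrightarrow> 0"
  proof (rule tendsto_sandwich[OF _ _ tendsto_const lim])
    show "\<forall>\<^sub>F n in sequentially. (norm (L2_inner M (s n) g - L2_inner M f g))\<^sup>2
        \<le> L2_sq M (\<lambda>x. s n x - f x) * L2_sq M g"
      using assms by (auto simp: L2_inner_diff_left[symmetric] intro!: always_eventually L2_inner_Cauchy_Schwarz L2_diff)
  qed auto
  then have "(\<lambda>n. sqrt ((norm (L2_inner M (s n) g - L2_inner M f g))\<^sup>2)) \<longlonglongrightarrow> sqrt 0"
    by (intro tendsto_intros)
  then have "(\<lambda>n. norm (L2_inner M (s n) g - L2_inner M f g)) \<longlonglongrightarrow> 0" by simp
  then show ?thesis using Lim_null tendsto_norm_zero_iff by blast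
qed

text \<open>A subsequence with rapidly decreasing gaps converges almost everywhere; Fatou's lemma
  then bounds the distance of the whole sequence to the pointwise limit.\<close>

lemma L2_complete:
  fixes s :: "nat \<Rightarrow> 'a \<Rightarrow> complex"
  assumes s: "\<And>n. s n \<in> L2 M"
    and Cauchy: "\<And>e. e > 0 \<Longrightarrow> \<exists>N. \<forall>m\<ge>N. \<forall>n\<ge>N. L2_sq M (\<lambda>x. s m x - s n x) < e"
  shows "\<exists>f\<in>L2 M. (\<lambda>n. L2_sq M (\<lambda>x. s n x - f x)) \<longlonglongrightarrow> 0"
proof -
  have [measurable]: "s n \<in> borel_measurable M" for n by (rule L2_measurable[OF s])
  have "\<exists>r. \<forall>k. (\<forall>m\<ge>r k. \<forall>n\<ge>r k. L2_sq M (\<lambda>x. s m x - s n x) < (1/4)^k) \<and> r k < r (Suc k)"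
  proof (rule dependent_nat_choice)
    show "\<exists>x. \<forall>m\<ge>x. \<forall>n\<ge>x. L2_sq M (\<lambda>x. s m x - s n x) < (1/4)^0"
      using Cauchy[of 1] by simp
  next
    fix x k
    obtain N where N: "\<forall>m\<ge>N. \<forall>n\<ge>N. L2_sq M (\<lambda>x. s m x - s n x) < (1/4)^Suc k"
      using Cauchy[of "(1/4)^Suc k"] by auto
    show "\<exists>y. (\<forall>m\<ge>y. \<forall>n\<ge>y. L2_sq M (\<lambda>x. s m x - s n x) < (1/4)^Suc k) \<and> x < y"
      by (rule exI[of _ "max N (Suc x)"]) (use N in auto)
  qed
  then obtain r where r: "\<And>k m n. m \<ge> r k \<Longrightarrow> n \<ge> r k \<Longrightarrow> L2_sq M (\<lambda>x. s m x - s n x) < (1/4)^k"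
    and rS: "\<And>k. r k < r (Suc k)" by auto
  have r_mono: "strict_mono r" using rS by (simp add: strict_mono_Suc_iff)
  define d where "d k x = s (r (Suc k)) x - s (r k) x" for k x
  have d_L2: "d k \<in> L2 M" for k unfolding d_def by (intro L2_diff s)
  have [measurable]: "d k \<in> borel_measurable M" for k by (rule L2_measurable[OF d_L2])
  have d_le: "L2_sq M (d k) \<le> (1/4)^k" for k
    unfolding d_def using r[of k "r (Suc k)" "r k"] rS[of k] by simp
  \<comment> \<open>The weight 2^k keeps the series summable, since 2^k (1/4)^k = (1/2)^k, and its
    pointwise finiteness gives |d_k(x)|^2 \<le> C (1/2)^k. The telescoping series is thus dominated
    by a geometric one, with no triangle inequality for the norm.\<close>
  have "(\<integral>\<^sup>+x. (\<Sum>k. ennreal (2^k * (norm (d k x))\<^sup>2)) \<partial>M) = (\<Sum>k. \<integral>\<^sup>+x. ennreal (2^k * (norm (d k x))\<^sup>2) \<partial>M)"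
    by (rule nn_integral_suminf) auto
  also have "\<dots> = (\<Sum>k. ennreal (2^k * L2_sq M (d k)))"
    by (simp add: ennreal_mult nn_integral_cmult nn_integral_L2_sq[OF d_L2])
  also have "\<dots> \<le> (\<Sum>k. ennreal ((1/2)^k))"
  proof (intro suminf_le allI ennreal_leI)
    fix k
    have "2^k * L2_sq M (d k) \<le> 2^k * (1/4)^k" by (intro mult_left_mono d_le) auto
    also have "\<dots> = (1/2::real)^k" by (simp flip: power_mult_distrib)
    finally show "2^k * L2_sq M (d k) \<le> (1/2)^k" .
  qed auto
  also have "\<dots> = ennreal (\<Sum>k. (1/2)^k)"
    by (rule suminf_ennreal2) auto
  also have "\<dots> < \<infinity>" by simp
  finally have "AE x in M. (\<Sum>k. ennreal (2^k * (norm (d k x))\<^sup>2)) \<noteq> \<infinity>"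
    by (intro nn_integral_noteq_infinite) auto
  then have conv: "AE x in M. convergent (\<lambda>k. s (r k) x)"
  proof (rule eventually_mono)
    fix x assume fin: "(\<Sum>k. ennreal (2^k * (norm (d k x))\<^sup>2)) \<noteq> \<infinity>"
    then have sm: "summable (\<lambda>k. 2^k * (norm (d k x))\<^sup>2)"
      by (intro summable_suminf_not_top) auto
    define C where "C = (\<Sum>k. 2^k * (norm (d k x))\<^sup>2)"
    have le: "2^k * (norm (d k x))\<^sup>2 \<le> C" for k
      unfolding C_def using sum_le_suminf[OF sm, of "{k}"] by auto
    have C0: "0 \<le> C" using le[of 0] by (smt (verit) mult_nonneg_nonneg zero_le_power2 power_0)
    have "norm (d k x) \<le> sqrt C * (sqrt (1/2))^k" for k
    proof -
      have "(norm (d k x))\<^sup>2 \<le> C * (1/2)^k" using le[of k] by (simp add: field_simps power_divide)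
      then have "sqrt ((norm (d k x))\<^sup>2) \<le> sqrt (C * (1/2)^k)" by (rule real_sqrt_le_mono)
      then show ?thesis by (simp add: real_sqrt_mult real_sqrt_power)
    qed
    moreover have "summable (\<lambda>k. sqrt C * (sqrt (1/2))^k)"
      by (intro summable_mult summable_geometric) (simp add: real_sqrt_lt_1_iff)
    ultimately have "summable (\<lambda>k. d k x)"
      by (intro summable_comparison_test[of "\<lambda>k. d k x" "\<lambda>k. sqrt C * (sqrt (1/2))^k"]) auto
    then have "convergent (\<lambda>n. s (r 0) x + (\<Sum>k<n. d k x))"
      by (intro convergent_add convergent_const) (simp add: summable_iff_convergent)
    also have "(\<lambda>n. s (r 0) x + (\<Sum>k<n. d k x)) = (\<lambda>n. s (r n) x)"
      unfolding d_def using sum_lessThan_telescope[of "\<lambda>k. s (r k) x"] by auto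
    finally show "convergent (\<lambda>k. s (r k) x)" .
  qed
  \<comment> \<open>Where the subsequence diverges \<open>lim\<close> returns an arbitrary value;
    this happens on a null set only.\<close>
  define f where "f x = lim (\<lambda>k. s (r k) x)" for x
  have f_meas [measurable]: "f \<in> borel_measurable M"
    unfolding f_def by (rule borel_measurable_lim_metric) simp
  have lim: "AE x in M. (\<lambda>k. s (r k) x) \<longlonglongrightarrow> f x"
    using conv unfolding f_def by (auto simp: convergent_LIMSEQ_iff)
  \<comment> \<open>Stated with the nonnegative integral because it is not yet known that s_n - f is
    square integrable; this bound is what shows it.\<close>
  have Fatou: "(\<integral>\<^sup>+x. ennreal ((norm (s n x - f x))\<^sup>2) \<partial>M) \<le> ennreal ((1/4)^k)" if "n \<ge> r k" for n k
  proof -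
    have "AE x in M. ennreal ((norm (s n x - f x))\<^sup>2) = liminf (\<lambda>j. ennreal ((norm (s n x - s (r j) x))\<^sup>2))"
      using lim
    proof (rule eventually_mono)
      fix x assume "(\<lambda>k. s (r k) x) \<longlonglongrightarrow> f x"
      then have "(\<lambda>j. ennreal ((norm (s n x - s (r j) x))\<^sup>2)) \<longlonglongrightarrow> ennreal ((norm (s n x - f x))\<^sup>2)"
        by (intro tendsto_intros)
      then show "ennreal ((norm (s n x - f x))\<^sup>2) = liminf (\<lambda>j. ennreal ((norm (s n x - s (r j) x))\<^sup>2))"
        by (subst lim_imp_Liminf) auto
    qed
    then have "(\<integral>\<^sup>+x. ennreal ((norm (s n x - f x))\<^sup>2) \<partial>M)
        = (\<integral>\<^sup>+x. liminf (\<lambda>j. ennreal ((norm (s n x - s (r j) x))\<^sup>2)) \<partial>M)"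
      by (rule nn_integral_cong_AE)
    also have "\<dots> \<le> liminf (\<lambda>j. \<integral>\<^sup>+x. ennreal ((norm (s n x - s (r j) x))\<^sup>2) \<partial>M)"
      by (rule nn_integral_liminf) simp
    also have "\<dots> = liminf (\<lambda>j. ennreal (L2_sq M (\<lambda>x. s n x - s (r j) x)))"
      by (simp add: nn_integral_L2_sq L2_diff s)
    also have "\<dots> \<le> ennreal ((1/4)^k)"
    proof (rule Liminf_le)
      show "\<forall>\<^sub>F j in sequentially. ennreal (L2_sq M (\<lambda>x. s n x - s (r j) x)) \<le> ennreal ((1/4)^k)"
        using eventually_ge_at_top[of k]
      proof (rule eventually_mono)
        fix j assume "k \<le> j"
        then have "r k \<le> r j" using r_mono by (simp add: strict_mono_less_eq)
        then show "ennreal (L2_sq M (\<lambda>x. s n x - s (r j) x)) \<le> ennreal ((1/4)^k)"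
          using r[of k n "r j"] that by (intro ennreal_leI) simp
      qed
    qed simp
    finally show ?thesis .
  qed
  have "(\<lambda>x. s (r 0) x - f x) \<in> L2 M"
    unfolding L2_iff_nn_integral using Fatou[of 0 "r 0"] by (auto intro: le_less_trans)
  from L2_diff[OF s[of "r 0"] this] have f: "f \<in> L2 M" by simp
  have "(\<lambda>n. L2_sq M (\<lambda>x. s n x - f x)) \<longlonglongrightarrow> 0"
  proof (rule LIMSEQ_I)
    fix e :: real assume "0 < e"
    then obtain k where k: "(1/4::real)^k < e" using real_arch_pow_inv[of e "1/4"] by auto
    have "L2_sq M (\<lambda>x. s n x - f x) \<le> (1/4)^k" if "n \<ge> r k" for n
      using Fatou[OF that] by (simp add: nn_integral_L2_sq L2_diff s f)
    then show "\<exists>N. \<forall>n\<ge>N. norm (L2_sq M (\<lambda>x. s n x - f x) - 0) < e"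
      using k by (intro exI[of _ "r k"]) (auto intro: le_less_trans)
  qed
  then show ?thesis using f by blast
qed

section \<open>Orthonormal families: Riesz-Fischer, Bessel, Parseval\<close>

lemma finite_to_nat_less: "finite {k::'k::countable. to_nat k < n}"
  using finite_vimageI[OF finite_lessThan[of n] inj_to_nat[where 'a='k]] by (simp add: vimage_def)

text \<open>Multi-indices carry no natural enumeration. The finite sets \<open>to_nat k < n\<close>
  exhaust any countable type, so that sums over it become limits of sequences, by monotone
  convergence.\<close>

lemma nn_integral_count_space_LIMSEQ:
  fixes f :: "'k::countable \<Rightarrow> ennreal"
  shows "(\<lambda>n. \<Sum>k | to_nat k < n. f k) \<longlonglongrightarrow> (\<integral>\<^sup>+k. f k \<partial>count_space UNIV)"
proof -
  let ?A = "\<lambda>n. {k::'k. to_nat k < n}"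
  have fin: "finite (?A n)" for n by (rule finite_to_nat_less)
  have eq: "(\<Sum>k\<in>?A n. f k) = (\<integral>\<^sup>+k. f k * indicator (?A n) k \<partial>count_space UNIV)" for n
    using fin[of n] by (simp add: nn_integral_count_space_finite nn_integral_count_space_indicator[symmetric])
  have inc: "incseq (\<lambda>n k. f k * indicator (?A n) k)"
    by (auto simp: incseq_def le_fun_def split: split_indicator)
  have "(\<lambda>n. \<integral>\<^sup>+k. f k * indicator (?A n) k \<partial>count_space UNIV)
      \<longlonglongrightarrow> (SUP n. \<integral>\<^sup>+k. f k * indicator (?A n) k \<partial>count_space UNIV)"
    using inc by (intro LIMSEQ_SUP) (auto simp: incseq_def le_fun_def intro!: nn_integral_mono)
  also have "(SUP n. \<integral>\<^sup>+k. f k * indicator (?A n) k \<partial>count_space UNIV)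
      = (\<integral>\<^sup>+k. (SUP n. f k * indicator (?A n) k) \<partial>count_space UNIV)"
    by (rule nn_integral_monotone_convergence_SUP[symmetric, OF inc]) auto
  also have "(\<lambda>k. SUP n. f k * indicator (?A n) k) = f"
  proof
    fix k
    show "(SUP n. f k * indicator (?A n) k) = f k"
    proof (rule antisym)
      show "(SUP n. f k * indicator (?A n) k) \<le> f k"
        by (auto intro!: SUP_least split: split_indicator)
      show "f k \<le> (SUP n. f k * indicator (?A n) k)"
        by (rule SUP_upper2[of "Suc (to_nat k)"]) auto
    qed
  qed
  finally show ?thesis by (simp add: eq)
qed

lemma L2_inner_orthonormal_sum:
  assumes "finite B" "\<And>k. k \<in> B \<Longrightarrow> e k \<in> L2 M" "l \<in> B"
    "\<And>k l. k \<in> B \<Longrightarrow> l \<in> B \<Longrightarrow> L2_inner M (e k) (e l) = (if k = l then 1 else 0)"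
  shows "L2_inner M (\<lambda>x. \<Sum>k\<in>B. c k * e k x) (e l) = c l"
proof -
  have "L2_inner M (\<lambda>x. \<Sum>k\<in>B. c k * e k x) (e l) = (\<Sum>k\<in>B. c k * L2_inner M (e k) (e l))"
    using assms by (simp add: L2_inner_sum_left L2_cmult L2_inner_cmult_left)
  also have "\<dots> = (\<Sum>k\<in>B. if k = l then c k else 0)"
    using assms(3,4) by (intro sum.cong) auto
  finally show ?thesis using assms(1,3) by simp
qed

lemma L2_sq_orthonormal_sum:
  assumes "finite B" "\<And>k. k \<in> B \<Longrightarrow> e k \<in> L2 M"
    "\<And>k l. k \<in> B \<Longrightarrow> l \<in> B \<Longrightarrow> L2_inner M (e k) (e l) = (if k = l then 1 else 0)"
  shows "L2_sq M (\<lambda>x. \<Sum>k\<in>B. c k * e k x) = (\<Sum>k\<in>B. (norm (c k))\<^sup>2)"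
proof -
  let ?s = "\<lambda>x. \<Sum>k\<in>B. c k * e k x"
  have s: "?s \<in> L2 M" by (intro L2_sum L2_cmult assms)
  have 1: "L2_inner M ?s (e l) = c l" if "l \<in> B" for l
    by (rule L2_inner_orthonormal_sum) (use assms that in auto)
  have "L2_inner M ?s ?s = (\<Sum>k\<in>B. c k * L2_inner M (e k) ?s)"
    using assms s by (subst L2_inner_sum_left) (auto simp: L2_inner_cmult_left L2_cmult)
  also have "\<dots> = (\<Sum>k\<in>B. c k * cnj (c k))"
    by (intro sum.cong refl) (simp flip: L2_inner_cnj[of M ?s] add: 1)
  finally have "of_real (L2_sq M ?s) = complex_of_real (\<Sum>k\<in>B. (norm (c k))\<^sup>2)"
    by (simp add: L2_inner_self complex_norm_square del: of_real_power)
  then show ?thesis using of_real_eq_iff by blast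
qed

lemma L2_fibres:
  assumes "sigma_finite_measure Y" "sigma_finite_measure X" and f: "f \<in> L2 (Y \<Otimes>\<^sub>M X)"
  shows "AE y in Y. (\<lambda>x. f (y, x)) \<in> L2 X"
    and "integrable Y (\<lambda>y. L2_sq X (\<lambda>x. f (y, x)))"
    and "(LINT y|Y. L2_sq X (\<lambda>x. f (y, x))) = L2_sq (Y \<Otimes>\<^sub>M X) f"
proof -
  interpret pair_sigma_finite Y X using assms(1,2) by (rule pair_sigma_finite.intro)
  note [measurable] = L2_measurable[OF f]
  have int: "integrable (Y \<Otimes>\<^sub>M X) (\<lambda>p. (norm (f p))\<^sup>2)" by (rule L2_integrable[OF f])
  show "AE y in Y. (\<lambda>x. f (y, x)) \<in> L2 X"
    using AE_integrable_fst'[OF int] AE_space by eventually_elim (auto simp: L2_def)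
  show "integrable Y (\<lambda>y. L2_sq X (\<lambda>x. f (y, x)))"
    using integrable_fst'[OF int] by (simp add: L2_sq_def)
  show "(LINT y|Y. L2_sq X (\<lambda>x. f (y, x))) = L2_sq (Y \<Otimes>\<^sub>M X) f"
    using integral_fst'[OF int] by (simp add: L2_sq_def)
qed

text \<open>The series is summed in the L2 space of the product, so joint measurability of the sum
  is automatic, which summing each fibre separately would not give. The basis may depend on the
  parameter and need be orthonormal for almost every parameter only: the scaled Hermite functions
  degenerate at frequency 0.\<close>

lemma fibre_Riesz_Fischer:
  fixes e :: "'k::countable \<Rightarrow> 'y \<Rightarrow> 'x \<Rightarrow> complex"
  assumes Y: "sigma_finite_measure Y" and X: "sigma_finite_measure X"
    and e_meas: "\<And>k. (\<lambda>(y, x). e k y x) \<in> borel_measurable (Y \<Otimes>\<^sub>M X)"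
    and orth: "AE y in Y. \<forall>k l. e k y \<in> L2 X \<and> L2_inner X (e k y) (e l y) = (if k = l then 1 else 0)"
    and F_meas: "\<And>k. F k \<in> borel_measurable Y"
    and fin: "(\<integral>\<^sup>+k. (\<integral>\<^sup>+y. ennreal ((norm (F k y))\<^sup>2) \<partial>Y) \<partial>count_space UNIV) < \<infinity>"
  obtains \<Psi> where "\<Psi> \<in> L2 (Y \<Otimes>\<^sub>M X)"
    "AE y in Y. (\<lambda>x. \<Psi> (y, x)) \<in> L2 X \<and> (\<forall>k. L2_inner X (\<lambda>x. \<Psi> (y, x)) (e k y) = F k y) \<and>
       (\<integral>\<^sup>+k. ennreal ((norm (F k y))\<^sup>2) \<partial>count_space UNIV) = ennreal (L2_sq X (\<lambda>x. \<Psi> (y, x)))"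
proof -
  interpret pair_sigma_finite Y X using Y X by (rule pair_sigma_finite.intro)
  note [measurable] = F_meas
  have e_meas' [measurable]: "(\<lambda>p. e k (fst p) (snd p)) \<in> borel_measurable (Y \<Otimes>\<^sub>M X)" for k
    using e_meas[of k] by (simp add: case_prod_beta')
  let ?A = "\<lambda>n. {k::'k. to_nat k < n}"
  have finA: "finite (?A n)" for n by (rule finite_to_nat_less)
  define a where "a k = enn2real (\<integral>\<^sup>+y. ennreal ((norm (F k y))\<^sup>2) \<partial>Y)" for k
  have a: "(\<integral>\<^sup>+y. ennreal ((norm (F k y))\<^sup>2) \<partial>Y) = ennreal (a k)" for k
  proof -
    have "(\<integral>\<^sup>+y. ennreal ((norm (F k y))\<^sup>2) \<partial>Y) < \<infinity>"
      using nn_integral_ge_point[of k UNIV "\<lambda>k. \<integral>\<^sup>+y. ennreal ((norm (F k y))\<^sup>2) \<partial>Y"] fin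
      by (auto intro: le_less_trans)
    then show ?thesis by (simp add: a_def)
  qed
  have a0: "a k \<ge> 0" for k by (simp add: a_def)
  define P where "P B p = (\<Sum>k\<in>B. F k (fst p) * e k (fst p) (snd p))" for B p
  have P_meas [measurable]: "P B \<in> borel_measurable (Y \<Otimes>\<^sub>M X)" for B
    unfolding P_def[abs_def] by measurable
  have P_fibre: "AE y in Y. \<forall>B. finite B \<longrightarrow> (\<lambda>x. P B (y, x)) \<in> L2 X \<and>
      L2_sq X (\<lambda>x. P B (y, x)) = (\<Sum>k\<in>B. (norm (F k y))\<^sup>2) \<and>
      (\<forall>l\<in>B. L2_inner X (\<lambda>x. P B (y, x)) (e l y) = F l y)"
    using orth
  proof (rule eventually_mono, intro allI impI)
    fix y and B :: "'k set"
    assume o: "\<forall>k l. e k y \<in> L2 X \<and> L2_inner X (e k y) (e l y) = (if k = l then 1 else 0)"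
      and B: "finite B"
    show "(\<lambda>x. P B (y, x)) \<in> L2 X \<and>
      L2_sq X (\<lambda>x. P B (y, x)) = (\<Sum>k\<in>B. (norm (F k y))\<^sup>2) \<and>
      (\<forall>l\<in>B. L2_inner X (\<lambda>x. P B (y, x)) (e l y) = F l y)"
      using o B unfolding P_def
      by (auto simp: L2_sq_orthonormal_sum intro!: L2_sum L2_cmult L2_inner_orthonormal_sum)
  qed
  have P_nn: "(\<integral>\<^sup>+p. ennreal ((norm (P B p))\<^sup>2) \<partial>(Y \<Otimes>\<^sub>M X)) = ennreal (\<Sum>k\<in>B. a k)" if B: "finite B" for B
  proof -
    have "(\<integral>\<^sup>+p. ennreal ((norm (P B p))\<^sup>2) \<partial>(Y \<Otimes>\<^sub>M X)) = (\<integral>\<^sup>+y. \<integral>\<^sup>+x. ennreal ((norm (P B (y, x)))\<^sup>2) \<partial>X \<partial>Y)"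
      by (rule M2.nn_integral_fst[symmetric]) simp
    also have "\<dots> = (\<integral>\<^sup>+y. (\<Sum>k\<in>B. ennreal ((norm (F k y))\<^sup>2)) \<partial>Y)"
      using P_fibre by (intro nn_integral_cong_AE) (auto elim!: eventually_mono simp: nn_integral_L2_sq B sum_ennreal)
    also have "\<dots> = (\<Sum>k\<in>B. \<integral>\<^sup>+y. ennreal ((norm (F k y))\<^sup>2) \<partial>Y)"
      by (rule nn_integral_sum) simp
    finally show ?thesis using a0 by (simp add: a sum_ennreal)
  qed
  have P_L2: "P B \<in> L2 (Y \<Otimes>\<^sub>M X)" if "finite B" for B
    using P_nn[OF that] by (simp add: L2_iff_nn_integral)
  have P_sq: "L2_sq (Y \<Otimes>\<^sub>M X) (P B) = (\<Sum>k\<in>B. a k)" if "finite B" for B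
    using P_nn[OF that] nn_integral_L2_sq[OF P_L2[OF that]] a0 by (simp add: sum_nonneg)
  define T where "T n = (\<Sum>k\<in>?A n. a k)" for n
  have "(\<lambda>n. ennreal (T n)) \<longlonglongrightarrow> (\<integral>\<^sup>+k. ennreal (a k) \<partial>count_space UNIV)"
    using nn_integral_count_space_LIMSEQ[of "\<lambda>k. ennreal (a k)"] a0 by (simp add: T_def sum_ennreal)
  moreover have "(\<integral>\<^sup>+k. ennreal (a k) \<partial>count_space UNIV) = ennreal (enn2real (\<integral>\<^sup>+k. ennreal (a k) \<partial>count_space UNIV))"
    using fin by (simp add: a)
  ultimately have "T \<longlonglongrightarrow> enn2real (\<integral>\<^sup>+k. ennreal (a k) \<partial>count_space UNIV)"
    by (subst tendsto_ennreal_iff[symmetric]) (auto simp: T_def a0 sum_nonneg)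
  then have T_Cauchy: "Cauchy T" by (rule LIMSEQ_imp_Cauchy)
  define S where "S n = P (?A n)" for n
  have S_L2: "S n \<in> L2 (Y \<Otimes>\<^sub>M X)" for n unfolding S_def by (rule P_L2[OF finA])
  \<comment> \<open>Orthonormality in almost every fibre makes the squared distance of two partial
    sums a difference of the real partial sums T, so Cauchyness is inherited from T.\<close>
  have diff: "L2_sq (Y \<Otimes>\<^sub>M X) (\<lambda>p. S m p - S n p) = T m - T n" if "n \<le> m" for m n
  proof -
    have sub: "?A n \<subseteq> ?A m" using that by auto
    have "(\<lambda>p. S m p - S n p) = P (?A m - ?A n)"
      unfolding S_def P_def fun_eq_iff using finA sub by (simp add: sum_diff)
    then show ?thesis using finA sub by (simp add: P_sq T_def sum_diff)
  qed
  have "\<exists>\<Psi>\<in>L2 (Y \<Otimes>\<^sub>M X). (\<lambda>n. L2_sq (Y \<Otimes>\<^sub>M X) (\<lambda>p. S n p - \<Psi> p)) \<longlonglongrightarrow> 0"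
  proof (rule L2_complete[OF S_L2])
    fix \<epsilon> :: real assume "\<epsilon> > 0"
    then obtain N where N: "\<And>m n. m \<ge> N \<Longrightarrow> n \<ge> N \<Longrightarrow> norm (T m - T n) < \<epsilon>"
      using T_Cauchy unfolding Cauchy_iff by blast
    have "L2_sq (Y \<Otimes>\<^sub>M X) (\<lambda>p. S m p - S n p) < \<epsilon>" if "m \<ge> N" "n \<ge> N" for m n
    proof (cases "n \<le> m")
      case True then show ?thesis using N[OF that] by (simp add: diff)
    next
      case False
      have "L2_sq (Y \<Otimes>\<^sub>M X) (\<lambda>p. S m p - S n p) = L2_sq (Y \<Otimes>\<^sub>M X) (\<lambda>p. S n p - S m p)"
        by (simp add: L2_sq_def norm_minus_commute)
      then show ?thesis using N[OF that] False by (simp add: diff)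
    qed
    then show "\<exists>N. \<forall>m\<ge>N. \<forall>n\<ge>N. L2_sq (Y \<Otimes>\<^sub>M X) (\<lambda>p. S m p - S n p) < \<epsilon>" by blast
  qed
  then obtain \<Psi> where \<Psi>: "\<Psi> \<in> L2 (Y \<Otimes>\<^sub>M X)" and lim: "(\<lambda>n. L2_sq (Y \<Otimes>\<^sub>M X) (\<lambda>p. S n p - \<Psi> p)) \<longlonglongrightarrow> 0"
    by blast
  have D: "(\<lambda>p. S n p - \<Psi> p) \<in> L2 (Y \<Otimes>\<^sub>M X)" for n by (intro L2_diff S_L2 \<Psi>)
  note fib = L2_fibres[OF Y X D]
  \<comment> \<open>Convergence in the product is L1 convergence of the squared fibre distances;
    only a subsequence converges for almost every parameter.\<close>
  have "\<exists>r::nat\<Rightarrow>nat. strict_mono r \<and> (AE y in Y. (\<lambda>n. L2_sq X (\<lambda>x. S (r n) (y, x) - \<Psi> (y, x))) \<longlonglongrightarrow> 0)"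
    using fib(2,3) lim by (intro tendsto_L1_AE_subseq) auto
  then obtain r where r: "strict_mono r"
    and rlim: "AE y in Y. (\<lambda>n. L2_sq X (\<lambda>x. S (r n) (y, x) - \<Psi> (y, x))) \<longlonglongrightarrow> 0" by blast
  have "AE y in Y. (\<lambda>x. \<Psi> (y, x)) \<in> L2 X \<and> (\<forall>k. L2_inner X (\<lambda>x. \<Psi> (y, x)) (e k y) = F k y) \<and>
       (\<integral>\<^sup>+k. ennreal ((norm (F k y))\<^sup>2) \<partial>count_space UNIV) = ennreal (L2_sq X (\<lambda>x. \<Psi> (y, x)))"
    using rlim P_fibre orth L2_fibres(1)[OF Y X \<Psi>]
  proof eventually_elim
    fix y
    assume lim: "(\<lambda>n. L2_sq X (\<lambda>x. S (r n) (y, x) - \<Psi> (y, x))) \<longlonglongrightarrow> 0"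
      and P: "\<forall>B. finite B \<longrightarrow> (\<lambda>x. P B (y, x)) \<in> L2 X \<and>
        L2_sq X (\<lambda>x. P B (y, x)) = (\<Sum>k\<in>B. (norm (F k y))\<^sup>2) \<and>
        (\<forall>l\<in>B. L2_inner X (\<lambda>x. P B (y, x)) (e l y) = F l y)"
      and o: "\<forall>k l. e k y \<in> L2 X \<and> L2_inner X (e k y) (e l y) = (if k = l then 1 else 0)"
      and \<Psi>y: "(\<lambda>x. \<Psi> (y, x)) \<in> L2 X"
    let ?\<Psi> = "\<lambda>x. \<Psi> (y, x)"
    have Sy: "(\<lambda>x. S n (y, x)) \<in> L2 X" for n using P finA by (auto simp: S_def)
    have coef: "L2_inner X ?\<Psi> (e k y) = F k y" for k
    proof (rule LIMSEQ_unique)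
      show "(\<lambda>n. L2_inner X (\<lambda>x. S (r n) (y, x)) (e k y)) \<longlonglongrightarrow> L2_inner X ?\<Psi> (e k y)"
        using o Sy \<Psi>y by (intro L2_inner_tendsto[OF _ _ _ lim]) auto
      show "(\<lambda>n. L2_inner X (\<lambda>x. S (r n) (y, x)) (e k y)) \<longlonglongrightarrow> F k y"
      proof (rule tendsto_eventually)
        show "\<forall>\<^sub>F n in sequentially. L2_inner X (\<lambda>x. S (r n) (y, x)) (e k y) = F k y"
          using eventually_gt_at_top[of "to_nat k"]
        proof eventually_elim
          case (elim n)
          then have "k \<in> ?A (r n)" using seq_suble[OF r, of n] by simp
          then show ?case using P finA unfolding S_def by blast
        qed
      qed
    qed
    \<comment> \<open>Pairing the partial sums with the limit itself gives the norm identity in the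
      fibre: the left side tends to the squared norm of the limit, the right side to the sum of the
      squared coefficients. Completeness of the family does not enter, as the limit lies in its
      closed span.\<close>
    have inner: "L2_inner X (\<lambda>x. S n (y, x)) ?\<Psi> = of_real (\<Sum>k\<in>?A n. (norm (F k y))\<^sup>2)" for n
    proof -
      have "L2_inner X (\<lambda>x. S n (y, x)) ?\<Psi> = (\<Sum>k\<in>?A n. F k y * L2_inner X (e k y) ?\<Psi>)"
        unfolding S_def P_def using o \<Psi>y by (simp add: L2_inner_sum_left L2_cmult L2_inner_cmult_left)
      also have "\<dots> = (\<Sum>k\<in>?A n. F k y * cnj (F k y))"
        by (intro sum.cong refl) (simp flip: L2_inner_cnj[of X ?\<Psi>] add: coef)
      finally show ?thesis by (simp add: complex_norm_square del: of_real_power)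
    qed
    have "(\<lambda>n. L2_inner X (\<lambda>x. S (r n) (y, x)) ?\<Psi>) \<longlonglongrightarrow> L2_inner X ?\<Psi> ?\<Psi>"
      using Sy \<Psi>y by (intro L2_inner_tendsto[OF _ _ _ lim]) auto
    then have "(\<lambda>n. complex_of_real (\<Sum>k\<in>?A (r n). (norm (F k y))\<^sup>2)) \<longlonglongrightarrow> complex_of_real (L2_sq X ?\<Psi>)"
      by (simp only: inner L2_inner_self)
    then have "(\<lambda>n. (\<Sum>k\<in>?A (r n). (norm (F k y))\<^sup>2)) \<longlonglongrightarrow> L2_sq X ?\<Psi>"
      by (simp only: tendsto_of_real_iff)
    then have "(\<lambda>n. ennreal (\<Sum>k\<in>?A (r n). (norm (F k y))\<^sup>2)) \<longlonglongrightarrow> ennreal (L2_sq X ?\<Psi>)"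
      by (rule tendsto_ennrealI)
    moreover have "((\<lambda>n. \<Sum>k\<in>?A n. ennreal ((norm (F k y))\<^sup>2)) \<circ> r)
        \<longlonglongrightarrow> (\<integral>\<^sup>+k. ennreal ((norm (F k y))\<^sup>2) \<partial>count_space UNIV)"
      by (rule LIMSEQ_subseq_LIMSEQ[OF nn_integral_count_space_LIMSEQ r])
    ultimately have "(\<integral>\<^sup>+k. ennreal ((norm (F k y))\<^sup>2) \<partial>count_space UNIV) = ennreal (L2_sq X ?\<Psi>)"
      by (intro LIMSEQ_unique) (simp_all add: sum_ennreal o_def)
    then show "?\<Psi> \<in> L2 X \<and> (\<forall>k. L2_inner X ?\<Psi> (e k y) = F k y) \<and>
       (\<integral>\<^sup>+k. ennreal ((norm (F k y))\<^sup>2) \<partial>count_space UNIV) = ennreal (L2_sq X ?\<Psi>)"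
      using \<Psi>y coef by blast
  qed
  with \<Psi> show thesis by (rule that)
qed

text \<open>The unparametrised theorem is the case of a one-point parameter space.\<close>

lemma Riesz_Fischer:
  fixes e :: "'k::countable \<Rightarrow> 'x \<Rightarrow> complex"
  assumes X: "sigma_finite_measure X"
    and e: "\<And>k. e k \<in> L2 X" and orth: "\<And>k l. L2_inner X (e k) (e l) = (if k = l then 1 else 0)"
    and fin: "(\<integral>\<^sup>+k. ennreal ((norm (c k))\<^sup>2) \<partial>count_space UNIV) < \<infinity>"
  obtains f where "f \<in> L2 X" "\<And>k. L2_inner X f (e k) = c k"
    "(\<integral>\<^sup>+k. ennreal ((norm (c k))\<^sup>2) \<partial>count_space UNIV) = ennreal (L2_sq X f)"
proof -
  let ?Y = "count_space {()}"
  have Y: "sigma_finite_measure ?Y" by (rule sigma_finite_measure_count_space_finite) simp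
  interpret sigma_finite_measure X by (rule X)
  have [measurable]: "e k \<in> borel_measurable X" for k using e L2_measurable by blast
  obtain \<Psi> where "AE y in ?Y. (\<lambda>x. \<Psi> (y, x)) \<in> L2 X \<and> (\<forall>k. L2_inner X (\<lambda>x. \<Psi> (y, x)) (e k) = c k) \<and>
       (\<integral>\<^sup>+k. ennreal ((norm (c k))\<^sup>2) \<partial>count_space UNIV) = ennreal (L2_sq X (\<lambda>x. \<Psi> (y, x)))"
    by (rule fibre_Riesz_Fischer[OF Y X, of "\<lambda>k y. e k" "\<lambda>k y. c k"])
       (use e orth fin in \<open>auto simp: nn_integral_count_space_finite\<close>)
  then have "(\<lambda>x. \<Psi> ((), x)) \<in> L2 X \<and> (\<forall>k. L2_inner X (\<lambda>x. \<Psi> ((), x)) (e k) = c k) \<and>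
       (\<integral>\<^sup>+k. ennreal ((norm (c k))\<^sup>2) \<partial>count_space UNIV) = ennreal (L2_sq X (\<lambda>x. \<Psi> ((), x)))"
    by (simp add: AE_count_space)
  then show thesis by (intro that[of "\<lambda>x. \<Psi> ((), x)"]) auto
qed

text \<open>Cauchy-Schwarz for f and its own partial expansion s: the inner product of s with f and
  the squared norm of s both equal S, so S^2 \<le> S |f|^2, and S cancels.\<close>

lemma Bessel:
  fixes e :: "'k::countable \<Rightarrow> 'x \<Rightarrow> complex"
  assumes e: "\<And>k. e k \<in> L2 X" and orth: "\<And>k l. L2_inner X (e k) (e l) = (if k = l then 1 else 0)"
    and f: "f \<in> L2 X"
  shows "(\<integral>\<^sup>+k. ennreal ((norm (L2_inner X f (e k)))\<^sup>2) \<partial>count_space UNIV) \<le> ennreal (L2_sq X f)"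
proof (rule LIMSEQ_le_const2[OF nn_integral_count_space_LIMSEQ], intro exI allI impI)
  fix n
  let ?A = "{k::'k. to_nat k < n}"
  have finA: "finite ?A" by (rule finite_to_nat_less)
  define S where "S = (\<Sum>k\<in>?A. (norm (L2_inner X f (e k)))\<^sup>2)"
  let ?s = "\<lambda>x. \<Sum>k\<in>?A. L2_inner X f (e k) * e k x"
  have S0: "0 \<le> S" by (simp add: S_def sum_nonneg)
  have s: "?s \<in> L2 X" by (intro L2_sum L2_cmult e)
  have "L2_inner X ?s f = (\<Sum>k\<in>?A. L2_inner X f (e k) * cnj (L2_inner X f (e k)))"
    using e f by (simp add: L2_inner_sum_left L2_cmult L2_inner_cmult_left L2_inner_cnj)
  then have "L2_inner X ?s f = of_real S"
    by (simp add: S_def complex_norm_square del: of_real_power)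
  moreover have "L2_sq X ?s = S"
    unfolding S_def by (rule L2_sq_orthonormal_sum[OF finA e orth])
  ultimately have "S\<^sup>2 \<le> S * L2_sq X f"
    using L2_inner_Cauchy_Schwarz[OF s f] by simp
  then have "S \<le> L2_sq X f"
    using S0 by (cases "S = 0") (auto simp: power2_eq_square)
  then show "(\<Sum>k\<in>?A. ennreal ((norm (L2_inner X f (e k)))\<^sup>2)) \<le> ennreal (L2_sq X f)"
    by (simp add: S_def sum_ennreal ennreal_leI)
qed

text \<open>Riesz-Fischer produces some g with the coefficients of f and with equality of norms;
  completeness forces g = f almost everywhere.\<close>

lemma Parseval:
  fixes e :: "'k::countable \<Rightarrow> 'x \<Rightarrow> complex"
  assumes X: "sigma_finite_measure X"
    and e: "\<And>k. e k \<in> L2 X" and orth: "\<And>k l. L2_inner X (e k) (e l) = (if k = l then 1 else 0)"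
    and complete: "\<And>w. w \<in> L2 X \<Longrightarrow> (\<And>k. L2_inner X w (e k) = 0) \<Longrightarrow> AE x in X. w x = 0"
    and f: "f \<in> L2 X"
  shows "(\<integral>\<^sup>+k. ennreal ((norm (L2_inner X f (e k)))\<^sup>2) \<partial>count_space UNIV) = ennreal (L2_sq X f)"
proof -
  have "(\<integral>\<^sup>+k. ennreal ((norm (L2_inner X f (e k)))\<^sup>2) \<partial>count_space UNIV) < \<infinity>"
    using Bessel[of e X f] e orth f by (auto intro: le_less_trans)
  then obtain g where g: "g \<in> L2 X" "\<And>k. L2_inner X g (e k) = L2_inner X f (e k)"
    and eq: "(\<integral>\<^sup>+k. ennreal ((norm (L2_inner X f (e k)))\<^sup>2) \<partial>count_space UNIV) = ennreal (L2_sq X g)"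
    by (rule Riesz_Fischer[OF X e orth, where c="\<lambda>k. L2_inner X f (e k)"]) (use that in blast)
  have "AE x in X. g x - f x = 0"
    by (rule complete) (auto simp: L2_diff L2_inner_diff_left g f e)
  then have "L2_sq X g = L2_sq X f"
    by (intro L2_sq_cong_AE) (auto simp: L2_measurable g f)
  then show ?thesis by (simp add: eq)
qed

text \<open>Turns the isometry property of a linear map into preservation of inner products; used
  for the Fourier transform and for \<open>calG\<close>.\<close>

lemma L2_inner_polarization:
  assumes "f \<in> L2 M" "g \<in> L2 M"
  shows "4 * L2_inner M f g = of_real (L2_sq M (\<lambda>x. f x + g x) - L2_sq M (\<lambda>x. f x - g x))
     + \<i> * of_real (L2_sq M (\<lambda>x. f x + \<i> * g x) - L2_sq M (\<lambda>x. f x - \<i> * g x))"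
proof -
  have e: "(norm (a + b))\<^sup>2 - (norm (a - b))\<^sup>2 = 4 * Re (a * cnj b)" for a b :: complex
    unfolding cmod_power2 by (simp add: algebra_simps power2_eq_square)
  have 1: "L2_sq M (\<lambda>x. f x + h x) - L2_sq M (\<lambda>x. f x - h x) = 4 * Re (L2_inner M f h)"
    if h: "h \<in> L2 M" for h
  proof -
    have "L2_sq M (\<lambda>x. f x + h x) - L2_sq M (\<lambda>x. f x - h x) = (LINT x|M. 4 * Re (f x * cnj (h x)))"
      unfolding L2_sq_def
      using L2_integrable[OF L2_add[OF assms(1) h]] L2_integrable[OF L2_diff[OF assms(1) h]]
      by (subst Bochner_Integration.integral_diff[symmetric]) (auto simp: e)
    then show ?thesis
      by (simp only: L2_inner_def integral_mult_right_zero integral_Re[OF L2_inner_integrable[OF assms(1) h]])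
  qed
  have 2: "L2_inner M f (\<lambda>x. \<i> * g x) = - \<i> * L2_inner M f g"
    unfolding L2_inner_def by (simp add: mult.left_commute[of _ \<i>])
  show ?thesis
    unfolding 1[OF assms(2)] 1[OF L2_cmult[OF assms(2)]] 2 by (simp add: complex_eq_iff)
qed

section \<open>Hermite functions\<close>

lemma integrable_gaussian: "0 < c \<Longrightarrow> integrable lborel (\<lambda>u::real. exp (- c * u\<^sup>2))"
proof -
  assume c: "0 < c"
  have "exp (- c * u\<^sup>2) = sqrt (pi / c) * normal_density 0 (1 / sqrt (2 * c)) u" for u
    using c by (simp add: normal_density_def real_sqrt_divide real_sqrt_mult power_divide field_simps)
  then show ?thesis using c integrable_normal_density[of "1 / sqrt (2 * c)" 0] by simp
qed

lemma integral_line_derivative_eq_0: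
  fixes F :: "real \<Rightarrow> 'a::euclidean_space"
  assumes F: "\<And>x. (F has_vector_derivative f x) (at x)" and f: "continuous_on UNIV f"
    and int: "integrable lborel f" and top: "(F \<longlongrightarrow> 0) at_top" and bot: "(F \<longlongrightarrow> 0) at_bot"
  shows "(LINT x|lborel. f x) = 0"
proof -
  have "(LBINT x=-\<infinity>..\<infinity>. f x) = 0 - 0"
    using int f
    by (intro interval_integral_FTC_integrable[where F=F] F)
       (auto simp: ereal_tendsto_simps top bot set_integrable_def continuous_on_eq_continuous_at)
  then show ?thesis
    by (simp add: interval_lebesgue_integral_def set_lebesgue_integral_def)
qed

lemma gaussian_decay_limits:
  fixes F :: "real \<Rightarrow> 'a::real_normed_vector"
  assumes "\<And>u. norm (F u) \<le> C * exp (- u\<^sup>2 / 4)"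
  shows "(F \<longlongrightarrow> 0) at_top" "(F \<longlongrightarrow> 0) at_bot"
proof -
  have "((\<lambda>u. C * exp (- u\<^sup>2 / 4)) \<longlongrightarrow> 0) at_top" "((\<lambda>u. C * exp (- u\<^sup>2 / 4)) \<longlongrightarrow> 0) at_bot"
    by real_asymp+
  then show "(F \<longlongrightarrow> 0) at_top" "(F \<longlongrightarrow> 0) at_bot"
    using assms by (auto intro: Lim_null_comparison[rotated])
qed

lemma gaussian_bound_integrable:
  fixes F :: "real \<Rightarrow> 'a::{banach, second_countable_topology}"
  assumes "F \<in> borel_measurable borel" "\<And>u. norm (F u) \<le> C * exp (- u\<^sup>2 / 4)"
  shows "integrable lborel F"
proof -
  have "integrable lborel (\<lambda>u::real. C * exp (- u\<^sup>2 / 4))"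
    using integrable_gaussian[of "1/4"] by simp
  moreover have "norm (F u) \<le> norm (C * exp (- u\<^sup>2 / 4))" for u
    using assms(2)[of u] abs_ge_self[of "C * exp (- u\<^sup>2 / 4)"] unfolding real_norm_def by linarith
  ultimately show ?thesis
    using assms(1) by (intro Bochner_Integration.integrable_bound[of _ "\<lambda>u. C * exp (- u\<^sup>2 / 4)" F] AE_I2) auto
qed

section \<open>Hermite polynomials, their growth and their recurrences\<close>

lemma hermite_poly_Suc:
  "hermite_poly (Suc n) u = 2 * u * hermite_poly n u - 2 * real n * hermite_poly (n - 1) u"
  by (cases n) simp_all

lemma hermite_poly_has_derivative:
  "(hermite_poly n has_real_derivative 2 * real n * hermite_poly (n - 1) u) (at u)"
proof (induction n u rule: hermite_poly.induct)
  case (3 n u)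
  have "((\<lambda>u. 2 * u * hermite_poly (Suc n) u - 2 * real (Suc n) * hermite_poly n u) has_real_derivative
      2 * hermite_poly (Suc n) u + 2 * u * (2 * real (Suc n) * hermite_poly n u)
        - 2 * real (Suc n) * (2 * real n * hermite_poly (n - 1) u)) (at u)"
    using 3 by (auto intro!: derivative_eq_intros)
  also have "2 * hermite_poly (Suc n) u + 2 * u * (2 * real (Suc n) * hermite_poly n u)
        - 2 * real (Suc n) * (2 * real n * hermite_poly (n - 1) u)
      = 2 * real (Suc (Suc n)) * hermite_poly (Suc n) u"
    unfolding hermite_poly_Suc[of n] by (simp add: algebra_simps)
  finally show ?case by simp
qed (auto intro!: derivative_eq_intros)

text \<open>An exponential bound is coarser than a polynomial one but suits the recurrence: the
  factor u is at most e^|u| and raises the rate by one.\<close>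

lemma hermite_poly_exp_bound: "\<exists>C\<ge>0. \<forall>u. \<bar>hermite_poly n u\<bar> \<le> C * exp (real n * \<bar>u\<bar>)"
proof (induction n rule: less_induct)
  case (less n)
  show ?case
  proof (cases n)
    case 0
    then show ?thesis by (intro exI[of _ 1]) auto
  next
    case (Suc m)
    obtain C where C: "C \<ge> 0" "\<And>u. \<bar>hermite_poly m u\<bar> \<le> C * exp (real m * \<bar>u\<bar>)" using less[of m] Suc by auto
    obtain D where D: "D \<ge> 0" "\<And>u. \<bar>hermite_poly (m - 1) u\<bar> \<le> D * exp (real (m - 1) * \<bar>u\<bar>)"
      using less[of "m - 1"] Suc diff_le_self[of m 1] by (metis le_imp_less_Suc)
    have "\<bar>hermite_poly n u\<bar> \<le> (2 * C + 2 * real m * D) * exp (real n * \<bar>u\<bar>)" for u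
    proof -
      have 1: "\<bar>u\<bar> \<le> exp \<bar>u\<bar>" using exp_ge_add_one_self[of "\<bar>u\<bar>"] by linarith
      have "\<bar>u * hermite_poly m u\<bar> \<le> exp \<bar>u\<bar> * (C * exp (real m * \<bar>u\<bar>))"
        unfolding abs_mult by (intro mult_mono 1 C) auto
      also have "\<dots> = C * exp (real n * \<bar>u\<bar>)" by (simp add: Suc exp_add[symmetric] algebra_simps)
      finally have a: "\<bar>u * hermite_poly m u\<bar> \<le> C * exp (real n * \<bar>u\<bar>)" .
      have "\<bar>hermite_poly (m - 1) u\<bar> \<le> D * exp (real n * \<bar>u\<bar>)"
        by (rule order_trans[OF D(2)]) (use D(1) Suc in \<open>auto intro!: mult_left_mono mult_right_mono\<close>)
      then have b: "real m * \<bar>hermite_poly (m - 1) u\<bar> \<le> real m * (D * exp (real n * \<bar>u\<bar>))"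
        by (intro mult_left_mono) auto
      have "\<bar>hermite_poly n u\<bar> \<le> 2 * \<bar>u * hermite_poly m u\<bar> + 2 * (real m * \<bar>hermite_poly (m - 1) u\<bar>)"
        unfolding Suc hermite_poly_Suc by (rule order_trans[OF abs_triangle_ineq4]) (simp add: abs_mult)
      also have "\<dots> \<le> 2 * (C * exp (real n * \<bar>u\<bar>)) + 2 * (real m * (D * exp (real n * \<bar>u\<bar>)))"
        using a b by linarith
      finally show ?thesis by (simp add: algebra_simps)
    qed
    then show ?thesis using C D by (intro exI[of _ "2 * C + 2 * real m * D"]) auto
  qed
qed

text \<open>The Hermite functions without normalisation: in this form all recurrences have rational
  coefficients.\<close>

definition hermite_gauss :: "nat \<Rightarrow> real \<Rightarrow> real" where
  "hermite_gauss n u = hermite_poly n u * exp (- u\<^sup>2 / 2)"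

text \<open>Half of the Gaussian absorbs the growth of the other factors, by a|u| - u^2/2 \<le> a^2
  - u^2/4; this is the origin of the exponent 1/4 in the bounds below.\<close>

lemma hermite_gauss_bound: "\<exists>C\<ge>0. \<forall>u. \<bar>u\<bar> ^ k * \<bar>hermite_gauss n u\<bar> \<le> C * exp (- u\<^sup>2 / 4)"
proof -
  obtain C where C: "C \<ge> 0" "\<And>u. \<bar>hermite_poly n u\<bar> \<le> C * exp (real n * \<bar>u\<bar>)"
    using hermite_poly_exp_bound by blast
  \<comment> \<open>The rate n comes from the polynomial, the rate k from |u|^k \<le>
    e^(k|u|).\<close>
  let ?a = "real (n + k)"
  have "\<bar>u\<bar> ^ k * \<bar>hermite_gauss n u\<bar> \<le> (C * exp (?a\<^sup>2)) * exp (- u\<^sup>2 / 4)" for u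
  proof -
    have "\<bar>u\<bar> \<le> exp \<bar>u\<bar>" using exp_ge_add_one_self[of "\<bar>u\<bar>"] by linarith
    then have "\<bar>u\<bar> ^ k \<le> exp (real k * \<bar>u\<bar>)"
      by (simp add: exp_of_nat_mult power_mono)
    then have "\<bar>u\<bar> ^ k * \<bar>hermite_gauss n u\<bar> \<le> exp (real k * \<bar>u\<bar>) * (C * exp (real n * \<bar>u\<bar>) * exp (- u\<^sup>2 / 2))"
      unfolding hermite_gauss_def abs_mult abs_exp_cancel
      by (intro mult_mono C(2) order_refl) (auto simp: C)
    also have "\<dots> = C * exp (?a * \<bar>u\<bar> - u\<^sup>2 / 2)"
    proof -
      have e: "?a * \<bar>u\<bar> - u\<^sup>2 / 2 = real k * \<bar>u\<bar> + (real n * \<bar>u\<bar> + - u\<^sup>2 / 2)" by (simp add: algebra_simps)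
      show ?thesis unfolding e exp_add by (simp only: mult_ac)
    qed
    also have "\<dots> \<le> C * exp (?a\<^sup>2 - u\<^sup>2 / 4)"
    proof -
      have "a * \<bar>u\<bar> - u\<^sup>2 / 2 \<le> a\<^sup>2 - u\<^sup>2 / 4" for a :: real
        using zero_le_power2[of "a - \<bar>u\<bar> / 2"] by (simp add: power2_diff power_divide)
      then show ?thesis using C(1) by (intro mult_left_mono) auto
    qed
    also have "\<dots> = (C * exp (?a\<^sup>2)) * exp (- u\<^sup>2 / 4)" by (simp add: mult.assoc flip: exp_add)
    finally show ?thesis .
  qed
  then show ?thesis using C(1) by (intro exI[of _ "C * exp (?a\<^sup>2)"]) auto
qed

text \<open>At n = 0 the truncated index \<open>n - 1\<close> does no harm, because its coefficient
  vanishes. The same holds in the recurrences below.\<close>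

lemma hermite_gauss_mult:
  "u * hermite_gauss n u = hermite_gauss (Suc n) u / 2 + real n * hermite_gauss (n - 1) u"
  by (simp add: hermite_gauss_def hermite_poly_Suc field_simps del: hermite_poly.simps)

lemma hermite_gauss_has_derivative:
  "(hermite_gauss n has_real_derivative real n * hermite_gauss (n - 1) u - hermite_gauss (Suc n) u / 2) (at u)"
proof -
  have "(hermite_gauss n has_real_derivative
      2 * real n * hermite_poly (n - 1) u * exp (- u\<^sup>2 / 2) - u * hermite_gauss n u) (at u)"
    unfolding hermite_gauss_def[abs_def]
    by (auto intro!: derivative_eq_intros hermite_poly_has_derivative simp: algebra_simps)
  also have "2 * real n * hermite_poly (n - 1) u * exp (- u\<^sup>2 / 2) - u * hermite_gauss n u
      = real n * hermite_gauss (n - 1) u - hermite_gauss (Suc n) u / 2"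
    unfolding hermite_gauss_mult by (simp add: hermite_gauss_def)
  finally show ?thesis .
qed

lemma hermite_gauss_continuous [continuous_intros]:
  "continuous_on A f \<Longrightarrow> continuous_on A (\<lambda>x. hermite_gauss n (f x))"
  by (rule continuous_on_compose2[of UNIV "hermite_gauss n"])
     (auto intro!: continuous_at_imp_continuous_on DERIV_isCont hermite_gauss_has_derivative)

lemma hermite_gauss_measurable [measurable]: "hermite_gauss n \<in> borel_measurable borel"
  by (intro borel_measurable_continuous_onI continuous_intros)

lemma hermite_gauss_integrable: "integrable lborel (hermite_gauss n)"
proof -
  obtain C where "\<forall>u. \<bar>u\<bar> ^ 0 * \<bar>hermite_gauss n u\<bar> \<le> C * exp (- u\<^sup>2 / 4)"
    using hermite_gauss_bound[of 0 n] by blast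
  then show ?thesis by (intro gaussian_bound_integrable[of _ C]) auto
qed

lemma hermite_gauss_mult_integrable:
  "integrable lborel (\<lambda>u. hermite_gauss n u * hermite_gauss m u)"
  and hermite_gauss_mult_bound:
  "\<exists>C. \<forall>u. \<bar>hermite_gauss n u * hermite_gauss m u\<bar> \<le> C * exp (- u\<^sup>2 / 4)"
proof -
  obtain C where C: "C \<ge> 0" "\<forall>u. \<bar>u\<bar> ^ 0 * \<bar>hermite_gauss n u\<bar> \<le> C * exp (- u\<^sup>2 / 4)"
    using hermite_gauss_bound[of 0 n] by blast
  obtain D where D: "D \<ge> 0" "\<forall>u. \<bar>u\<bar> ^ 0 * \<bar>hermite_gauss m u\<bar> \<le> D * exp (- u\<^sup>2 / 4)"
    using hermite_gauss_bound[of 0 m] by blast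
  have b: "\<bar>hermite_gauss n u * hermite_gauss m u\<bar> \<le> (C * D) * exp (- u\<^sup>2 / 4)" for u
  proof -
    have "\<bar>hermite_gauss n u * hermite_gauss m u\<bar> \<le> (C * exp (- u\<^sup>2 / 4)) * (D * exp (- u\<^sup>2 / 4))"
      unfolding abs_mult using C D by (intro mult_mono) auto
    also have "\<dots> = C * D * (exp (- u\<^sup>2 / 4) * exp (- u\<^sup>2 / 4))" by simp
    also have "\<dots> \<le> C * D * (exp (- u\<^sup>2 / 4) * 1)" using C D by (intro mult_left_mono) auto
    finally show ?thesis by simp
  qed
  show "integrable lborel (\<lambda>u. hermite_gauss n u * hermite_gauss m u)"
    by (rule gaussian_bound_integrable[of _ "C * D"]) (use b in auto)
  show "\<exists>C. \<forall>u. \<bar>hermite_gauss n u * hermite_gauss m u\<bar> \<le> C * exp (- u\<^sup>2 / 4)"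
    using b by blast
qed

section \<open>Orthogonality and Fourier transform of the Hermite functions on the line\<close>

lemma integral_gaussian: "(LINT u|lborel. exp (- u\<^sup>2)) = sqrt pi"
proof -
  have "exp (- u\<^sup>2) = sqrt pi * normal_density 0 (1 / sqrt 2) u" for u
    by (simp add: normal_density_def real_sqrt_divide power_divide)
  then show ?thesis by simp
qed

text \<open>The derivative of g_n g_m integrates to zero, which gives I(n+1, m) = 2m I(n, m-1).
  Together with symmetry and I(0, 0) this determines all values.\<close>

lemma hermite_gauss_orthogonal:
  "(LINT u|lborel. hermite_gauss n u * hermite_gauss m u) = (if n = m then 2 ^ n * fact n * sqrt pi else 0)"
proof -
  define I where "I n m = (LINT u|lborel. hermite_gauss n u * hermite_gauss m u)" for n m
  have comm: "I n m = I m n" for n m by (simp add: I_def mult.commute)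
  have step: "I (Suc n) m = 2 * real m * I n (m - 1)" for n m
  proof -
    let ?g = hermite_gauss
    let ?F = "\<lambda>u. ?g n u * ?g m u"
    let ?f = "\<lambda>u. 2 * real m * (?g n u * ?g (m - 1) u) - ?g (Suc n) u * ?g m u"
    obtain C where C: "\<forall>u. \<bar>?g n u * ?g m u\<bar> \<le> C * exp (- u\<^sup>2 / 4)" using hermite_gauss_mult_bound by blast
    have "(?F has_vector_derivative ?f u) (at u)" for u
    proof -
      have "(?F has_real_derivative (real n * ?g (n - 1) u - ?g (Suc n) u / 2) * ?g m u +
          (real m * ?g (m - 1) u - ?g (Suc m) u / 2) * ?g n u) (at u)"
        by (rule DERIV_mult[OF hermite_gauss_has_derivative hermite_gauss_has_derivative])
      \<comment> \<open>The derivative of g_n is u g_n - g_{n+1} and that of g_m is 2m g_{m-1} - u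
        g_m, so the terms with the factor u cancel.\<close>
      also have "(real n * ?g (n - 1) u - ?g (Suc n) u / 2) * ?g m u +
          (real m * ?g (m - 1) u - ?g (Suc m) u / 2) * ?g n u = ?f u
          + (u * ?g n u) * ?g m u - (u * ?g m u) * ?g n u"
        unfolding hermite_gauss_mult by (simp add: algebra_simps)
      finally show ?thesis
        by (simp add: has_real_derivative_iff_has_vector_derivative algebra_simps)
    qed
    then have "(LINT u|lborel. ?f u) = 0"
      by (rule integral_line_derivative_eq_0)
         (use gaussian_decay_limits[of ?F C] C in
          \<open>auto intro!: continuous_intros Bochner_Integration.integrable_diff integrable_mult_right
             hermite_gauss_mult_integrable\<close>)
    then show ?thesis
      by (simp add: I_def hermite_gauss_mult_integrable)
  qed
  have "I 0 0 = sqrt pi"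
    unfolding I_def hermite_gauss_def using integral_gaussian by (simp add: exp_add[symmetric])
  then have "I n m = (if n = m then 2 ^ n * fact n * sqrt pi else 0)" for n m
  proof (induction n arbitrary: m)
    case 0
    then show ?case using comm[of 0 m] step[of "m - 1" 0] by (cases m) auto
  next
    case (Suc n)
    then show ?case using step[of n m] by (cases m) auto
  qed
  then show ?thesis by (simp add: I_def)
qed

lemma cis_has_vector_derivative:
  "((\<lambda>u. cis (- (\<xi> * u))) has_vector_derivative - \<i> * \<xi> * cis (- (\<xi> * u))) (at u)"
proof -
  have "((\<lambda>u. \<i> * complex_of_real (- (\<xi> * u))) has_vector_derivative - \<i> * \<xi>) (at u)"
    by (auto intro!: derivative_eq_intros simp: has_vector_derivative_def fun_eq_iff scaleR_conv_of_real)
  from field_vector_diff_chain_at[OF this DERIV_exp] show ?thesis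
    by (simp add: cis_conv_exp o_def)
qed

lemma hermite_gauss_cis_integrable:
  "complex_integrable lborel (\<lambda>u. of_real (hermite_gauss n u) * cis (- (\<xi> * u)))"
proof -
  have "complex_integrable lborel (\<lambda>u. complex_of_real (hermite_gauss n u))"
    using hermite_gauss_integrable by simp
  moreover have "(\<lambda>u. complex_of_real (hermite_gauss n u) * cis (- (\<xi> * u))) \<in> borel_measurable lborel"
    by (auto intro!: borel_measurable_continuous_onI continuous_intros)
  ultimately show ?thesis
    by (rule Bochner_Integration.integrable_bound) (simp add: norm_mult)
qed

text \<open>Integrating the derivative of g_n(u) e^(-i \<xi> u) to zero gives a three-term
  recurrence for the transforms, which (-i)^n g_n(\<xi>) satisfies as well. The base case is the
  characteristic function of the standard normal distribution.\<close>

lemma hermite_gauss_fourier: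
  "(LINT u|lborel. of_real (hermite_gauss n u) * cis (- (\<xi> * u)))
     = of_real (sqrt (2 * pi)) * (- \<i>) ^ n * of_real (hermite_gauss n \<xi>)"
proof -
  define J where "J n = (LINT u|lborel. complex_of_real (hermite_gauss n u) * cis (- (\<xi> * u)))" for n
  have J0: "J 0 = of_real (sqrt (2 * pi) * exp (- \<xi>\<^sup>2 / 2))"
  proof -
    have "of_real (exp (- \<xi>\<^sup>2 / 2)) = char std_normal_distribution (- \<xi>)"
      by (simp add: char_std_normal_distribution)
    also have "\<dots> = (LINT u|lborel. std_normal_density u *\<^sub>R iexp (- \<xi> * u))"
      unfolding char_def by (subst integral_density) auto
    also have "\<dots> = (LINT u|lborel. of_real (1 / sqrt (2 * pi)) * (complex_of_real (hermite_gauss 0 u) * cis (- (\<xi> * u))))"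
      by (intro Bochner_Integration.integral_cong refl)
         (simp add: std_normal_density_def hermite_gauss_def cis_conv_exp scaleR_conv_of_real)
    finally show ?thesis by (simp add: J_def field_simps)
  qed
  have step: "J (Suc n) = 2 * real n * J (n - 1) - 2 * \<i> * \<xi> * J n" for n
  proof -
    let ?e = "\<lambda>u. cis (- (\<xi> * u))"
    let ?F = "\<lambda>u. complex_of_real (hermite_gauss n u) * ?e u"
    let ?f = "\<lambda>u. real n * (complex_of_real (hermite_gauss (n - 1) u) * ?e u)
      - 1/2 * (complex_of_real (hermite_gauss (Suc n) u) * ?e u) - \<i> * \<xi> * ?F u"
    obtain C where C: "\<forall>u. \<bar>u\<bar> ^ 0 * \<bar>hermite_gauss n u\<bar> \<le> C * exp (- u\<^sup>2 / 4)"
      using hermite_gauss_bound[of 0 n] by blast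
    have "(?F has_vector_derivative ?f u) (at u)" for u
    proof -
      have 1: "((\<lambda>u. complex_of_real (hermite_gauss n u)) has_vector_derivative
         of_real (real n * hermite_gauss (n - 1) u - hermite_gauss (Suc n) u / 2)) (at u)"
        using hermite_gauss_has_derivative
        by (intro has_vector_derivative_of_real) (simp add: has_real_derivative_iff_has_vector_derivative)
      note 2 = cis_has_vector_derivative[of \<xi> u]
      show ?thesis
        by (rule has_vector_derivative_eq_rhs[OF has_vector_derivative_mult[OF 1 2]])
           (simp add: algebra_simps)
    qed
    then have "(LINT u|lborel. ?f u) = 0"
      by (rule integral_line_derivative_eq_0)
         (use gaussian_decay_limits[of ?F C] C in
          \<open>auto intro!: continuous_intros Bochner_Integration.integrable_diff integrable_mult_right
             hermite_gauss_cis_integrable simp: norm_mult\<close>)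
    then have 0: "real n * J (n - 1) - 1/2 * J (Suc n) - \<i> * \<xi> * J n = 0"
      unfolding J_def by (simp add: hermite_gauss_cis_integrable)
    have "J (Suc n) = 2 * real n * J (n - 1) - 2 * \<i> * \<xi> * J n
        - 2 * (real n * J (n - 1) - 1/2 * J (Suc n) - \<i> * \<xi> * J n)"
      by (simp add: algebra_simps)
    then show ?thesis unfolding 0 by simp
  qed
  have "J n = of_real (sqrt (2 * pi)) * (- \<i>) ^ n * of_real (hermite_gauss n \<xi>)"
  proof (induction n rule: less_induct)
    case (less n)
    show ?case
    proof (cases n)
      case 0
      then show ?thesis using J0 by (simp add: hermite_gauss_def)
    next
      case (Suc m)
      have g: "hermite_gauss n \<xi> = 2 * \<xi> * hermite_gauss m \<xi> - 2 * real m * hermite_gauss (m - 1) \<xi>"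
        unfolding Suc using hermite_gauss_mult[of \<xi> m] by (simp add: algebra_simps)
      \<comment> \<open>Division of (-i)^m by -i; for m = 0 the exponent is truncated, but both
        sides vanish.\<close>
      have m: "real m * (- \<i>) ^ (m - 1) = \<i> * real m * (- \<i>) ^ m"
        by (cases m) (auto simp: algebra_simps)
      have "J n = 2 * real m * (of_real (sqrt (2 * pi)) * (- \<i>) ^ (m - 1) * of_real (hermite_gauss (m - 1) \<xi>))
          - 2 * \<i> * \<xi> * (of_real (sqrt (2 * pi)) * (- \<i>) ^ m * of_real (hermite_gauss m \<xi>))"
        unfolding Suc step using less Suc by simp
      also have "\<dots> = 2 * of_real (sqrt (2 * pi)) * (real m * (- \<i>) ^ (m - 1)) * of_real (hermite_gauss (m - 1) \<xi>)
          - 2 * \<i> * \<xi> * (of_real (sqrt (2 * pi)) * (- \<i>) ^ m * of_real (hermite_gauss m \<xi>))" by simp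
      finally show ?thesis unfolding m g unfolding Suc by (simp add: algebra_simps)
    qed
  qed
  then show ?thesis by (simp add: J_def)
qed

section \<open>Normalised Hermite functions on the line\<close>

lemma hermite_fun_eq:
  "hermite_fun n u = (2 ^ n * fact n * sqrt pi) powr (- 1 / 2) * hermite_gauss n u"
  by (simp add: hermite_fun_def hermite_gauss_def)

lemma hermite_fun_measurable [measurable]: "hermite_fun n \<in> borel_measurable borel"
  unfolding hermite_fun_eq[abs_def] by measurable

lemma hermite_fun_continuous [continuous_intros]:
  "continuous_on A f \<Longrightarrow> continuous_on A (\<lambda>x. hermite_fun n (f x))"
  unfolding hermite_fun_eq by (intro continuous_intros)

lemma hermite_fun_bound: "\<exists>C\<ge>0. \<forall>u. \<bar>u\<bar> ^ k * \<bar>hermite_fun n u\<bar> \<le> C * exp (- u\<^sup>2 / 4)"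
proof -
  let ?c = "(2 ^ n * fact n * sqrt pi) powr (- 1 / 2) :: real"
  obtain C where C: "C \<ge> 0" "\<forall>u. \<bar>u\<bar> ^ k * \<bar>hermite_gauss n u\<bar> \<le> C * exp (- u\<^sup>2 / 4)"
    using hermite_gauss_bound by blast
  have "\<bar>u\<bar> ^ k * \<bar>hermite_fun n u\<bar> \<le> (?c * C) * exp (- u\<^sup>2 / 4)" for u
    using mult_left_mono[OF C(2)[rule_format, of u], of ?c]
    by (simp add: hermite_fun_eq abs_mult mult_ac)
  then show ?thesis using C(1) by (intro exI[of _ "?c * C"]) auto
qed

lemma hermite_fun_mult_integrable: "integrable lborel (\<lambda>u. hermite_fun n u * hermite_fun m u)"
proof -
  have "(\<lambda>u. hermite_fun n u * hermite_fun m u) = (\<lambda>u. ((2 ^ n * fact n * sqrt pi) powr (- 1 / 2) *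
      (2 ^ m * fact m * sqrt pi) powr (- 1 / 2)) * (hermite_gauss n u * hermite_gauss m u))"
    by (simp add: hermite_fun_eq mult_ac)
  then show ?thesis using hermite_gauss_mult_integrable by simp
qed

lemma hermite_fun_orthonormal:
  "(LINT u|lborel. hermite_fun n u * hermite_fun m u) = (if n = m then 1 else 0)"
proof -
  let ?c = "\<lambda>n. (2 ^ n * fact n * sqrt pi) powr (- 1 / 2) :: real"
  have "(LINT u|lborel. hermite_fun n u * hermite_fun m u)
      = (LINT u|lborel. (?c n * ?c m) * (hermite_gauss n u * hermite_gauss m u))"
    by (simp add: hermite_fun_eq mult_ac)
  also have "\<dots> = ?c n * ?c m * (if n = m then 2 ^ n * fact n * sqrt pi else 0)"
    by (simp add: hermite_gauss_orthogonal)
  also have "\<dots> = (if n = m then 1 else 0)"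
    by (auto simp: powr_add[symmetric] powr_minus field_simps)
  finally show ?thesis .
qed

definition hermite_fun_deriv :: "nat \<Rightarrow> real \<Rightarrow> real" where
  "hermite_fun_deriv n u = (2 ^ n * fact n * sqrt pi) powr (- 1 / 2) *
     (real n * hermite_gauss (n - 1) u - hermite_gauss (Suc n) u / 2)"

lemma hermite_fun_has_derivative: "(hermite_fun n has_real_derivative hermite_fun_deriv n u) (at u)"
  unfolding hermite_fun_eq[abs_def] hermite_fun_deriv_def
  by (rule DERIV_cmult[OF hermite_gauss_has_derivative])

text \<open>The eigenvalue equation of the harmonic oscillator. Applying the three-term recurrence
  twice to u^2 g_n and differentiating g_n twice give the same combination of neighbours, up to the
  multiple 2n+1 of g_n.\<close>

lemma hermite_fun_deriv_has_derivative:
  "(hermite_fun_deriv n has_real_derivative (u\<^sup>2 - (2 * real n + 1)) * hermite_fun n u) (at u)"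
proof -
  \<comment> \<open>\<open>Suc (n - 1)\<close> differs from n at n = 0, where the coefficient
    vanishes.\<close>
  have n: "real n * hermite_gauss (Suc (n - 1)) u = real n * hermite_gauss n u" by (cases n) auto
  have "u\<^sup>2 * hermite_gauss n u = u * (u * hermite_gauss n u)" by (simp add: power2_eq_square)
  also have "\<dots> = (u * hermite_gauss (Suc n) u) / 2 + real n * (u * hermite_gauss (n - 1) u)"
    unfolding hermite_gauss_mult[of u n] by (simp add: algebra_simps)
  also have "\<dots> = (hermite_gauss (Suc (Suc n)) u / 2 + real (Suc n) * hermite_gauss n u) / 2
      + real n * (hermite_gauss (Suc (n - 1)) u / 2 + real (n - 1) * hermite_gauss (n - 1 - 1) u)"
    unfolding hermite_gauss_mult by simp
  finally have e: "(u\<^sup>2 - (2 * real n + 1)) * hermite_gauss n u = real n * (real (n - 1) * hermite_gauss (n - 1 - 1) u - hermite_gauss (Suc (n - 1)) u / 2)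
      - (real (Suc n) * hermite_gauss (Suc n - 1) u - hermite_gauss (Suc (Suc n)) u / 2) / 2"
    using n by (cases n) (simp_all add: field_simps)
  have "(hermite_fun_deriv n has_real_derivative (2 ^ n * fact n * sqrt pi) powr (- 1 / 2) *
      (real n * (real (n - 1) * hermite_gauss (n - 1 - 1) u - hermite_gauss (Suc (n - 1)) u / 2)
      - (real (Suc n) * hermite_gauss (Suc n - 1) u - hermite_gauss (Suc (Suc n)) u / 2) / 2)) (at u)"
    unfolding hermite_fun_deriv_def[abs_def]
    by (intro DERIV_cmult DERIV_diff DERIV_cdivide hermite_gauss_has_derivative)
  then show ?thesis unfolding e[symmetric] by (simp add: hermite_fun_eq mult_ac)
qed

lemma hermite_fun_deriv_bound: "\<exists>C\<ge>0. \<forall>u. \<bar>hermite_fun_deriv n u\<bar> \<le> C * exp (- u\<^sup>2 / 4)"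
proof -
  let ?c = "(2 ^ n * fact n * sqrt pi) powr (- 1 / 2) :: real"
  obtain C where C: "C \<ge> 0" "\<forall>u. \<bar>u\<bar> ^ 0 * \<bar>hermite_gauss (n - 1) u\<bar> \<le> C * exp (- u\<^sup>2 / 4)"
    using hermite_gauss_bound by blast
  obtain D where D: "D \<ge> 0" "\<forall>u. \<bar>u\<bar> ^ 0 * \<bar>hermite_gauss (Suc n) u\<bar> \<le> D * exp (- u\<^sup>2 / 4)"
    using hermite_gauss_bound by blast
  have "\<bar>hermite_fun_deriv n u\<bar> \<le> (?c * (real n * C + D / 2)) * exp (- u\<^sup>2 / 4)" for u
  proof -
    have "\<bar>real n * hermite_gauss (n - 1) u - hermite_gauss (Suc n) u / 2\<bar>
        \<le> real n * \<bar>hermite_gauss (n - 1) u\<bar> + \<bar>hermite_gauss (Suc n) u\<bar> / 2"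
      by (rule order_trans[OF abs_triangle_ineq4]) (simp add: abs_mult)
    also have "\<dots> \<le> real n * (C * exp (- u\<^sup>2 / 4)) + D * exp (- u\<^sup>2 / 4) / 2"
      using C D by (intro add_mono mult_left_mono divide_right_mono) auto
    finally have "?c * \<bar>real n * hermite_gauss (n - 1) u - hermite_gauss (Suc n) u / 2\<bar>
        \<le> ?c * (real n * (C * exp (- u\<^sup>2 / 4)) + D * exp (- u\<^sup>2 / 4) / 2)"
      by (rule mult_left_mono) simp
    then show ?thesis
      unfolding hermite_fun_deriv_def abs_mult by (simp add: algebra_simps)
  qed
  then show ?thesis using C(1) D(1) by (intro exI[of _ "?c * (real n * C + D / 2)"]) auto
qed

section \<open>Fourier uniqueness and completeness of the Hermite functions\<close>

lemma cis_measurable [measurable]: "cis \<in> borel_measurable borel"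
  by (intro borel_measurable_continuous_onI continuous_intros)

lemma (in pair_sigma_finite) integrable_tensor:
  fixes f :: "'a \<Rightarrow> complex" and g :: "'b \<Rightarrow> complex"
  assumes "integrable M1 f" "integrable M2 g"
  shows "integrable (M1 \<Otimes>\<^sub>M M2) (\<lambda>p. f (fst p) * g (snd p))"
proof (rule Fubini_integrable)
  have [measurable]: "f \<in> borel_measurable M1" "g \<in> borel_measurable M2" using assms by auto
  show "(\<lambda>p. f (fst p) * g (snd p)) \<in> borel_measurable (M1 \<Otimes>\<^sub>M M2)" by measurable
  show "integrable M1 (\<lambda>x. LINT y|M2. norm (f (fst (x, y)) * g (snd (x, y))))"
    using assms by (simp add: norm_mult)
  show "AE x in M1. integrable M2 (\<lambda>y. f (fst (x, y)) * g (snd (x, y)))"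
    using assms by simp
qed

text \<open>Lebesgue measure is an image of the product measure indexed by \<open>Basis\<close>,
  whereas the product of the functions runs over coordinate indices; the bijection j \<mapsto>
  \<open>axis j 1\<close> matches the two.\<close>

lemma lborel_prod_vec:
  fixes f :: "'m::finite \<Rightarrow> real \<Rightarrow> complex"
  assumes "\<And>j. integrable lborel (f j)"
  shows integrable_lborel_prod_vec: "integrable lborel (\<lambda>x::real^'m. \<Prod>j\<in>UNIV. f j (x $ j))"
    and integral_lborel_prod_vec: "(LINT x|lborel. (\<Prod>j\<in>UNIV. f j ((x::real^'m) $ j))) = (\<Prod>j\<in>UNIV. LINT u|lborel. f j u)"
proof -
  interpret product_sigma_finite "\<lambda>_::real^'m. lborel :: real measure"
    by standard
  define ax where "ax j = (axis j 1 :: real^'m)" for j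
  have inj: "inj ax" by (auto simp: inj_def ax_def axis_eq_axis)
  have B: "Basis = range ax" by (auto simp: Basis_vec_def ax_def)
  define f' where "f' b = f (inv ax b)" for b
  have f'_ax: "f' (ax j) = f j" for j using inj by (simp add: f'_def)
  have [measurable]: "f j \<in> borel_measurable borel" for j using assms[of j] by auto
  let ?T = "\<lambda>g::real^'m \<Rightarrow> real. (\<Sum>b\<in>Basis. g b *\<^sub>R b)"
  have T: "?T \<in> (\<Pi>\<^sub>M b\<in>Basis. lborel) \<rightarrow>\<^sub>M borel" by measurable
  have comp: "?T g $ j = g (ax j)" for g j
  proof -
    have "ax j \<in> Basis" unfolding B by simp
    then show ?thesis
      by (simp add: cart_eq_inner_axis ax_def inner_sum_left_Basis)
  qed
  have eq: "(\<Prod>j\<in>UNIV. f j (?T g $ j)) = (\<Prod>b\<in>Basis. f' b (g b))" for g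
  proof -
    have "(\<Prod>j\<in>UNIV. f j (?T g $ j)) = (\<Prod>j\<in>UNIV. f' (ax j) (g (ax j)))" by (simp only: comp f'_ax)
    then show ?thesis unfolding B prod.reindex[OF inj] by simp
  qed
  have int: "\<And>b. b \<in> Basis \<Longrightarrow> integrable lborel (f' b)" using assms by (simp add: f'_def)
  have m: "(\<lambda>x::real^'m. \<Prod>j\<in>UNIV. f j (x $ j)) \<in> borel_measurable borel" by measurable
  show "integrable lborel (\<lambda>x::real^'m. \<Prod>j\<in>UNIV. f j (x $ j))"
    unfolding lborel_eq[where 'a="real^'m"]
    by (subst integrable_distr_eq[OF T m]) (simp only: eq, intro product_integrable_prod int, auto)
  have "(LINT x|lborel. (\<Prod>j\<in>UNIV. f j ((x::real^'m) $ j))) = (LINT g|(\<Pi>\<^sub>M b\<in>Basis. lborel). (\<Prod>b\<in>Basis. f' b (g b)))"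
    unfolding lborel_eq[where 'a="real^'m"] by (subst integral_distr[OF T m]) (simp only: eq)
  also have "\<dots> = (\<Prod>b\<in>Basis. LINT u|lborel. f' b u)"
    by (rule product_integral_prod) (use int in auto)
  also have "\<dots> = (\<Prod>j\<in>UNIV. LINT u|lborel. f j u)"
    unfolding B prod.reindex[OF inj] by (simp add: f'_ax)
  finally show "(LINT x|lborel. (\<Prod>j\<in>UNIV. f j ((x::real^'m) $ j))) = (\<Prod>j\<in>UNIV. LINT u|lborel. f j u)" .
qed

section \<open>Gaussians in several variables and injectivity of the Fourier transform\<close>

lemma cis_sum: "finite A \<Longrightarrow> cis (\<Sum>j\<in>A. a j) = (\<Prod>j\<in>A. cis (a j))"
  by (induction A rule: finite_induct) (auto simp: cis_mult[symmetric])

lemma norm_vec_sq: "(norm (x::real^'m::finite))\<^sup>2 = (\<Sum>j\<in>UNIV. (x $ j)\<^sup>2)"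
  unfolding power2_norm_eq_inner inner_vec_def by (simp add: power2_eq_square)

lemma exp_norm_vec_sq: "exp (- c * (norm (x::real^'m::finite))\<^sup>2) = (\<Prod>j\<in>UNIV. exp (- c * (x $ j)\<^sup>2))"
  by (simp add: norm_vec_sq sum_distrib_left exp_sum)

lemma integrable_gaussian_vec:
  assumes "0 < c" shows "integrable lborel (\<lambda>x::real^'m::finite. complex_of_real (exp (- c * (norm x)\<^sup>2)))"
  unfolding exp_norm_vec_sq of_real_prod
  by (rule integrable_lborel_prod_vec) (use integrable_gaussian[OF assms] in simp)

lemma hermite_gauss_prod_fourier:
  fixes \<xi> :: "real^'m::finite"
  shows "(LINT x|lborel. of_real (\<Prod>j\<in>UNIV. hermite_gauss (k $ j) (x $ j)) * cis (- (\<xi> \<bullet> x)))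
    = of_real (sqrt (2 * pi)) ^ CARD('m) * (- \<i>) ^ (\<Sum>j\<in>UNIV. k $ j) * of_real (\<Prod>j\<in>UNIV. hermite_gauss (k $ j) (\<xi> $ j))"
proof -
  have "(LINT x|lborel. of_real (\<Prod>j\<in>UNIV. hermite_gauss (k $ j) (x $ j)) * cis (- (\<xi> \<bullet> x)))
      = (LINT x|lborel. (\<Prod>j\<in>UNIV. of_real (hermite_gauss (k $ j) (x $ j)) * cis (- (\<xi> $ j * x $ j))))"
    by (simp add: inner_vec_def sum_negf[symmetric] cis_sum prod.distrib)
  also have "\<dots> = (\<Prod>j\<in>UNIV. LINT u|lborel. of_real (hermite_gauss (k $ j) u) * cis (- (\<xi> $ j * u)))"
    by (rule integral_lborel_prod_vec) (rule hermite_gauss_cis_integrable)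
  also have "\<dots> = (\<Prod>j\<in>UNIV. of_real (sqrt (2 * pi)) * (- \<i>) ^ (k $ j) * of_real (hermite_gauss (k $ j) (\<xi> $ j)))"
    by (simp only: hermite_gauss_fourier)
  finally show ?thesis by (simp add: prod.distrib power_sum)
qed

definition gauss_vec :: "real^'m::finite \<Rightarrow> real" where
  "gauss_vec x = exp (- (norm x)\<^sup>2 / 2)"

lemma gauss_vec_eq: "gauss_vec x = (\<Prod>j\<in>UNIV. hermite_gauss 0 (x $ j))"
  using exp_norm_vec_sq[of "1/2" x] by (simp add: gauss_vec_def hermite_gauss_def)

lemma gauss_vec_measurable [measurable]: "gauss_vec \<in> borel_measurable borel"
  unfolding gauss_vec_def[abs_def] by measurable

lemma gauss_vec_integrable: "complex_integrable lborel (\<lambda>x. of_real (gauss_vec x))"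
  using integrable_gaussian_vec[of "1/2"] by (simp add: gauss_vec_def[abs_def])

lemma gauss_vec_le_1: "0 < gauss_vec x" "gauss_vec x \<le> 1"
  by (auto simp: gauss_vec_def)

lemma gauss_vec_fourier:
  "(LINT x|lborel. of_real (gauss_vec x) * cis (- (\<xi> \<bullet> x)))
    = of_real (sqrt (2 * pi)) ^ CARD('m) * of_real (gauss_vec (\<xi>::real^'m::finite))"
  using hermite_gauss_prod_fourier[of "\<chi> j. 0" \<xi>] by (simp add: gauss_vec_eq)

lemma lborel_integral_affine:
  fixes f :: "'a::euclidean_space \<Rightarrow> complex"
  assumes "f \<in> borel_measurable borel" "c \<noteq> 0"
  shows "(LINT x|lborel. f x) = \<bar>c\<bar> ^ DIM('a) *\<^sub>R (LINT x|lborel. f (t + c *\<^sub>R x))"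
    and "integrable lborel f \<longleftrightarrow> integrable lborel (\<lambda>x. f (t + c *\<^sub>R x))"
proof -
  note [measurable] = assms(1)
  have "(LINT x|lborel. f x) = (LINT x|density (distr lborel borel (\<lambda>x. t + c *\<^sub>R x)) (\<lambda>_. ennreal (\<bar>c\<bar> ^ DIM('a))). f x)"
    using lborel_affine[OF assms(2), of t] by simp
  also have "\<dots> = \<bar>c\<bar> ^ DIM('a) *\<^sub>R (LINT x|lborel. f (t + c *\<^sub>R x))"
    by (subst integral_density) (auto simp: integral_distr)
  finally show "(LINT x|lborel. f x) = \<bar>c\<bar> ^ DIM('a) *\<^sub>R (LINT x|lborel. f (t + c *\<^sub>R x))" .
  have s: "integrable lborel (\<lambda>x. C *\<^sub>R g x) \<longleftrightarrow> integrable lborel g" if "C \<noteq> 0" for C :: real and g :: "'a \<Rightarrow> complex"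
    using integrable_scaleR_right[of "inverse C" lborel "\<lambda>x. C *\<^sub>R g x"] that by auto
  have "integrable lborel f \<longleftrightarrow> integrable (density (distr lborel borel (\<lambda>x. t + c *\<^sub>R x)) (\<lambda>_. ennreal (\<bar>c\<bar> ^ DIM('a)))) f"
    using lborel_affine[OF assms(2), of t] by simp
  also have "\<dots> \<longleftrightarrow> integrable lborel (\<lambda>x. f (t + c *\<^sub>R x))"
    using assms(2) s by (subst integrable_density) (auto simp: integrable_distr_eq)
  finally show "integrable lborel f \<longleftrightarrow> integrable lborel (\<lambda>x. f (t + c *\<^sub>R x))" .
qed

text \<open>Gaussians are superpositions of characters, so \<^term>\<open>v\<close> is orthogonal to all translated and
  rescaled Gaussians; these form an approximate identity.\<close>

lemma fourier_L1_injective: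
  fixes v :: "real^'m::finite \<Rightarrow> complex"
  assumes v: "integrable lborel v" and 0: "\<And>\<xi>. (LINT x|lborel. v x * cis (- (\<xi> \<bullet> x))) = 0"
  shows "AE x in lborel. v x = 0"
proof -
  have [measurable]: "v \<in> borel_measurable borel" using v by auto
  let ?c = "complex_of_real (sqrt (2 * pi)) ^ CARD('m)"
  \<comment> \<open>The Gaussian is replaced by its Fourier integral and the order of integration
    exchanged; the inner integral is then the transform of v at - t \<xi>, which vanishes.\<close>
  have gauss0: "(LINT x|lborel. v x * of_real (gauss_vec (t *\<^sub>R (y - x)))) = 0" for t y
  proof -
    let ?k = "\<lambda>x \<xi>. v x * (of_real (gauss_vec \<xi>) * cis (- ((t *\<^sub>R (y - x)) \<bullet> \<xi>)))"
    have int: "integrable (lborel \<Otimes>\<^sub>M lborel) (case_prod ?k)"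
      by (rule Bochner_Integration.integrable_bound[OF lborel_pair.integrable_tensor[OF v gauss_vec_integrable]])
         (auto simp: norm_mult case_prod_beta' intro!: AE_I2)
    have "?c * (LINT x|lborel. v x * of_real (gauss_vec (t *\<^sub>R (y - x)))) = (LINT x|lborel. v x * (LINT \<xi>|lborel. of_real (gauss_vec \<xi>) * cis (- ((t *\<^sub>R (y - x)) \<bullet> \<xi>))))"
      unfolding gauss_vec_fourier by (simp add: mult_ac flip: integral_mult_right_zero)
    also have "\<dots> = (LINT x|lborel. LINT \<xi>|lborel. ?k x \<xi>)" by simp
    also have "\<dots> = (LINT \<xi>|lborel. LINT x|lborel. ?k x \<xi>)"
      by (rule lborel_pair.Fubini_integral[OF int, symmetric])
    also have "\<dots> = (LINT \<xi>|lborel. of_real (gauss_vec \<xi>) * cis (- (t * (y \<bullet> \<xi>))) * (LINT x|lborel. v x * cis (- ((- t *\<^sub>R \<xi>) \<bullet> x))))"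
    proof (intro Bochner_Integration.integral_cong refl)
      fix \<xi>
      have "?k x \<xi> = of_real (gauss_vec \<xi>) * cis (- (t * (y \<bullet> \<xi>))) * (v x * cis (- ((- t *\<^sub>R \<xi>) \<bullet> x)))" for x
      proof -
        have e: "- ((t *\<^sub>R (y - x)) \<bullet> \<xi>) = - (t * (y \<bullet> \<xi>)) + - ((- t *\<^sub>R \<xi>) \<bullet> x)"
          by (simp add: inner_diff_left inner_commute[of \<xi>] algebra_simps)
        show ?thesis unfolding e cis_mult[symmetric] by simp
      qed
      then show "(LINT x|lborel. ?k x \<xi>) = of_real (gauss_vec \<xi>) * cis (- (t * (y \<bullet> \<xi>))) * (LINT x|lborel. v x * cis (- ((- t *\<^sub>R \<xi>) \<bullet> x)))"
        by (simp only: integral_mult_right_zero)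
    qed
    also have "\<dots> = 0" by (simp only: 0) simp
    finally show ?thesis by simp
  qed
  \<comment> \<open>P n is the indicator of the box smeared by a Gaussian of width 1/t_n, up to its
    mass. It is orthogonal to v, after a substitution and Fubini, and off the boundary of the box, a
    null set, it tends to the indicator times the mass.\<close>
  have box0: "(LINT x|lborel. indicator (box a b) x *\<^sub>R v x) = 0" for a b
  proof -
    let ?A = "box a b"
    let ?G = "(LINT z|lborel. complex_of_real (gauss_vec (z::real^'m)))"
    define t where "t n = real (Suc n)" for n
    have t: "t n > 0" for n by (simp add: t_def)
    define P where "P n x = (LINT z|lborel. indicator ?A (x + (1 / t n) *\<^sub>R z) *\<^sub>R complex_of_real (gauss_vec z))" for n x
    have P0: "(LINT x|lborel. v x * P n x) = 0" for n
    proof -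
      have P: "P n x = (\<bar>t n\<bar> ^ CARD('m)) *\<^sub>R (LINT y|lborel. indicator ?A y *\<^sub>R complex_of_real (gauss_vec (t n *\<^sub>R (y - x))))" for x
      proof -
        have "P n x = \<bar>t n\<bar> ^ DIM(real^'m) *\<^sub>R (LINT z|lborel. indicator ?A (x + (1 / t n) *\<^sub>R (- t n *\<^sub>R x + t n *\<^sub>R z))
            *\<^sub>R complex_of_real (gauss_vec (- t n *\<^sub>R x + t n *\<^sub>R z)))"
          unfolding P_def using t[of n] by (subst lborel_integral_affine(1)[of _ "t n" "- t n *\<^sub>R x"]) auto
        then show ?thesis using t[of n] by (simp add: algebra_simps)
      qed
      let ?k = "\<lambda>x y. v x * (indicator ?A y *\<^sub>R complex_of_real (gauss_vec (t n *\<^sub>R (y - x))))"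
      have ind: "integrable lborel (\<lambda>y. complex_of_real (indicator ?A y))"
        using emeasure_lborel_box_finite[of a b] by (intro integrable_of_real integrable_real_indicator) auto
      have int: "integrable (lborel \<Otimes>\<^sub>M lborel) (case_prod ?k)"
        by (rule Bochner_Integration.integrable_bound[OF lborel_pair.integrable_tensor[OF v ind]])
           (auto simp: norm_mult case_prod_beta' abs_of_pos[OF gauss_vec_le_1(1)] gauss_vec_le_1(2) mult_left_le
             split: split_indicator intro!: AE_I2 mult_left_mono)
      have "(LINT x|lborel. v x * P n x) = (\<bar>t n\<bar> ^ CARD('m)) *\<^sub>R (LINT x|lborel. LINT y|lborel. ?k x y)"
        unfolding P integral_mult_right_zero by simp
      also have "(LINT x|lborel. LINT y|lborel. ?k x y) = (LINT y|lborel. LINT x|lborel. ?k x y)"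
        by (rule lborel_pair.Fubini_integral[OF int, symmetric])
      also have "\<dots> = (LINT y|lborel. indicator ?A y *\<^sub>R (LINT x|lborel. v x * complex_of_real (gauss_vec (t n *\<^sub>R (y - x)))))"
        by (simp flip: integral_scaleR_right)
      also have "\<dots> = 0" by (simp add: gauss0)
      finally show ?thesis by simp
    qed
    have P_lim: "(\<lambda>n. P n x) \<longlonglongrightarrow> indicator ?A x *\<^sub>R ?G" if x: "x \<notin> cbox a b - box a b" for x
      unfolding P_def integral_scaleR_right[symmetric]
    proof (rule integral_dominated_convergence[where w=gauss_vec])
      have t0: "(\<lambda>n. 1 / t n) \<longlonglongrightarrow> 0" unfolding t_def by (rule lim_1_over_n[THEN LIMSEQ_Suc]) 
      have conv: "(\<lambda>n. x + (1 / t n) *\<^sub>R z) \<longlonglongrightarrow> x" for z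
        using tendsto_add[OF tendsto_const tendsto_scaleR[OF t0 tendsto_const], of x z] by simp
      have "(\<lambda>n. indicator ?A (x + (1 / t n) *\<^sub>R z) *\<^sub>R complex_of_real (gauss_vec z))
            \<longlonglongrightarrow> indicator ?A x *\<^sub>R complex_of_real (gauss_vec z)" for z
      proof (cases "x \<in> ?A")
        case True
        then have "\<forall>\<^sub>F n in sequentially. x + (1 / t n) *\<^sub>R z \<in> ?A"
          using topological_tendstoD[OF conv open_box] by blast
        then show ?thesis using True
          by (intro tendsto_eventually) (auto elim!: eventually_mono)
      next
        case False
        then have "x \<in> - cbox a b" using x by auto
        then have "\<forall>\<^sub>F n in sequentially. x + (1 / t n) *\<^sub>R z \<in> - cbox a b"
          using topological_tendstoD[OF conv, of "- cbox a b"] by (simp add: open_Compl closed_cbox)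
        moreover have "indicator ?A y = (0::real)" if "y \<notin> cbox a b" for y
          using that box_subset_cbox[of a b] by (auto simp: indicator_def)
        ultimately show ?thesis using False
          by (intro tendsto_eventually) (auto elim!: eventually_mono)
      qed
      then show "AE z in lborel. (\<lambda>n. indicator ?A (x + (1 / t n) *\<^sub>R z) *\<^sub>R complex_of_real (gauss_vec z))
            \<longlonglongrightarrow> indicator ?A x *\<^sub>R complex_of_real (gauss_vec z)" by auto
      show "integrable lborel gauss_vec"
        using gauss_vec_integrable[THEN integrable_Re] by simp
    qed (auto split: split_indicator simp: less_imp_le[OF gauss_vec_le_1(1)])
    have P_meas [measurable]: "P n \<in> borel_measurable borel" for n
      unfolding P_def[abs_def] by measurable
    have P_bd: "norm (P n x) \<le> (LINT z|lborel. gauss_vec (z::real^'m))" for n x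
      unfolding P_def
    proof (rule Bochner_Integration.integral_norm_bound_integral)
      show g: "integrable lborel (gauss_vec :: real^'m \<Rightarrow> real)"
        using gauss_vec_integrable[THEN integrable_Re] by simp
      show "complex_integrable lborel (\<lambda>z. indicator ?A (x + (1 / t n) *\<^sub>R z) *\<^sub>R complex_of_real (gauss_vec z))"
        by (rule Bochner_Integration.integrable_bound[OF gauss_vec_integrable]) (auto split: split_indicator)
    qed (auto split: split_indicator simp: less_imp_le[OF gauss_vec_le_1(1)])
    have "(\<lambda>n. LINT x|lborel. v x * P n x) \<longlonglongrightarrow> (LINT x|lborel. v x * (indicator ?A x *\<^sub>R ?G))"
    proof (rule integral_dominated_convergence[where w="\<lambda>x. norm (v x) * (LINT z|lborel. gauss_vec (z::real^'m))"])
      have "AE x in lborel. x \<notin> cbox a b - box a b" by (rule AE_not_in[OF null_sets_cbox_Diff_box])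
      then show "AE x in lborel. (\<lambda>n. v x * P n x) \<longlonglongrightarrow> v x * (indicator ?A x *\<^sub>R ?G)"
        by eventually_elim (intro tendsto_mult tendsto_const P_lim)
      show "AE x in lborel. norm (v x * P n x) \<le> norm (v x) * (LINT z|lborel. gauss_vec (z::real^'m))" for n
        by (auto simp: norm_mult intro!: mult_left_mono P_bd)
    qed (use v in auto)
    then have "(LINT x|lborel. v x * (indicator ?A x *\<^sub>R ?G)) = 0"
      unfolding P0 LIMSEQ_const_iff by (rule sym)
    moreover have "(LINT x|lborel. v x * (indicator ?A x *\<^sub>R ?G)) = (LINT x|lborel. indicator ?A x *\<^sub>R v x) * ?G"
      by (simp flip: integral_mult_left_zero)
    moreover have "?G \<noteq> 0" using gauss_vec_fourier[of "0::real^'m"] by (simp add: gauss_vec_def)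
    ultimately show ?thesis by simp
  qed
  \<comment> \<open>Boxes form an intersection-stable generator of the Borel sets. In the complement
    case the integral of v over the whole space is its transform at frequency 0.\<close>
  have "(LINT x:A|lborel. v x) = 0" if "A \<in> sets lborel" for A
  proof -
    let ?G = "range (\<lambda>(a, b). box a b :: (real^'m) set)"
    have b: "B \<in> sets borel" if "B \<in> sigma_sets UNIV ?G" for B
      using that unfolding borel_eq_box by simp
    have "Int_stable ?G" by (auto simp: Int_stable_def box_Int_box)
    moreover have "?G \<subseteq> Pow UNIV" by auto
    moreover have A: "A \<in> sigma_sets UNIV ?G" using that unfolding sets_lborel borel_eq_box by simp
    ultimately show ?thesis using A
    proof (induction rule: sigma_sets_induct_disjoint)
      case (basic A)
      then show ?case using box0 by (auto simp: set_lebesgue_integral_def)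
    next
      case empty
      then show ?case by (simp add: set_lebesgue_integral_def)
    next
      case (compl A)
      note [measurable] = b[OF compl(1)]
      have "(LINT x:UNIV - A|lborel. v x) = (LINT x|lborel. v x - indicator A x *\<^sub>R v x)"
        unfolding set_lebesgue_integral_def
        by (intro Bochner_Integration.integral_cong) (auto split: split_indicator)
      also have "\<dots> = (LINT x|lborel. v x) - (LINT x:A|lborel. v x)"
        unfolding set_lebesgue_integral_def
        by (rule Bochner_Integration.integral_diff) (use v in \<open>auto intro: integrable_mult_indicator\<close>)
      finally show ?case using compl 0[of 0] by simp
    next
      case (union A)
      have [measurable]: "A i \<in> sets borel" for i using union(2) b by blast
      have "(LINT x:(\<Union>i. A i)|lborel. v x) = (\<Sum>i. (LINT x:(A i)|lborel. v x))"
        using union(1) v by (intro lebesgue_integral_countable_add)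
          (auto simp: disjoint_family_on_def set_integrable_def intro!: integrable_mult_indicator)
      moreover have "(LINT x:(A i)|lborel. v x) = 0" for i using union(2) by (intro union(3)) auto
      ultimately show ?case by simp
    qed
  qed
  with v show ?thesis by (intro sigma_finite_measure.density_zero[OF sigma_finite_lborel])
qed

text \<open>A class containing both the square-integrable and the bounded functions. It is needed
  because the Fourier integral of an integrable function is a priori only bounded, yet has to be
  compared with a square-integrable function through its Hermite coefficients.\<close>

definition gaussian_tempered :: "(real^'m::finite \<Rightarrow> complex) \<Rightarrow> bool" where
  "gaussian_tempered w \<longleftrightarrow> w \<in> borel_measurable borel \<and>
     (\<forall>c>0. integrable lborel (\<lambda>x. w x * of_real (exp (- c * (norm x)\<^sup>2))))"

lemma gaussian_tempered_diff:
  assumes "gaussian_tempered f" "gaussian_tempered g"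
  shows "gaussian_tempered (\<lambda>x. f x - g x)"
  using assms unfolding gaussian_tempered_def by (auto simp: left_diff_distrib)

lemma gaussian_L2: "0 < c \<Longrightarrow> (\<lambda>x::real^'m::finite. complex_of_real (exp (- c * (norm x)\<^sup>2))) \<in> L2 lborel"
  using integrable_gaussian_vec[of "2 * c", where 'm='m, THEN integrable_Re]
  by (simp add: L2_def power2_eq_square mult.assoc flip: exp_add)

lemma L2_gaussian_tempered: "f \<in> L2 lborel \<Longrightarrow> gaussian_tempered f"
  unfolding gaussian_tempered_def
  using L2_measurable[of f lborel] L2_mult_integrable[OF _ gaussian_L2] by auto

lemma bounded_gaussian_tempered:
  assumes "f \<in> borel_measurable borel" "\<And>x. norm (f x) \<le> B"
  shows "gaussian_tempered (f :: real^'m::finite \<Rightarrow> complex)"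
  unfolding gaussian_tempered_def
proof (intro conjI allI impI assms(1))
  fix c :: real assume "0 < c"
  have "integrable lborel (\<lambda>x::real^'m. B * complex_of_real (exp (- c * (norm x)\<^sup>2)))"
    using integrable_gaussian_vec[OF \<open>0 < c\<close>, where 'm='m] by simp
  then show "complex_integrable lborel (\<lambda>x. f x * of_real (exp (- c * (norm x)\<^sup>2)))"
    by (rule Bochner_Integration.integrable_bound)
       (use assms order_trans[OF norm_ge_zero assms(2)] in \<open>auto simp: norm_mult\<close>)
qed

text \<open>Polynomials generated from Hermite products, so that orthogonality to the generators
  passes to all members by linearity; the powers of \<xi> \<bullet> x are what has to be
  reached.\<close>

inductive_set hermite_span :: "(real^'m::finite \<Rightarrow> real) set" where
  base: "(\<lambda>x. \<Prod>j\<in>UNIV. hermite_poly (k $ j) (x $ j)) \<in> hermite_span"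
| add: "p \<in> hermite_span \<Longrightarrow> q \<in> hermite_span \<Longrightarrow> (\<lambda>x. p x + q x) \<in> hermite_span"
| scale: "p \<in> hermite_span \<Longrightarrow> (\<lambda>x. c * p x) \<in> hermite_span"

lemma hermite_span_sum:
  assumes "finite A" "A \<noteq> {}" "\<And>i. i \<in> A \<Longrightarrow> p i \<in> hermite_span"
  shows "(\<lambda>x. \<Sum>i\<in>A. p i x) \<in> hermite_span"
  using assms by (induction A rule: finite_ne_induct) (auto intro: hermite_span.add)

text \<open>The three-term recurrence in the i-th coordinate; for \<open>k $ i = 0\<close> the
  lowered index is truncated, but its coefficient is zero.\<close>

lemma hermite_span_mult_coord:
  fixes p :: "real^'m::finite \<Rightarrow> real"
  assumes "p \<in> hermite_span" shows "(\<lambda>x. x $ i * p x) \<in> hermite_span"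
  using assms
proof induction
  case (base k)
  define up where "up = (\<chi> j. if j = i then Suc (k $ j) else k $ j)"
  define dn where "dn = (\<chi> j. if j = i then k $ j - 1 else k $ j)"
  have split: "(\<Prod>j\<in>UNIV. g j) = g i * (\<Prod>j\<in>UNIV - {i}. g j)" for g :: "'m \<Rightarrow> real"
    by (rule prod.remove) auto
  have "x $ i * (\<Prod>j\<in>UNIV. hermite_poly (k $ j) (x $ j)) =
      1 / 2 * (\<Prod>j\<in>UNIV. hermite_poly (up $ j) (x $ j)) + real (k $ i) * (\<Prod>j\<in>UNIV. hermite_poly (dn $ j) (x $ j))" for x :: "real^'m"
    unfolding split by (simp add: up_def dn_def hermite_poly_Suc algebra_simps del: hermite_poly.simps)
  then show ?case by (simp only:) (intro hermite_span.intros)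
next
  case (add p q)
  then show ?case by (auto simp: distrib_left intro: hermite_span.intros)
next
  case (scale p c)
  have "x $ i * (c * p x) = c * (x $ i * p x)" for x by simp
  then show ?case using scale.IH by (simp only:) (rule hermite_span.scale)
qed

lemma hermite_span_inner_power: "(\<lambda>x::real^'m::finite. (\<xi> \<bullet> x) ^ n) \<in> hermite_span"
proof (induction n)
  case 0
  then show ?case using hermite_span.base[of "\<chi> j. 0"] by simp
next
  case (Suc n)
  have "(\<xi> \<bullet> x) ^ Suc n = (\<Sum>i\<in>UNIV. \<xi> $ i * (x $ i * (\<xi> \<bullet> x) ^ n))" for x
    by (simp add: inner_vec_def sum_distrib_right mult.assoc)
  then show ?case
    using Suc by (auto intro!: hermite_span_sum hermite_span.scale hermite_span_mult_coord)
qed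

lemma hermite_gauss_prod_bound:
  "\<exists>C\<ge>0. \<forall>x::real^'m::finite. \<bar>\<Prod>j\<in>UNIV. hermite_gauss (k $ j) (x $ j)\<bar> \<le> C * exp (- (norm x)\<^sup>2 / 4)"
proof -
  have "\<forall>j. \<exists>C. C \<ge> 0 \<and> (\<forall>u. \<bar>u\<bar> ^ 0 * \<bar>hermite_gauss (k $ j) u\<bar> \<le> C * exp (- u\<^sup>2 / 4))"
    using hermite_gauss_bound[of 0] by blast
  from choice[OF this] obtain C where C: "\<And>j. C j \<ge> 0" "\<And>j u. \<bar>hermite_gauss (k $ j) u\<bar> \<le> C j * exp (- u\<^sup>2 / 4)"
    by auto
  have "\<bar>\<Prod>j\<in>UNIV. hermite_gauss (k $ j) (x $ j)\<bar> \<le> (\<Prod>j\<in>UNIV. C j) * exp (- (norm x)\<^sup>2 / 4)" for x :: "real^'m"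
  proof -
    have "\<bar>\<Prod>j\<in>UNIV. hermite_gauss (k $ j) (x $ j)\<bar> \<le> (\<Prod>j\<in>UNIV. C j * exp (- (x $ j)\<^sup>2 / 4))"
      unfolding abs_prod by (intro prod_mono) (use C in auto)
    also have "\<dots> = (\<Prod>j\<in>UNIV. C j) * exp (- (norm x)\<^sup>2 / 4)"
      using exp_norm_vec_sq[of "1/4" x] by (simp add: prod.distrib)
    finally show ?thesis .
  qed
  then show ?thesis using C(1) by (intro exI[of _ "\<Prod>j\<in>UNIV. C j"]) (auto intro: prod_nonneg)
qed

lemma gaussian_tempered_integrable:
  assumes w: "gaussian_tempered w" and g: "g \<in> borel_measurable borel"
    and b: "\<And>x. norm (g x) \<le> C * exp (- c * (norm x)\<^sup>2)" and c: "0 < c"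
  shows "integrable lborel (\<lambda>x. w x * g x)"
proof -
  have [measurable]: "w \<in> borel_measurable borel" "g \<in> borel_measurable borel"
    using w g by (auto simp: gaussian_tempered_def)
  have "integrable lborel (\<lambda>x. C * (w x * complex_of_real (exp (- c * (norm x)\<^sup>2))))"
    using w c by (auto simp: gaussian_tempered_def intro: integrable_mult_right)
  then show ?thesis
  proof (rule Bochner_Integration.integrable_bound)
    show "AE x in lborel. norm (w x * g x) \<le> norm (C * (w x * complex_of_real (exp (- c * (norm x)\<^sup>2))))"
    proof (intro AE_I2)
      fix x
      have "norm (w x) * norm (g x) \<le> norm (w x) * \<bar>C * exp (- c * (norm x)\<^sup>2)\<bar>"
        using b[of x] by (intro mult_left_mono) auto
      then show "norm (w x * g x) \<le> norm (C * (w x * complex_of_real (exp (- c * (norm x)\<^sup>2))))"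
        by (simp add: norm_mult abs_mult mult_ac)
    qed
  qed simp
qed

text \<open>Integrability is carried along the induction because the integral is additive on
  integrable functions only.\<close>

lemma hermite_span_orthogonal:
  fixes w :: "real^'m::finite \<Rightarrow> complex"
  assumes w: "gaussian_tempered w"
    and 0: "\<And>k. (LINT x|lborel. w x * of_real (\<Prod>j\<in>UNIV. hermite_gauss (k $ j) (x $ j))) = 0"
    and p: "p \<in> hermite_span"
  shows "integrable lborel (\<lambda>x. w x * of_real (p x * gauss_vec x)) \<and>
    (LINT x|lborel. w x * of_real (p x * gauss_vec x)) = 0"
  using p
proof induction
  case (base k)
  have e: "(\<Prod>j\<in>UNIV. hermite_poly (k $ j) (x $ j)) * gauss_vec x = (\<Prod>j\<in>UNIV. hermite_gauss (k $ j) (x $ j))" for x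
    by (simp add: gauss_vec_eq hermite_gauss_def prod.distrib)
  obtain C where C: "\<forall>x::real^'m. \<bar>\<Prod>j\<in>UNIV. hermite_gauss (k $ j) (x $ j)\<bar> \<le> C * exp (- (norm x)\<^sup>2 / 4)"
    using hermite_gauss_prod_bound by blast
  have "integrable lborel (\<lambda>x. w x * of_real (\<Prod>j\<in>UNIV. hermite_gauss (k $ j) (x $ j)))"
    by (rule gaussian_tempered_integrable[OF w, of _ C "1/4"]) (use C in \<open>auto simp del: of_real_prod\<close>)
  then show ?case unfolding e using 0 by blast
next
  case (add p q)
  then show ?case by (simp add: distrib_left distrib_right)
next
  case (scale p c)
  have "w x * of_real (c * p x * gauss_vec x) = of_real c * (w x * of_real (p x * gauss_vec x))" for x
    by simp
  then show ?case using scale.IH by (simp only: integral_mult_right_zero) auto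
qed

text \<open>In the transform of w times the Gaussian the character is expanded into its power
  series. Every term is a polynomial of \<open>hermite_span\<close> and integrates to zero, so the
  transform vanishes and L1 injectivity applies.\<close>

lemma hermite_complete_gauss:
  fixes w :: "real^'m::finite \<Rightarrow> complex"
  assumes w: "gaussian_tempered w"
    and 0: "\<And>k. (LINT x|lborel. w x * of_real (\<Prod>j\<in>UNIV. hermite_gauss (k $ j) (x $ j))) = 0"
  shows "AE x in lborel. w x = 0"
proof -
  have w_meas [measurable]: "w \<in> borel_measurable borel" using w by (simp add: gaussian_tempered_def)
  define v where "v x = w x * of_real (gauss_vec x)" for x
  have v: "integrable lborel v"
    unfolding v_def by (rule gaussian_tempered_integrable[OF w, of _ 1 "1/2"]) (auto simp: gauss_vec_def)
  have "(LINT x|lborel. v x * cis (- (\<xi> \<bullet> x))) = 0" for \<xi>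
  proof -
    define s where "s N x = (\<Sum>n<N. ((- \<i>) ^ n / fact n) * (w x * of_real ((\<xi> \<bullet> x) ^ n * gauss_vec x)))" for N x
    note orth = hermite_span_orthogonal[OF w 0 hermite_span_inner_power]
    have s0: "(LINT x|lborel. s N x) = 0" for N
      unfolding s_def using orth[of \<xi>] by (subst Bochner_Integration.integral_sum) auto
    have s_eq: "s N x = v x * (\<Sum>n<N. (\<i> * of_real (- (\<xi> \<bullet> x))) ^ n /\<^sub>R fact n)" for N x
      unfolding s_def v_def sum_distrib_left
      by (intro sum.cong refl)
         (simp add: scaleR_conv_of_real power_mult_distrib field_simps flip: power_mult_distrib)
    have "(\<lambda>N. LINT x|lborel. s N x) \<longlonglongrightarrow> (LINT x|lborel. v x * cis (- (\<xi> \<bullet> x)))"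
    \<comment> \<open>All partial sums of the exponential series are dominated by e^(|\<xi>||x|),
      which the Gaussian inside v makes integrable against w.\<close>
    proof (rule integral_dominated_convergence[where w="\<lambda>x. norm (v x) * exp (norm \<xi> * norm x)"])
      show "AE x in lborel. (\<lambda>N. s N x) \<longlonglongrightarrow> v x * cis (- (\<xi> \<bullet> x))"
      proof (intro AE_I2)
        fix x
        have "(\<lambda>n. (\<i> * of_real (- (\<xi> \<bullet> x))) ^ n /\<^sub>R fact n) sums exp (\<i> * of_real (- (\<xi> \<bullet> x)))"
          by (rule exp_converges)
        then show "(\<lambda>N. s N x) \<longlonglongrightarrow> v x * cis (- (\<xi> \<bullet> x))"
          unfolding s_eq sums_def cis_conv_exp by (intro tendsto_intros)
      qed
      show "AE x in lborel. norm (s N x) \<le> norm (v x) * exp (norm \<xi> * norm x)" for N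
      proof (intro AE_I2)
        fix x
        have "norm (\<Sum>n<N. (\<i> * of_real (- (\<xi> \<bullet> x))) ^ n /\<^sub>R fact n) \<le> (\<Sum>n<N. \<bar>\<xi> \<bullet> x\<bar> ^ n /\<^sub>R fact n)"
          by (rule sum_norm_le) (simp add: norm_power norm_mult)
        also have "\<dots> \<le> exp \<bar>\<xi> \<bullet> x\<bar>"
          unfolding exp_def by (rule sum_le_suminf[OF summable_exp_generic]) auto
        also have "\<dots> \<le> exp (norm \<xi> * norm x)" by (simp add: Cauchy_Schwarz_ineq2)
        finally show "norm (s N x) \<le> norm (v x) * exp (norm \<xi> * norm x)"
          unfolding s_eq norm_mult by (intro mult_left_mono) auto
      qed
      have "integrable lborel (\<lambda>x. w x * of_real (gauss_vec x * exp (norm \<xi> * norm x)))"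
      proof (rule gaussian_tempered_integrable[OF w, of _ "exp ((norm \<xi>)\<^sup>2)" "1/4"])
        fix x :: "real^'m"
        \<comment> \<open>Completing the square trades half of the Gaussian exponent for the
          constant e^(|\<xi>|^2).\<close>
        have "0 \<le> (norm \<xi> - norm x / 2)\<^sup>2" by simp
        then have "- (norm x)\<^sup>2 / 2 + norm \<xi> * norm x \<le> (norm \<xi>)\<^sup>2 + - (1/4) * (norm x)\<^sup>2"
          by (simp add: power2_diff power_divide)
        then show "norm (complex_of_real (gauss_vec x * exp (norm \<xi> * norm x))) \<le> exp ((norm \<xi>)\<^sup>2) * exp (- (1/4) * (norm x)\<^sup>2)"
          by (simp add: gauss_vec_def norm_mult flip: exp_add)
      qed auto
      then show "integrable lborel (\<lambda>x. norm (v x) * exp (norm \<xi> * norm x))"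
        by (drule_tac integrable_norm) (simp add: v_def norm_mult mult.assoc)
      show "(\<lambda>x. v x * cis (- (\<xi> \<bullet> x))) \<in> borel_measurable lborel" "s N \<in> borel_measurable lborel" for N
        unfolding s_def[abs_def] v_def[abs_def] by measurable
    qed
    then show ?thesis by (simp add: s0 LIMSEQ_const_iff)
  qed
  then have "AE x in lborel. v x = 0" by (rule fourier_L1_injective[OF v])
  then show ?thesis by (auto simp: v_def gauss_vec_def)
qed

section \<open>Hermite functions in several variables and their rescalings\<close>

lemma hermite_multi_eq:
  "hermite_multi k x = (\<Prod>j\<in>UNIV. (2 ^ (k $ j) * fact (k $ j) * sqrt pi) powr (- 1 / 2)) * (\<Prod>j\<in>UNIV. hermite_gauss (k $ j) (x $ j))"
  by (simp only: hermite_multi_def hermite_fun_eq prod.distrib)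

lemma hermite_multi_measurable [measurable]: "hermite_multi k \<in> borel_measurable borel"
  unfolding hermite_multi_def[abs_def] by measurable

lemma hermite_multi_bound:
  "\<exists>C\<ge>0. \<forall>x::real^'m::finite. \<bar>hermite_multi k x\<bar> \<le> C * exp (- (norm x)\<^sup>2 / 4)"
proof -
  let ?c = "\<Prod>j\<in>UNIV. (2 ^ (k $ j) * fact (k $ j) * sqrt pi) powr (- 1 / 2) :: real"
  obtain C where C: "C \<ge> 0" "\<forall>x::real^'m. \<bar>\<Prod>j\<in>UNIV. hermite_gauss (k $ j) (x $ j)\<bar> \<le> C * exp (- (norm x)\<^sup>2 / 4)"
    using hermite_gauss_prod_bound by blast
  have "\<bar>hermite_multi k x\<bar> \<le> (\<bar>?c\<bar> * C) * exp (- (norm x)\<^sup>2 / 4)" for x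
    unfolding hermite_multi_eq abs_mult mult.assoc using C by (intro mult_left_mono) auto
  then show ?thesis using C by (intro exI[of _ "\<bar>?c\<bar> * C"]) auto
qed

lemma hermite_multi_complete:
  fixes w :: "real^'m::finite \<Rightarrow> complex"
  assumes "gaussian_tempered w" "\<And>k. (LINT x|lborel. w x * of_real (hermite_multi k x)) = 0"
  shows "AE x in lborel. w x = 0"
proof (rule hermite_complete_gauss[OF assms(1)])
  fix k :: "nat^'m"
  let ?c = "\<Prod>j\<in>UNIV. (2 ^ (k $ j) * fact (k $ j) * sqrt pi) powr (- 1 / 2) :: real"
  have "?c \<noteq> 0" by simp
  have "w x * of_real (\<Prod>j\<in>UNIV. hermite_gauss (k $ j) (x $ j)) = of_real (1 / ?c) * (w x * of_real (hermite_multi k x))" for x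
    using \<open>?c \<noteq> 0\<close> unfolding hermite_multi_eq of_real_mult of_real_divide by (simp only: field_simps) simp
  then have "(LINT x|lborel. w x * of_real (\<Prod>j\<in>UNIV. hermite_gauss (k $ j) (x $ j)))
      = of_real (1 / ?c) * (LINT x|lborel. w x * of_real (hermite_multi k x))"
    by (simp only: integral_mult_right_zero)
  then show "(LINT x|lborel. w x * of_real (\<Prod>j\<in>UNIV. hermite_gauss (k $ j) (x $ j))) = 0"
    by (simp only: assms(2) mult_zero_right)
qed

lemma hermite_multi_integrable: "complex_integrable lborel (\<lambda>x::real^'m::finite. of_real (hermite_multi k x))"
proof -
  obtain C where C: "\<forall>x::real^'m. \<bar>hermite_multi k x\<bar> \<le> C * exp (- (norm x)\<^sup>2 / 4)"
    using hermite_multi_bound by blast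
  have "gaussian_tempered (\<lambda>x::real^'m. 1)" by (rule bounded_gaussian_tempered[of _ 1]) auto
  from gaussian_tempered_integrable[OF this, of "\<lambda>x. of_real (hermite_multi k x)" C "1/4"] C
  show ?thesis by simp
qed

lemma hermite_multi_L2: "(\<lambda>x::real^'m::finite. complex_of_real (hermite_multi k x)) \<in> L2 lborel"
proof -
  obtain C where C: "C \<ge> 0" "\<forall>x::real^'m. \<bar>hermite_multi k x\<bar> \<le> C * exp (- (norm x)\<^sup>2 / 4)"
    using hermite_multi_bound by blast
  have "(\<lambda>x::real^'m. C * complex_of_real (exp (- (1/4) * (norm x)\<^sup>2))) \<in> L2 lborel"
    by (intro L2_cmult gaussian_L2) auto
  then show ?thesis by (rule L2_bound) (use C in \<open>auto simp: norm_mult\<close>)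
qed

lemma hermite_multi_orthonormal:
  fixes k l :: "nat^'m::finite"
  shows "(LINT x|lborel. complex_of_real (hermite_multi k x) * of_real (hermite_multi l x)) = (if k = l then 1 else 0)"
proof -
  have "(LINT x|lborel. complex_of_real (hermite_multi k x) * of_real (hermite_multi l x))
      = (LINT x|lborel. (\<Prod>j\<in>UNIV. complex_of_real (hermite_fun (k $ j) (x $ j) * hermite_fun (l $ j) (x $ j))))"
    by (simp add: hermite_multi_def prod.distrib)
  also have "\<dots> = (\<Prod>j\<in>UNIV. LINT u|lborel. complex_of_real (hermite_fun (k $ j) u * hermite_fun (l $ j) u))"
    by (rule integral_lborel_prod_vec) (intro integrable_of_real hermite_fun_mult_integrable)
  also have "\<dots> = (\<Prod>j\<in>UNIV. if k $ j = l $ j then 1 else 0)"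
    using hermite_fun_orthonormal by (intro prod.cong refl) (simp del: of_real_mult)
  also have "\<dots> = (if k = l then 1 else 0)"
    by (auto simp: vec_eq_iff)
  finally show ?thesis .
qed

lemma hermite_multi_fourier:
  fixes k :: "nat^'m::finite"
  shows "fourier_integral (\<lambda>x. of_real (hermite_multi k x)) \<xi> = (- \<i>) ^ (\<Sum>j\<in>UNIV. k $ j) * of_real (hermite_multi k \<xi>)"
proof -
  let ?c = "\<Prod>j\<in>UNIV. (2 ^ (k $ j) * fact (k $ j) * sqrt pi) powr (- 1 / 2) :: real"
  let ?d = "(2 * pi) powr (- real CARD('m) / 2)"
  have d: "complex_of_real ?d * of_real (sqrt (2 * pi)) ^ CARD('m) = 1"
  proof -
    have "sqrt (2 * pi) ^ CARD('m) = (2 * pi) powr (real CARD('m) / 2)"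
      by (simp add: powr_half_sqrt[symmetric] powr_powr flip: powr_realpow)
    then have "?d * sqrt (2 * pi) ^ CARD('m) = 1" by (simp add: powr_add[symmetric])
    then show ?thesis by (metis of_real_1 of_real_mult of_real_power)
  qed
  have "(LINT x|lborel. of_real (hermite_multi k x) * cis (- (\<xi> \<bullet> x)))
      = (LINT x|lborel. of_real ?c * (of_real (\<Prod>j\<in>UNIV. hermite_gauss (k $ j) (x $ j)) * cis (- (\<xi> \<bullet> x))))"
    by (simp only: hermite_multi_eq of_real_mult mult.assoc)
  also have "\<dots> = of_real ?c * (of_real (sqrt (2 * pi)) ^ CARD('m) * (- \<i>) ^ (\<Sum>j\<in>UNIV. k $ j) * of_real (\<Prod>j\<in>UNIV. hermite_gauss (k $ j) (\<xi> $ j)))"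
    by (simp only: integral_mult_right_zero hermite_gauss_prod_fourier)
  finally have "fourier_integral (\<lambda>x. of_real (hermite_multi k x)) \<xi> = (of_real ?d * of_real (sqrt (2 * pi)) ^ CARD('m)) *
      ((- \<i>) ^ (\<Sum>j\<in>UNIV. k $ j) * (of_real ?c * of_real (\<Prod>j\<in>UNIV. hermite_gauss (k $ j) (\<xi> $ j))))"
    by (simp add: fourier_integral_def)
  then show ?thesis unfolding d hermite_multi_eq by (simp only: of_real_mult mult_1)
qed

lemma hermite_scaled_measurable [measurable]:
  "(\<lambda>x. hermite_scaled k (f x) (g x)) \<in> borel_measurable M"
  if [measurable]: "f \<in> borel_measurable M" "g \<in> borel_measurable M"
  unfolding hermite_scaled_def by measurable

text \<open>The substitution x \<mapsto> x / sqrt \<tau> moves the scale from the Hermite function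
  to f. The Jacobian \<tau>^(-d/2) and the normalisation \<tau>^(d/4) leave \<tau>^(-d/4).
  Orthonormality and completeness at scale \<tau> reduce to scale 1 in this way.\<close>

lemma hermite_scaled_inner:
  fixes f g :: "real^'m::finite \<Rightarrow> complex"
  assumes "f \<in> borel_measurable borel" "0 < \<tau>"
  shows "(LINT x|lborel. f x * of_real (hermite_scaled k \<tau> x))
     = of_real (\<tau> powr (- real CARD('m) / 4)) * (LINT x|lborel. f ((1 / sqrt \<tau>) *\<^sub>R x) * of_real (hermite_multi k x))"
proof -
  note [measurable] = assms(1)
  have s: "(1 / sqrt \<tau>) ^ CARD('m) = \<tau> powr (- real CARD('m) / 2)"
    using assms(2) by (simp add: powr_half_sqrt[symmetric] powr_minus_divide[symmetric] powr_powr flip: powr_realpow)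
  have "(LINT x|lborel. f x * of_real (hermite_scaled k \<tau> x))
     = \<bar>1 / sqrt \<tau>\<bar> ^ DIM(real^'m) *\<^sub>R (LINT x|lborel. f (0 + (1 / sqrt \<tau>) *\<^sub>R x) * of_real (hermite_scaled k \<tau> (0 + (1 / sqrt \<tau>) *\<^sub>R x)))"
    by (rule lborel_integral_affine) (use assms in auto)
  also have "\<dots> = of_real (\<tau> powr (- real CARD('m) / 2)) * (LINT x|lborel. of_real (\<tau> powr (real CARD('m) / 4)) * (f ((1 / sqrt \<tau>) *\<^sub>R x) * of_real (hermite_multi k x)))"
    using assms(2) s by (simp add: hermite_scaled_def scaleR_conv_of_real[where 'a=complex] mult_ac)
  also have "\<dots> = of_real (\<tau> powr (- real CARD('m) / 2) * \<tau> powr (real CARD('m) / 4)) * (LINT x|lborel. f ((1 / sqrt \<tau>) *\<^sub>R x) * of_real (hermite_multi k x))"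
    by simp
  also have "\<tau> powr (- real CARD('m) / 2) * \<tau> powr (real CARD('m) / 4) = \<tau> powr (- real CARD('m) / 4)"
    unfolding powr_add[symmetric] by (rule arg_cong[of _ _ "\<lambda>s. \<tau> powr s"]) simp
  finally show ?thesis .
qed

lemma hermite_scaled_L2:
  fixes k :: "nat^'m::finite"
  assumes "0 < \<tau>" shows "(\<lambda>x. complex_of_real (hermite_scaled k \<tau> x)) \<in> L2 lborel"
proof -
  let ?h = "\<lambda>x::real^'m. complex_of_real ((hermite_multi k x)\<^sup>2)"
  have "integrable lborel ?h"
    using L2_mult_integrable[OF hermite_multi_L2 hermite_multi_L2, of k k] by (simp add: power2_eq_square)
  then have "integrable lborel (\<lambda>x. ?h (0 + sqrt \<tau> *\<^sub>R x))"
    using lborel_integral_affine(2)[of ?h "sqrt \<tau>" 0] assms by simp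
  from integrable_mult_right[OF this[THEN integrable_Re], of "(\<tau> powr (real CARD('m) / 4))\<^sup>2"]
  show ?thesis by (simp add: L2_def hermite_scaled_def norm_mult abs_mult power_mult_distrib)
qed

lemma hermite_scaled_orthonormal:
  fixes k l :: "nat^'m::finite"
  assumes "0 < \<tau>"
  shows "L2_inner lborel (\<lambda>x. of_real (hermite_scaled k \<tau> x)) (\<lambda>x. of_real (hermite_scaled l \<tau> x)) = (if k = l then 1 else 0)"
proof -
  have "L2_inner lborel (\<lambda>x. of_real (hermite_scaled k \<tau> x)) (\<lambda>x. of_real (hermite_scaled l \<tau> x))
     = of_real (\<tau> powr (- real CARD('m) / 4)) * (LINT x|lborel. of_real (hermite_scaled k \<tau> ((1 / sqrt \<tau>) *\<^sub>R x)) * of_real (hermite_multi l x))"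
    unfolding L2_inner_def complex_cnj_complex_of_real by (rule hermite_scaled_inner) (use assms in auto)
  also have "\<dots> = of_real (\<tau> powr (- real CARD('m) / 4)) * (LINT x|lborel. of_real (\<tau> powr (real CARD('m) / 4)) * (of_real (hermite_multi k x) * of_real (hermite_multi l x)))"
    using assms by (simp add: hermite_scaled_def mult.assoc)
  also have "\<dots> = of_real (\<tau> powr (- real CARD('m) / 4) * \<tau> powr (real CARD('m) / 4)) * (LINT x|lborel. of_real (hermite_multi k x) * of_real (hermite_multi l x))"
    by (simp only: integral_mult_right_zero of_real_mult mult.assoc)
  also have "\<tau> powr (- real CARD('m) / 4) * \<tau> powr (real CARD('m) / 4) = 1"
    using assms by (simp add: powr_add[symmetric])
  finally show ?thesis by (simp add: hermite_multi_orthonormal)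
qed

lemma hermite_scaled_complete:
  fixes w :: "real^'m::finite \<Rightarrow> complex"
  assumes "0 < \<tau>" "w \<in> L2 lborel" "\<And>k. L2_inner lborel w (\<lambda>x. of_real (hermite_scaled k \<tau> x)) = 0"
  shows "AE x in lborel. w x = 0"
proof -
  let ?s = "1 / sqrt \<tau>"
  have [measurable]: "w \<in> borel_measurable borel" using L2_measurable[OF assms(2)] by simp
  have "integrable lborel (\<lambda>x. complex_of_real ((norm (w x))\<^sup>2))"
    by (intro integrable_of_real L2_integrable[OF assms(2)])
  then have "integrable lborel (\<lambda>x. complex_of_real ((norm (w (0 + ?s *\<^sub>R x)))\<^sup>2))"
    using lborel_integral_affine(2)[of "\<lambda>x. complex_of_real ((norm (w x))\<^sup>2)" ?s 0] assms(1) by simp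
  from this[THEN integrable_Re] have ws: "(\<lambda>x. w (?s *\<^sub>R x)) \<in> L2 lborel"
    by (simp add: L2_def)
  have "AE x in lborel. w (?s *\<^sub>R x) = 0"
  proof (rule hermite_multi_complete[OF L2_gaussian_tempered[OF ws]])
    fix k
    show "(LINT x|lborel. w (?s *\<^sub>R x) * of_real (hermite_multi k x)) = 0"
      using hermite_scaled_inner[of w \<tau> k] assms(1) assms(3)[of k] by (simp add: L2_inner_def)
  qed
  \<comment> \<open>Vanishing almost everywhere is carried back through the dilation by means of the
    integral of |w|^2.\<close>
  then have "(LINT x|lborel. complex_of_real ((norm (w (0 + ?s *\<^sub>R x)))\<^sup>2)) = 0"
    by (subst integral_cong_AE[where g="\<lambda>_. 0"]) auto
  then have "(LINT x|lborel. complex_of_real ((norm (w x))\<^sup>2)) = 0"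
    using assms(1) by (subst lborel_integral_affine(1)[of _ ?s 0]) auto
  then have "L2_sq lborel w = 0" by (simp add: L2_sq_def del: of_real_power)
  then show ?thesis using L2_sq_eq_0_iff[OF assms(2)] by simp
qed

section \<open>The Fourier transform of square-integrable functions\<close>

abbreviation herm :: "nat^'n::finite \<Rightarrow> real^'n \<Rightarrow> complex" where
  "herm k \<equiv> (\<lambda>x. of_real (hermite_multi k x))"

abbreviation degree_phase :: "nat^'n::finite \<Rightarrow> complex" where
  "degree_phase k \<equiv> (- \<i>) ^ (\<Sum>j\<in>UNIV. k $ j)"

lemma herm_orthonormal: "L2_inner lborel (herm k) (herm l) = (if k = l then 1 else 0)"
  by (simp add: L2_inner_def hermite_multi_orthonormal)

lemma herm_complete:
  assumes "gaussian_tempered w" "\<And>k. L2_inner lborel w (herm k) = 0"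
  shows "AE x in lborel. w x = 0"
  by (rule hermite_multi_complete[OF assms(1)]) (use assms(2) in \<open>simp add: L2_inner_def\<close>)

lemma herm_Parseval:
  "f \<in> L2 lborel \<Longrightarrow> (\<integral>\<^sup>+k. ennreal ((norm (L2_inner lborel f (herm k)))\<^sup>2) \<partial>count_space UNIV) = ennreal (L2_sq lborel f)"
  by (rule Parseval[OF sigma_finite_lborel hermite_multi_L2 herm_orthonormal])
     (auto intro: herm_complete L2_gaussian_tempered)

text \<open>Square integrability is not visible from the integral. Fubini moves the transform onto
  the Hermite function, which yields the coefficients; Riesz-Fischer supplies a square-integrable G
  with these coefficients, and completeness for \<open>gaussian_tempered\<close> functions
  identifies G with the Fourier integral.\<close>

lemma fourier_integral_L1_L2:
  fixes g :: "real^'n::finite \<Rightarrow> complex"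
  assumes int: "integrable lborel g" and L2: "g \<in> L2 lborel"
  shows "fourier_integral g \<in> L2 lborel"
    and "L2_inner lborel (fourier_integral g) (herm k) = degree_phase k * L2_inner lborel g (herm k)"
proof -
  let ?c = "complex_of_real ((2 * pi) powr (- real DIM(real^'n) / 2))"
  have [measurable]: "g \<in> borel_measurable borel" using int by auto
  have F_meas [measurable]: "fourier_integral g \<in> borel_measurable borel"
    unfolding fourier_integral_def[abs_def] by measurable
  have "norm (fourier_integral g \<xi>) \<le> norm ?c * (LINT x|lborel. norm (g x))" for \<xi>
    unfolding fourier_integral_def norm_mult
    by (intro mult_left_mono order_trans[OF integral_norm_bound]) (auto simp: norm_mult)
  then have temp: "gaussian_tempered (fourier_integral g)"
    by (intro bounded_gaussian_tempered) auto
  have coef: "L2_inner lborel (fourier_integral g) (herm k) = degree_phase k * L2_inner lborel g (herm k)" for k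
  proof -
    let ?k = "\<lambda>\<xi> x. g x * cis (- (\<xi> \<bullet> x)) * herm k \<xi>"
    have int2: "integrable (lborel \<Otimes>\<^sub>M lborel) (case_prod ?k)"
      by (rule Bochner_Integration.integrable_bound[OF lborel_pair.integrable_tensor[OF hermite_multi_integrable[of k] int]])
         (auto simp: norm_mult case_prod_beta' intro!: AE_I2)
    have "L2_inner lborel (fourier_integral g) (herm k) = ?c * (LINT \<xi>|lborel. LINT x|lborel. ?k \<xi> x)"
      by (simp add: L2_inner_def fourier_integral_def mult.assoc flip: integral_mult_left_zero)
    also have "(LINT \<xi>|lborel. LINT x|lborel. ?k \<xi> x) = (LINT x|lborel. LINT \<xi>|lborel. ?k \<xi> x)"
      by (rule lborel_pair.Fubini_integral[OF int2, symmetric])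
    also have "?c * \<dots> = (LINT x|lborel. g x * fourier_integral (herm k) x)"
    proof -
      have "?c * (LINT \<xi>|lborel. ?k \<xi> x) = g x * fourier_integral (herm k) x" for x
      proof -
        have "?k \<xi> x = g x * (herm k \<xi> * cis (- (x \<bullet> \<xi>)))" for \<xi>
          by (simp add: inner_commute)
        then have "(LINT \<xi>|lborel. ?k \<xi> x) = g x * (LINT \<xi>|lborel. herm k \<xi> * cis (- (x \<bullet> \<xi>)))"
          by (simp only: integral_mult_right_zero)
        then show ?thesis by (simp only: fourier_integral_def mult.left_commute)
      qed
      then show ?thesis by (simp only: flip: integral_mult_right_zero)
    qed
    also have "\<dots> = degree_phase k * L2_inner lborel g (herm k)"
      by (simp add: hermite_multi_fourier L2_inner_def mult.left_commute[of _ "degree_phase k"])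
    finally show ?thesis .
  qed
  then show "L2_inner lborel (fourier_integral g) (herm k) = degree_phase k * L2_inner lborel g (herm k)" .
  have "(\<integral>\<^sup>+k. ennreal ((norm (degree_phase k * L2_inner lborel g (herm k)))\<^sup>2) \<partial>count_space UNIV) < \<infinity>"
    using herm_Parseval[OF L2] by (simp add: norm_mult norm_power)
  then obtain G where G: "G \<in> L2 lborel" "\<And>k. L2_inner lborel G (herm k) = degree_phase k * L2_inner lborel g (herm k)"
    by (rule Riesz_Fischer[OF sigma_finite_lborel hermite_multi_L2 herm_orthonormal]) (use that in blast)
  have "AE x in lborel. fourier_integral g x - G x = 0"
  proof (rule herm_complete)
    show "gaussian_tempered (\<lambda>x. fourier_integral g x - G x)"
      by (intro gaussian_tempered_diff temp L2_gaussian_tempered G)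
    fix k
    obtain C where C: "\<forall>x::real^'n. \<bar>hermite_multi k x\<bar> \<le> C * exp (- (norm x)\<^sup>2 / 4)"
      using hermite_multi_bound by blast
    have "integrable lborel (\<lambda>x. fourier_integral g x * herm k x)"
      by (rule gaussian_tempered_integrable[OF temp, of _ C "1/4"]) (use C in auto)
    moreover have "integrable lborel (\<lambda>x. G x * herm k x)"
      by (rule L2_mult_integrable[OF G(1) hermite_multi_L2])
    ultimately show "L2_inner lborel (\<lambda>x. fourier_integral g x - G x) (herm k) = 0"
      using coef[of k] G(2)[of k] by (simp add: L2_inner_def left_diff_distrib)
  qed
  then show "fourier_integral g \<in> L2 lborel"
    by (intro L2_cong_AE[OF G(1)]) auto
qed

text \<open>Replaces the limit of truncations by an identity of coefficients, from which Plancherel,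
  uniqueness and linearity follow at once. The truncations are integrable, so their coefficients are
  known; as the phases are unimodular, Parseval makes the distance of their transforms to h equal to
  their own distance to g.\<close>

lemma is_fourier_L2_iff:
  fixes g h :: "real^'n::finite \<Rightarrow> complex"
  shows "is_fourier_L2 g h \<longleftrightarrow> g \<in> L2 lborel \<and> h \<in> L2 lborel \<and>
    (\<forall>k. L2_inner lborel h (herm k) = degree_phase k * L2_inner lborel g (herm k))"
proof (cases "g \<in> L2 lborel \<and> h \<in> L2 lborel")
  case False
  then show ?thesis by (auto simp: is_fourier_L2_def)
next
  case True
  then have g: "g \<in> L2 lborel" and h: "h \<in> L2 lborel" by auto
  have [measurable]: "g \<in> borel_measurable borel" using L2_measurable[OF g] by simp
  define gn where "gn n x = (if x \<in> cball 0 (real n) then g x else 0)" for n x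
  have gn_eq: "gn n = (\<lambda>x. indicator (cball 0 (real n)) x *\<^sub>R g x)" for n
    by (auto simp: gn_def indicator_def)
  have [measurable]: "gn n \<in> borel_measurable borel" for n
    unfolding gn_eq by (intro borel_measurable_scaleR borel_measurable_indicator) auto
  have gn_L2: "gn n \<in> L2 lborel" for n by (rule L2_bound[OF g]) (auto simp: gn_def)
  \<comment> \<open>The indicator of a ball is itself square integrable, hence its product with g is
    integrable.\<close>
  have gn_int: "integrable lborel (gn n)" for n
  proof -
    have "(\<lambda>x::real^'n. complex_of_real (indicator (cball 0 (real n)) x)) \<in> borel_measurable lborel"
      by (intro measurable_compose[OF _ borel_measurable_of_real] borel_measurable_indicator) auto
    then have "(\<lambda>x::real^'n. complex_of_real (indicator (cball 0 (real n)) x)) \<in> L2 lborel"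
      unfolding L2_def using emeasure_lborel_cball_finite[of "0::real^'n" "real n"]
      by (auto simp: power2_eq_square indicator_inter_arith[symmetric] intro!: integrable_real_indicator)
    from L2_mult_integrable[OF g this] show ?thesis
      by (rule Bochner_Integration.integrable_cong[THEN iffD1, rotated -1]) (auto simp: gn_def)
  qed
  have gn_lim: "(\<lambda>n. L2_sq lborel (\<lambda>x. gn n x - g x)) \<longlonglongrightarrow> 0"
  proof -
    have "(\<lambda>n. LINT x|lborel. (norm (gn n x - g x))\<^sup>2) \<longlonglongrightarrow> (LINT x|(lborel :: (real^'n) measure). 0)"
    proof (rule integral_dominated_convergence[where w="\<lambda>x. (norm (g x))\<^sup>2"])
      show "AE x in lborel. (\<lambda>n. (norm (gn n x - g x))\<^sup>2) \<longlonglongrightarrow> 0"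
      proof (intro AE_I2 tendsto_eventually)
        fix x :: "real^'n"
        show "\<forall>\<^sub>F n in sequentially. (norm (gn n x - g x))\<^sup>2 = 0"
          using eventually_ge_at_top[of "nat \<lceil>norm x\<rceil>"]
          by eventually_elim (simp add: gn_def nat_ceiling_le_eq)
      qed
    qed (use L2_integrable[OF g] in \<open>auto simp: gn_def\<close>)
    then show ?thesis by (simp add: L2_sq_def)
  qed
  note F = fourier_integral_L1_L2[OF gn_int gn_L2]
  have eq: "is_fourier_L2 g h \<longleftrightarrow> (\<lambda>n. L2_sq lborel (\<lambda>\<xi>. fourier_integral (gn n) \<xi> - h \<xi>)) \<longlonglongrightarrow> 0"
  proof -
    have "(\<integral>\<^sup>+\<xi>. ennreal ((norm (fourier_integral (\<lambda>x. if x \<in> cball 0 (real n) then g x else 0) \<xi> - h \<xi>))\<^sup>2) \<partial>lborel)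
        = ennreal (L2_sq lborel (\<lambda>\<xi>. fourier_integral (gn n) \<xi> - h \<xi>))" for n
    proof -
      have "(\<lambda>x. if x \<in> cball 0 (real n) then g x else 0) = gn n" by (rule ext) (simp only: gn_def)
      then show ?thesis using nn_integral_L2_sq[OF L2_diff[OF F(1)[of n] h]] by (simp only:)
    qed
    then show ?thesis
      using tendsto_ennreal_iff[of "\<lambda>n. L2_sq lborel (\<lambda>\<xi>. fourier_integral (gn n) \<xi> - h \<xi>)" sequentially 0]
      by (simp add: is_fourier_L2_def g h)
  qed
  show ?thesis
  proof
    assume "is_fourier_L2 g h"
    then have lim: "(\<lambda>n. L2_sq lborel (\<lambda>\<xi>. fourier_integral (gn n) \<xi> - h \<xi>)) \<longlonglongrightarrow> 0" using eq by simp
    have "L2_inner lborel h (herm k) = degree_phase k * L2_inner lborel g (herm k)" for k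
    proof (rule LIMSEQ_unique)
      show "(\<lambda>n. L2_inner lborel (fourier_integral (gn n)) (herm k)) \<longlonglongrightarrow> L2_inner lborel h (herm k)"
        by (rule L2_inner_tendsto[OF F(1) h hermite_multi_L2 lim])
      show "(\<lambda>n. L2_inner lborel (fourier_integral (gn n)) (herm k)) \<longlonglongrightarrow> degree_phase k * L2_inner lborel g (herm k)"
        unfolding F(2) by (intro tendsto_mult tendsto_const L2_inner_tendsto[OF gn_L2 g hermite_multi_L2 gn_lim])
    qed
    then show "g \<in> L2 lborel \<and> h \<in> L2 lborel \<and> (\<forall>k. L2_inner lborel h (herm k) = degree_phase k * L2_inner lborel g (herm k))"
      using g h by blast
  next
    assume "g \<in> L2 lborel \<and> h \<in> L2 lborel \<and> (\<forall>k. L2_inner lborel h (herm k) = degree_phase k * L2_inner lborel g (herm k))"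
    then have c: "L2_inner lborel h (herm k) = degree_phase k * L2_inner lborel g (herm k)" for k by blast
    have "L2_sq lborel (\<lambda>\<xi>. fourier_integral (gn n) \<xi> - h \<xi>) = L2_sq lborel (\<lambda>x. gn n x - g x)" for n
    proof -
      have "norm (L2_inner lborel (\<lambda>\<xi>. fourier_integral (gn n) \<xi> - h \<xi>) (herm k)) = norm (L2_inner lborel (\<lambda>x. gn n x - g x) (herm k))" for k
      proof -
        have "L2_inner lborel (\<lambda>\<xi>. fourier_integral (gn n) \<xi> - h \<xi>) (herm k) = degree_phase k * L2_inner lborel (\<lambda>x. gn n x - g x) (herm k)"
          by (simp add: L2_inner_diff_left F gn_L2 g h hermite_multi_L2 c right_diff_distrib)
        then show ?thesis by (simp add: norm_mult norm_power)
      qed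
      then have "ennreal (L2_sq lborel (\<lambda>\<xi>. fourier_integral (gn n) \<xi> - h \<xi>)) = ennreal (L2_sq lborel (\<lambda>x. gn n x - g x))"
        using herm_Parseval[OF L2_diff[OF F(1)[of n] h]] herm_Parseval[OF L2_diff[OF gn_L2[of n] g]] by simp
      then show ?thesis by simp
    qed
    then show "is_fourier_L2 g h" using gn_lim eq by simp
  qed
qed

lemma is_fourier_L2_sq: "is_fourier_L2 g h \<Longrightarrow> L2_sq lborel h = L2_sq lborel (g :: real^'n::finite \<Rightarrow> complex)"
  using herm_Parseval[of g] herm_Parseval[of h]
  by (simp add: is_fourier_L2_iff norm_mult norm_power)

lemma is_fourier_L2_unique:
  assumes "is_fourier_L2 g h" "is_fourier_L2 g h'"
  shows "AE x in lborel. h x = h' (x::real^'n::finite)"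
proof -
  have "AE x in lborel. h x - h' x = 0"
    by (rule herm_complete)
       (use assms in \<open>auto simp: is_fourier_L2_iff L2_inner_diff_left L2_diff hermite_multi_L2 intro!: L2_gaussian_tempered\<close>)
  then show ?thesis by simp
qed

lemma is_fourier_L2_add_cmult:
  assumes "is_fourier_L2 g h" "is_fourier_L2 g' h'"
  shows "is_fourier_L2 (\<lambda>x. g x + c * g' x) (\<lambda>x::real^'n::finite. h x + c * h' x)"
  using assms
  by (simp add: is_fourier_L2_iff L2_inner_add_left L2_inner_cmult_left L2_add L2_cmult hermite_multi_L2 algebra_simps)

lemma is_fourier_L2_inner:
  assumes "is_fourier_L2 g h" "is_fourier_L2 g' (h' :: real^'n::finite \<Rightarrow> complex)"
  shows "L2_inner lborel h h' = L2_inner lborel g g'"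
proof -
  have L: "g \<in> L2 lborel" "g' \<in> L2 lborel" "h \<in> L2 lborel" "h' \<in> L2 lborel"
    using assms by (auto simp: is_fourier_L2_def)
  have "L2_sq lborel (\<lambda>x. h x + c * h' x) = L2_sq lborel (\<lambda>x. g x + c * g' x)" for c
    by (rule is_fourier_L2_sq[OF is_fourier_L2_add_cmult[OF assms]])
  from this[of 1] this[of "-1"] this[of \<i>] this[of "-\<i>"]
  have "4 * L2_inner lborel h h' = 4 * L2_inner lborel g g'"
    unfolding L2_inner_polarization[OF L(1,2)] L2_inner_polarization[OF L(3,4)] by simp
  then show ?thesis by simp
qed

section \<open>Slices of functions on a product\<close>

lemma L2_lborel_fibres:
  fixes f :: "'a::euclidean_space \<times> 'b::euclidean_space \<Rightarrow> complex"
  assumes "f \<in> L2 lborel"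
  shows "AE y in lborel. (\<lambda>x. f (y, x)) \<in> L2 lborel"
    and "integrable lborel (\<lambda>y. L2_sq lborel (\<lambda>x. f (y, x)))"
    and "(LINT y|lborel. L2_sq lborel (\<lambda>x. f (y, x))) = L2_sq lborel f"
  using L2_fibres[OF sigma_finite_lborel sigma_finite_lborel, of f] assms unfolding lborel_prod by auto

lemma L2_lborel_swap:
  fixes f :: "'a::euclidean_space \<times> 'b::euclidean_space \<Rightarrow> complex"
  assumes f: "f \<in> L2 lborel"
  shows "(\<lambda>(y, x). f (x, y)) \<in> L2 lborel" and "L2_sq lborel (\<lambda>(y, x). f (x, y)) = L2_sq lborel f"
proof -
  have [measurable]: "f \<in> borel_measurable (lborel \<Otimes>\<^sub>M lborel)"
    using L2_measurable[OF f] unfolding lborel_prod .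
  have m: "(\<lambda>(y, x). f (x, y)) \<in> borel_measurable (lborel \<Otimes>\<^sub>M lborel)"
    by measurable
  have eq: "(\<lambda>(y, x). (norm (f (x, y)))\<^sup>2) = (\<lambda>p. (norm ((\<lambda>(y, x). f (x, y)) p))\<^sup>2)"
    by auto
  show "(\<lambda>(y, x). f (x, y)) \<in> L2 lborel"
    using m lborel_pair.integrable_product_swap[of "\<lambda>p. (norm (f p))\<^sup>2"] L2_integrable[OF f]
    unfolding L2_def lborel_prod eq by auto
  show "L2_sq lborel (\<lambda>(y, x). f (x, y)) = L2_sq lborel f"
    using lborel_pair.integral_product_swap[of "\<lambda>p. (norm (f p))\<^sup>2"]
    unfolding L2_sq_def eq lborel_prod[symmetric] by simp
qed

lemma AE_lborel_fibres:
  assumes "AE p in lborel. P p"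
  shows "AE x in lborel. AE y in lborel. P (x::'a::euclidean_space, y::'b::euclidean_space)"
    and "AE y in lborel. AE x in lborel. P (x::'a::euclidean_space, y::'b::euclidean_space)"
proof -
  have "AE p in lborel \<Otimes>\<^sub>M lborel. P p" using assms unfolding lborel_prod .
  then show "AE x in lborel. AE y in lborel. P (x, y)" by (rule lborel_pair.AE_pair)
  have "AE p in lborel \<Otimes>\<^sub>M lborel. (case p of (y, x) \<Rightarrow> P (x, y))"
  proof -
    have "AE p in distr (lborel \<Otimes>\<^sub>M lborel) (lborel \<Otimes>\<^sub>M lborel) (\<lambda>(x, y). (y, x)). P p"
      using \<open>AE p in lborel \<Otimes>\<^sub>M lborel. P p\<close> lborel_pair.distr_pair_swap by metis
    then have "AE p in lborel \<Otimes>\<^sub>M lborel. P ((\<lambda>(x, y). (y, x)) p)"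
      by (rule AE_distrD[rotated]) (rule measurable_pair_swap')
    then show ?thesis by (auto elim!: eventually_mono)
  qed
  from lborel_pair.AE_pair[OF this] show "AE y in lborel. AE x in lborel. P (x, y)" by simp
qed

lemma AE_lborel_pairI:
  fixes f g :: "'a::euclidean_space \<times> 'b::euclidean_space \<Rightarrow> complex"
  assumes "f \<in> borel_measurable lborel" "g \<in> borel_measurable lborel"
    "AE x in lborel. AE y in lborel. f (x, y) = g (x, y)"
  shows "AE p in lborel. f p = g p"
proof -
  have [measurable]: "f \<in> borel_measurable (lborel \<Otimes>\<^sub>M lborel)" "g \<in> borel_measurable (lborel \<Otimes>\<^sub>M lborel)"
    using assms(1,2) unfolding lborel_prod .
  have "AE p in lborel \<Otimes>\<^sub>M lborel. f p = g p"
    by (rule lborel_pair.AE_pair_measure[OF _ assms(3)]) measurable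
  then show ?thesis unfolding lborel_prod .
qed

section \<open>Unitarity of the diagonalising transform\<close>

text \<open>Multiplies the Hermite coefficients of each slice by unimodular numbers. With
  \<open>degree_phase\<close> it yields the partial Fourier transform, with the inverse phases its
  inverse, so existence and surjectivity share one construction.\<close>

lemma fibre_multiplier:
  fixes f :: "'a::euclidean_space \<times> (real^'n::finite) \<Rightarrow> complex"
  assumes f: "f \<in> L2 lborel" and u: "\<And>k. norm (u k) = 1"
  obtains \<Phi> where "\<Phi> \<in> L2 lborel"
    "AE y in lborel. (\<lambda>x. f (y, x)) \<in> L2 lborel \<and> (\<lambda>x. \<Phi> (y, x)) \<in> L2 lborel \<and>
       (\<forall>k. L2_inner lborel (\<lambda>x. \<Phi> (y, x)) (herm k) = u k * L2_inner lborel (\<lambda>x. f (y, x)) (herm k))"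
proof -
  have fm [measurable]: "f \<in> borel_measurable (lborel \<Otimes>\<^sub>M lborel)"
    using L2_measurable[OF f] unfolding lborel_prod .
  define F where "F k y = u k * L2_inner lborel (\<lambda>x. f (y, x)) (herm k)" for k y
  have F_meas: "F k \<in> borel_measurable lborel" for k
    unfolding F_def[abs_def] L2_inner_def complex_cnj_complex_of_real by measurable
  have "(\<integral>\<^sup>+k. (\<integral>\<^sup>+y. ennreal ((norm (F k y))\<^sup>2) \<partial>lborel) \<partial>count_space UNIV)
      = (\<integral>\<^sup>+y. (\<integral>\<^sup>+k. ennreal ((norm (F k y))\<^sup>2) \<partial>count_space UNIV) \<partial>lborel)"
    using F_meas by (intro nn_integral_count_space_nn_integral[symmetric]) auto
  also have "\<dots> = (\<integral>\<^sup>+y. ennreal (L2_sq lborel (\<lambda>x. f (y, x))) \<partial>lborel)"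
    using L2_lborel_fibres(1)[OF f]
    by (intro nn_integral_cong_AE) (auto elim!: eventually_mono simp: F_def norm_mult u herm_Parseval)
  also have "\<dots> = ennreal (L2_sq lborel f)"
    using L2_lborel_fibres(2,3)[OF f] by (subst nn_integral_eq_integral) auto
  finally have fin: "(\<integral>\<^sup>+k. (\<integral>\<^sup>+y. ennreal ((norm (F k y))\<^sup>2) \<partial>lborel) \<partial>count_space UNIV) < \<infinity>" by simp
  have e: "(\<lambda>(y::'a, x). herm k x) \<in> borel_measurable (lborel \<Otimes>\<^sub>M lborel)" for k :: "nat^'n"
    by measurable
  obtain \<Phi> where \<Phi>: "\<Phi> \<in> L2 (lborel \<Otimes>\<^sub>M lborel)"
    "AE y in lborel. (\<lambda>x. \<Phi> (y, x)) \<in> L2 lborel \<and> (\<forall>k. L2_inner lborel (\<lambda>x. \<Phi> (y, x)) (herm k) = F k y) \<and>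
       (\<integral>\<^sup>+k. ennreal ((norm (F k y))\<^sup>2) \<partial>count_space UNIV) = ennreal (L2_sq lborel (\<lambda>x. \<Phi> (y, x)))"
    by (rule fibre_Riesz_Fischer[OF sigma_finite_lborel sigma_finite_lborel e _ F_meas fin])
       (auto simp: hermite_multi_L2 herm_orthonormal)
  show thesis
  proof (rule that)
    show "\<Phi> \<in> L2 lborel" using \<Phi>(1) unfolding lborel_prod .
    show "AE y in lborel. (\<lambda>x. f (y, x)) \<in> L2 lborel \<and> (\<lambda>x. \<Phi> (y, x)) \<in> L2 lborel \<and>
       (\<forall>k. L2_inner lborel (\<lambda>x. \<Phi> (y, x)) (herm k) = u k * L2_inner lborel (\<lambda>x. f (y, x)) (herm k))"
      using \<Phi>(2) L2_lborel_fibres(1)[OF f] by eventually_elim (simp add: F_def)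
  qed
qed

text \<open>Provides the jointly measurable witness without which the choice in the definition would
  say nothing.\<close>

lemma partial_fourier:
  fixes f :: "'a::euclidean_space \<times> (real^'n::finite) \<Rightarrow> complex"
  assumes f: "f \<in> L2 lborel"
  shows partial_fourier_L2: "partial_fourier f \<in> L2 lborel"
    and partial_fourier_fibre: "AE y in lborel. is_fourier_L2 (\<lambda>x. f (y, x)) (\<lambda>\<xi>. partial_fourier f (y, \<xi>))"
proof -
  obtain \<Phi> where "\<Phi> \<in> L2 lborel"
    "AE y in lborel. (\<lambda>x. f (y, x)) \<in> L2 lborel \<and> (\<lambda>x. \<Phi> (y, x)) \<in> L2 lborel \<and>
       (\<forall>k. L2_inner lborel (\<lambda>x. \<Phi> (y, x)) (herm k) = degree_phase k * L2_inner lborel (\<lambda>x. f (y, x)) (herm k))"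
    by (rule fibre_multiplier[OF f, of degree_phase]) (auto simp: norm_power)
  then have "\<exists>\<Phi>. \<Phi> \<in> L2 lborel \<and> (AE y in lborel. is_fourier_L2 (\<lambda>x. f (y, x)) (\<lambda>\<xi>. \<Phi> (y, \<xi>)))"
    by (auto simp: is_fourier_L2_iff)
  from someI_ex[OF this]
  show "partial_fourier f \<in> L2 lborel"
    "AE y in lborel. is_fourier_L2 (\<lambda>x. f (y, x)) (\<lambda>\<xi>. partial_fourier f (y, \<xi>))"
    unfolding partial_fourier_def by auto
qed

text \<open>Any jointly measurable function that is correct on almost every slice is the partial
  transform; linearity, surjectivity and the explicit formula for compactly supported functions all
  come from this.\<close>

lemma partial_fourier_unique:
  fixes f :: "'a::euclidean_space \<times> (real^'n::finite) \<Rightarrow> complex"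
  assumes f: "f \<in> L2 lborel" and \<Phi>: "\<Phi> \<in> borel_measurable lborel"
    and "AE y in lborel. is_fourier_L2 (\<lambda>x. f (y, x)) (\<lambda>\<xi>. \<Phi> (y, \<xi>))"
  shows "AE p in lborel. partial_fourier f p = \<Phi> p"
proof (rule AE_lborel_pairI[OF L2_measurable[OF partial_fourier_L2[OF f]] \<Phi>])
  show "AE y in lborel. AE \<xi> in lborel. partial_fourier f (y, \<xi>) = \<Phi> (y, \<xi>)"
    using assms(3) partial_fourier_fibre[OF f] by eventually_elim (rule is_fourier_L2_unique)
qed

lemma partial_fourier_L2_sq:
  fixes f :: "'a::euclidean_space \<times> (real^'n::finite) \<Rightarrow> complex"
  assumes f: "f \<in> L2 lborel"
  shows "L2_sq lborel (partial_fourier f) = L2_sq lborel f"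
proof -
  have "(LINT y|lborel. L2_sq lborel (\<lambda>\<xi>. partial_fourier f (y, \<xi>))) = (LINT y|lborel. L2_sq lborel (\<lambda>x. f (y, x)))"
    using L2_lborel_fibres(2)[OF f] L2_lborel_fibres(2)[OF partial_fourier_L2[OF f]] partial_fourier_fibre[OF f]
    by (intro integral_cong_AE) (auto elim!: eventually_mono intro: is_fourier_L2_sq)
  then show ?thesis
    by (simp only: L2_lborel_fibres(3)[OF f] L2_lborel_fibres(3)[OF partial_fourier_L2[OF f]])
qed

lemma partial_fourier_add_cmult:
  fixes f g :: "'a::euclidean_space \<times> (real^'n::finite) \<Rightarrow> complex"
  assumes f: "f \<in> L2 lborel" and g: "g \<in> L2 lborel"
  shows "AE p in lborel. partial_fourier (\<lambda>x. f x + c * g x) p = partial_fourier f p + c * partial_fourier g p"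
proof (rule partial_fourier_unique[OF L2_add[OF f L2_cmult[OF g]]])
  show "(\<lambda>p. partial_fourier f p + c * partial_fourier g p) \<in> borel_measurable lborel"
    by (intro L2_measurable L2_add L2_cmult partial_fourier_L2 f g)
  show "AE y in lborel. is_fourier_L2 (\<lambda>x. f (y, x) + c * g (y, x))
     (\<lambda>\<xi>. partial_fourier f (y, \<xi>) + c * partial_fourier g (y, \<xi>))"
    using partial_fourier_fibre[OF f] partial_fourier_fibre[OF g]
    by eventually_elim (rule is_fourier_L2_add_cmult)
qed

lemma partial_fourier_surj:
  fixes \<Psi> :: "'a::euclidean_space \<times> (real^'n::finite) \<Rightarrow> complex"
  assumes \<Psi>: "\<Psi> \<in> L2 lborel"
  obtains f where "f \<in> L2 lborel" "AE p in lborel. partial_fourier f p = \<Psi> p"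
proof -
  obtain f where f: "f \<in> L2 lborel"
    "AE y in lborel. (\<lambda>x. \<Psi> (y, x)) \<in> L2 lborel \<and> (\<lambda>x. f (y, x)) \<in> L2 lborel \<and>
       (\<forall>k. L2_inner lborel (\<lambda>x. f (y, x)) (herm k) = inverse (degree_phase k) * L2_inner lborel (\<lambda>x. \<Psi> (y, x)) (herm k))"
    by (rule fibre_multiplier[OF \<Psi>, of "\<lambda>k. inverse (degree_phase k)"]) (auto simp: norm_power norm_inverse)
  from f(2) have "AE y in lborel. is_fourier_L2 (\<lambda>x. f (y, x)) (\<lambda>\<xi>. \<Psi> (y, \<xi>))"
    by eventually_elim (simp add: is_fourier_L2_iff)
  then have "AE p in lborel. partial_fourier f p = \<Psi> p"
    by (rule partial_fourier_unique[OF f(1) L2_measurable[OF \<Psi>]])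
  with f(1) show thesis by (rule that)
qed

text \<open>There are countably many multi-indices, so the exceptional sets of frequencies can be
  united. It allows arguing at one fixed frequency for all k at once.\<close>

lemma AE_Gamma:
  "(AE p in Gamma_measure. P p) \<longleftrightarrow> (AE \<xi> in lborel. \<forall>k. P (k::nat^'m::finite, \<xi>::real^'n::finite))"
proof -
  have "pair_sigma_finite (count_space (UNIV::(nat^'m) set)) (lborel :: (real^'n) measure)"
    by (intro pair_sigma_finite.intro sigma_finite_measure_count_space_countable sigma_finite_lborel) auto
  then interpret pair_sigma_finite "count_space (UNIV::(nat^'m) set)" "lborel :: (real^'n) measure" .
  show ?thesis
  proof
    assume "AE p in Gamma_measure. P p"
    from AE_pair[OF this[unfolded Gamma_measure_def]]
    have "\<forall>k. AE \<xi> in lborel. P (k, \<xi>)" by (simp add: AE_count_space)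
    then show "AE \<xi> in lborel. \<forall>k. P (k, \<xi>)" by (simp add: AE_all_countable)
  next
    assume "AE \<xi> in lborel. \<forall>k. P (k, \<xi>)"
    then obtain N where N: "N \<in> null_sets lborel" "{\<xi>. \<not> (\<forall>k. P (k, \<xi>))} \<subseteq> N"
      by (auto simp: eventually_ae_filter)
    have "(UNIV :: (nat^'m) set) \<times> N \<in> null_sets (count_space UNIV \<Otimes>\<^sub>M lborel)"
    proof (rule null_setsI)
      show "UNIV \<times> N \<in> sets (count_space (UNIV :: (nat^'m) set) \<Otimes>\<^sub>M lborel)"
        using N(1) by (intro pair_measureI) auto
      show "emeasure (count_space UNIV \<Otimes>\<^sub>M lborel) ((UNIV :: (nat^'m) set) \<times> N) = 0"
        using N(1) by (subst lborel.emeasure_pair_measure_Times) auto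
    qed
    then show "AE p in Gamma_measure. P p"
      unfolding Gamma_measure_def by (rule AE_I') (use N(2) in auto)
  qed
qed

lemma Gamma_measurable_iff:
  "F \<in> borel_measurable Gamma_measure \<longleftrightarrow> (\<forall>k. (\<lambda>\<xi>. F (k::nat^'m::finite, \<xi>::real^'n::finite)) \<in> borel_measurable lborel)"
proof
  assume "F \<in> borel_measurable Gamma_measure"
  then have [measurable]: "F \<in> borel_measurable (count_space UNIV \<Otimes>\<^sub>M lborel)" by (simp add: Gamma_measure_def)
  show "\<forall>k. (\<lambda>\<xi>. F (k, \<xi>)) \<in> borel_measurable lborel"
    by (intro allI) measurable
next
  assume "\<forall>k. (\<lambda>\<xi>. F (k, \<xi>)) \<in> borel_measurable lborel"
  then show "F \<in> borel_measurable Gamma_measure"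
    unfolding Gamma_measure_def by (intro measurable_pair_measure_countable1) auto
qed

lemma nn_integral_Gamma:
  fixes g :: "(nat^'m::finite) \<times> (real^'n::finite) \<Rightarrow> ennreal"
  assumes "g \<in> borel_measurable Gamma_measure"
  shows "(\<integral>\<^sup>+p. g p \<partial>Gamma_measure) = (\<integral>\<^sup>+k. (\<integral>\<^sup>+\<xi>. g (k, \<xi>) \<partial>lborel) \<partial>count_space UNIV)"
    and "(\<integral>\<^sup>+p. g p \<partial>Gamma_measure) = (\<integral>\<^sup>+\<xi>. (\<integral>\<^sup>+k. g (k, \<xi>) \<partial>count_space UNIV) \<partial>lborel)"
proof -
  have g: "g \<in> borel_measurable (count_space UNIV \<Otimes>\<^sub>M lborel)" using assms by (simp add: Gamma_measure_def)
  show 1: "(\<integral>\<^sup>+p. g p \<partial>Gamma_measure) = (\<integral>\<^sup>+k. (\<integral>\<^sup>+\<xi>. g (k, \<xi>) \<partial>lborel) \<partial>count_space UNIV)"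
    unfolding Gamma_measure_def by (rule lborel.nn_integral_fst[OF g, symmetric])
  show "(\<integral>\<^sup>+p. g p \<partial>Gamma_measure) = (\<integral>\<^sup>+\<xi>. (\<integral>\<^sup>+k. g (k, \<xi>) \<partial>count_space UNIV) \<partial>lborel)"
    unfolding 1 using measurable_compose[OF _ g, of "Pair _"]
    by (intro nn_integral_count_space_nn_integral[symmetric]) auto
qed

section \<open>The transform \<open>calG\<close>: isometry, linearity, bijectivity\<close>

abbreviation sherm :: "nat^'m::finite \<Rightarrow> real^'n::finite \<Rightarrow> real^'m \<Rightarrow> complex" where
  "sherm k \<xi> \<equiv> (\<lambda>x. of_real (hermite_scaled k (norm \<xi>) x))"

lemma AE_frequency_nonzero:
  "AE \<xi> in lborel. (\<xi> :: real^'n::finite) \<noteq> 0"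
  by (rule AE_lborel_singleton)

lemma sherm_Parseval:
  assumes "\<xi> \<noteq> 0" "f \<in> L2 lborel"
  shows "(\<integral>\<^sup>+k. ennreal ((norm (L2_inner lborel f (sherm k \<xi>)))\<^sup>2) \<partial>count_space UNIV) = ennreal (L2_sq lborel f)"
proof (rule Parseval[OF sigma_finite_lborel hermite_scaled_L2 hermite_scaled_orthonormal _ assms(2)])
  show "AE x in lborel. w x = 0" if "w \<in> L2 lborel" "\<And>k. L2_inner lborel w (sherm k \<xi>) = 0" for w
    by (rule hermite_scaled_complete[of "norm \<xi>"]) (use that assms(1) in auto)
qed (use assms(1) in auto)

lemma calG_eq: "calG f (k, \<xi>) = L2_inner lborel (\<lambda>x. partial_fourier f (x, \<xi>)) (sherm k \<xi>)"
  by (simp add: calG_def scaled_hermite_transform_def)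

lemma AE_partial_fourier_slice:
  fixes f :: "(real^'m::finite) \<times> (real^'n::finite) \<Rightarrow> complex"
  assumes "f \<in> L2 lborel"
  shows "AE \<xi> in lborel. (\<lambda>x. partial_fourier f (x, \<xi>)) \<in> L2 lborel"
  using L2_lborel_fibres(1)[OF L2_lborel_swap(1)[OF partial_fourier_L2[OF assms]]] by simp

lemma calG_measurable:
  fixes f :: "(real^'m::finite) \<times> (real^'n::finite) \<Rightarrow> complex"
  assumes "f \<in> L2 lborel"
  shows "calG f \<in> borel_measurable Gamma_measure"
proof -
  have [measurable]: "partial_fourier f \<in> borel_measurable (lborel \<Otimes>\<^sub>M lborel)"
    using L2_measurable[OF partial_fourier_L2[OF assms]] unfolding lborel_prod .
  show ?thesis
    unfolding Gamma_measurable_iff calG_eq L2_inner_def complex_cnj_complex_of_real by measurable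
qed

text \<open>Parseval for the scaled Hermite basis at each nonzero frequency, Tonelli over the
  frequencies, and the isometry of the partial Fourier transform.\<close>

lemma calG_isometry:
  fixes f :: "(real^'m::finite) \<times> (real^'n::finite) \<Rightarrow> complex"
  assumes f: "f \<in> L2 lborel"
  shows calG_L2: "calG f \<in> L2 Gamma_measure"
    and calG_L2_sq: "L2_sq Gamma_measure (calG f) = L2_sq lborel f"
proof -
  note [measurable] = calG_measurable[OF f]
  let ?\<Phi> = "partial_fourier f"
  note sw = L2_lborel_swap[OF partial_fourier_L2[OF f]]
  have "(\<integral>\<^sup>+p. ennreal ((norm (calG f p))\<^sup>2) \<partial>Gamma_measure)
      = (\<integral>\<^sup>+\<xi>. (\<integral>\<^sup>+k. ennreal ((norm (calG f (k, \<xi>)))\<^sup>2) \<partial>count_space UNIV) \<partial>lborel)"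
    by (rule nn_integral_Gamma(2)) measurable
  also have "\<dots> = (\<integral>\<^sup>+\<xi>. ennreal (L2_sq lborel (\<lambda>x. ?\<Phi> (x, \<xi>))) \<partial>lborel)"
    using AE_partial_fourier_slice[OF f] AE_frequency_nonzero
    by (intro nn_integral_cong_AE, eventually_elim) (simp add: calG_eq sherm_Parseval)
  also have "\<dots> = ennreal (L2_sq lborel ?\<Phi>)"
    using L2_lborel_fibres(2,3)[OF sw(1)] sw(2) by (subst nn_integral_eq_integral) auto
  finally have eq: "(\<integral>\<^sup>+p. ennreal ((norm (calG f p))\<^sup>2) \<partial>Gamma_measure) = ennreal (L2_sq lborel f)"
    by (simp add: partial_fourier_L2_sq[OF f])
  then show 1: "calG f \<in> L2 Gamma_measure" by (simp add: L2_iff_nn_integral)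
  show "L2_sq Gamma_measure (calG f) = L2_sq lborel f"
    using eq nn_integral_L2_sq[OF 1] by simp
qed

text \<open>Linear almost everywhere only, since the representatives chosen by
  \<open>partial_fourier\<close> for f, g and their combination are unrelated.\<close>

lemma calG_add_cmult:
  fixes f g :: "(real^'m::finite) \<times> (real^'n::finite) \<Rightarrow> complex"
  assumes f: "f \<in> L2 lborel" and g: "g \<in> L2 lborel"
  shows "AE p in Gamma_measure. calG (\<lambda>x. f x + c * g x) p = calG f p + c * calG g p"
proof -
  have m: "AE \<xi> in lborel. (\<lambda>x. partial_fourier h (x, \<xi>)) \<in> borel_measurable lborel" if "h \<in> L2 lborel"
    for h :: "(real^'m) \<times> (real^'n) \<Rightarrow> complex"
    using AE_partial_fourier_slice[OF that] by eventually_elim (rule L2_measurable)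
  show ?thesis
    unfolding AE_Gamma
    using AE_partial_fourier_slice[OF f] AE_partial_fourier_slice[OF g]
      AE_partial_fourier_slice[OF L2_add[OF f L2_cmult[OF g, of c]]]
      AE_lborel_fibres(2)[OF partial_fourier_add_cmult[OF f g, of c]] AE_frequency_nonzero
  proof eventually_elim
    case (elim \<xi>)
    show ?case
    proof
      fix k :: "nat^'m"
      have h: "sherm k \<xi> \<in> L2 lborel" using elim by (intro hermite_scaled_L2) auto
      have "calG (\<lambda>x. f x + c * g x) (k, \<xi>) = L2_inner lborel (\<lambda>x. partial_fourier f (x, \<xi>) + c * partial_fourier g (x, \<xi>)) (sherm k \<xi>)"
        unfolding calG_eq using elim h
        by (intro L2_inner_cong_AE L2_measurable[where M=lborel] L2_add L2_cmult) auto
      then show "calG (\<lambda>x. f x + c * g x) (k, \<xi>) = calG f (k, \<xi>) + c * calG g (k, \<xi>)"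
        using elim h by (simp add: calG_eq L2_inner_add_left L2_cmult L2_inner_cmult_left)
    qed
  qed
qed

lemma calG_inner:
  fixes f g :: "(real^'m::finite) \<times> (real^'n::finite) \<Rightarrow> complex"
  assumes f: "f \<in> L2 lborel" and g: "g \<in> L2 lborel"
  shows "L2_inner Gamma_measure (calG f) (calG g) = L2_inner lborel f g"
proof -
  have "L2_sq Gamma_measure (\<lambda>p. calG f p + c * calG g p) = L2_sq lborel (\<lambda>x. f x + c * g x)" for c
  proof -
    have "L2_sq Gamma_measure (\<lambda>p. calG f p + c * calG g p) = L2_sq Gamma_measure (calG (\<lambda>x. f x + c * g x))"
      using calG_add_cmult[OF f g, of c]
      by (intro L2_sq_cong_AE) (auto intro!: L2_measurable L2_add L2_cmult calG_L2 f g)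
    then show ?thesis by (simp add: calG_L2_sq L2_add L2_cmult f g)
  qed
  from this[of 1] this[of "-1"] this[of \<i>] this[of "-\<i>"]
  have "4 * L2_inner Gamma_measure (calG f) (calG g) = 4 * L2_inner lborel f g"
    unfolding L2_inner_polarization[OF f g] L2_inner_polarization[OF calG_L2[OF f] calG_L2[OF g]] by simp
  then show ?thesis by simp
qed

lemma calG_injective:
  fixes f g :: "(real^'m::finite) \<times> (real^'n::finite) \<Rightarrow> complex"
  assumes f: "f \<in> L2 lborel" and g: "g \<in> L2 lborel"
    and eq: "AE p in Gamma_measure. calG f p = calG g p"
  shows "AE x in lborel. f x = g x"
proof -
  have d: "(\<lambda>x. f x + (-1) * g x) \<in> L2 lborel" by (intro L2_add L2_cmult f g)
  have "AE p in Gamma_measure. calG (\<lambda>x. f x + (-1) * g x) p = 0"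
    using eq calG_add_cmult[OF f g, of "-1"] by eventually_elim simp
  then have "L2_sq lborel (\<lambda>x. f x + (-1) * g x) = 0"
    using L2_sq_eq_0_iff[OF calG_L2[OF d]] calG_L2_sq[OF d] by simp
  then show ?thesis using L2_sq_eq_0_iff[OF d] by simp
qed

text \<open>Fibrewise Riesz-Fischer with the frequency as parameter, because the basis varies with
  it. It yields a function of (\<xi>, x'), which is swapped and then pulled back through the partial
  Fourier transform.\<close>

lemma calG_surj:
  fixes F :: "(nat^'m::finite) \<times> (real^'n::finite) \<Rightarrow> complex"
  assumes F: "F \<in> L2 Gamma_measure"
  shows "calG_inv F \<in> L2 lborel" and "AE p in Gamma_measure. calG (calG_inv F) p = F p"
proof -
  have Fm: "(\<lambda>\<xi>. F (k, \<xi>)) \<in> borel_measurable lborel" for k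
    using L2_measurable[OF F] unfolding Gamma_measurable_iff by blast
  have "(\<integral>\<^sup>+k. (\<integral>\<^sup>+\<xi>. ennreal ((norm (F (k, \<xi>)))\<^sup>2) \<partial>lborel) \<partial>count_space UNIV) = (\<integral>\<^sup>+p. ennreal ((norm (F p))\<^sup>2) \<partial>Gamma_measure)"
    using L2_measurable[OF F] by (intro nn_integral_Gamma(1)[symmetric]) auto
  then have fin: "(\<integral>\<^sup>+k. (\<integral>\<^sup>+\<xi>. ennreal ((norm (F (k, \<xi>)))\<^sup>2) \<partial>lborel) \<partial>count_space UNIV) < \<infinity>"
    using nn_integral_L2_sq[OF F] by simp
  have e: "(\<lambda>(\<xi>::real^'n, x). sherm k \<xi> x) \<in> borel_measurable (lborel \<Otimes>\<^sub>M lborel)" for k :: "nat^'m"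
    by measurable
  have orth: "AE \<xi>::real^'n in lborel. \<forall>k l :: nat^'m. sherm k \<xi> \<in> L2 lborel \<and> L2_inner lborel (sherm k \<xi>) (sherm l \<xi>) = (if k = l then 1 else 0)"
    using AE_frequency_nonzero by eventually_elim (auto simp: hermite_scaled_L2 hermite_scaled_orthonormal)
  obtain \<Psi> where \<Psi>: "\<Psi> \<in> L2 (lborel \<Otimes>\<^sub>M lborel)"
    "AE \<xi> in lborel. (\<lambda>x. \<Psi> (\<xi>, x)) \<in> L2 lborel \<and> (\<forall>k. L2_inner lborel (\<lambda>x. \<Psi> (\<xi>, x)) (sherm k \<xi>) = F (k, \<xi>)) \<and>
       (\<integral>\<^sup>+k. ennreal ((norm (F (k, \<xi>)))\<^sup>2) \<partial>count_space UNIV) = ennreal (L2_sq lborel (\<lambda>x. \<Psi> (\<xi>, x)))"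
    by (rule fibre_Riesz_Fischer[OF sigma_finite_lborel sigma_finite_lborel e orth, where F="\<lambda>k \<xi>. F (k, \<xi>)"])
       (use Fm fin in auto)
  define \<Psi>' where "\<Psi>' = (\<lambda>(x, \<xi>). \<Psi> (\<xi>, x))"
  have "\<Psi> \<in> L2 lborel" using \<Psi>(1) unfolding lborel_prod .
  then have \<Psi>'_L2: "\<Psi>' \<in> L2 lborel" unfolding \<Psi>'_def by (rule L2_lborel_swap(1))
  obtain f where f: "f \<in> L2 lborel" "AE p in lborel. partial_fourier f p = \<Psi>' p"
    by (rule partial_fourier_surj[OF \<Psi>'_L2])
  have "AE p in Gamma_measure. calG f p = F p"
    unfolding AE_Gamma using \<Psi>(2) AE_lborel_fibres(2)[OF f(2)] AE_partial_fourier_slice[OF f(1)] AE_frequency_nonzero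
  proof eventually_elim
    case (elim \<xi>)
    have "calG f (k, \<xi>) = L2_inner lborel (\<lambda>x. \<Psi> (\<xi>, x)) (sherm k \<xi>)" for k
      unfolding calG_eq using elim
      by (intro L2_inner_cong_AE L2_measurable[where M=lborel] hermite_scaled_L2) (auto simp: \<Psi>'_def)
    then show ?case using elim by simp
  qed
  with f(1) have "\<exists>f. f \<in> L2 lborel \<and> (AE p in Gamma_measure. calG f p = F p)" by blast
  from someI_ex[OF this] show "calG_inv F \<in> L2 lborel" "AE p in Gamma_measure. calG (calG_inv F) p = F p"
    unfolding calG_inv_def by auto
qed

section \<open>Test functions and integration by parts\<close>

definition smooth :: "('a::euclidean_space \<Rightarrow> complex) \<Rightarrow> bool" where
  "smooth \<phi> \<longleftrightarrow> (\<forall>n. times_cont_differentiable n \<phi>)"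

lemma dir_deriv_eqI: "(f has_derivative f') (at x) \<Longrightarrow> dir_deriv v f x = f' v"
  unfolding dir_deriv_def using frechet_derivative_at by metis

lemma dir_deriv_works:
  "f differentiable_on UNIV \<Longrightarrow> (f has_derivative (\<lambda>v. dir_deriv v f x)) (at x)"
  unfolding dir_deriv_def differentiable_on_def using frechet_derivative_works[of f "at x"] by auto

lemma differentiable_on_UNIVI: "(\<And>x. (f has_derivative F x) (at x)) \<Longrightarrow> f differentiable_on UNIV"
  unfolding differentiable_on_def differentiable_def by (blast intro: has_derivative_at_withinI)

text \<open>Replaces the count of derivatives by closure under differentiation.\<close>

lemma smooth_iff: "smooth \<phi> \<longleftrightarrow> \<phi> differentiable_on UNIV \<and> (\<forall>v. smooth (dir_deriv v \<phi>))"
proof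
  assume s: "smooth \<phi>"
  then have t: "times_cont_differentiable n \<phi>" for n by (simp add: smooth_def)
  from t[of "Suc 0"] t[of "Suc _"] show "\<phi> differentiable_on UNIV \<and> (\<forall>v. smooth (dir_deriv v \<phi>))"
    by (simp add: smooth_def)
next
  assume a: "\<phi> differentiable_on UNIV \<and> (\<forall>v. smooth (dir_deriv v \<phi>))"
  have "times_cont_differentiable n \<phi>" for n
    using a by (cases n) (auto simp: smooth_def intro: differentiable_imp_continuous_on)
  then show "smooth \<phi>" by (simp add: smooth_def)
qed

lemma smooth_differentiable: "smooth \<phi> \<Longrightarrow> \<phi> differentiable_on UNIV"
  using smooth_iff by blast

lemma smooth_dir_deriv: "smooth \<phi> \<Longrightarrow> smooth (dir_deriv v \<phi>)"
  using smooth_iff by blast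

lemma smooth_continuous: "smooth \<phi> \<Longrightarrow> continuous_on UNIV \<phi>"
  by (intro differentiable_imp_continuous_on smooth_differentiable)

lemma smooth_has_derivative:
  "smooth \<phi> \<Longrightarrow> (\<phi> has_derivative (\<lambda>v. dir_deriv v \<phi> x)) (at x)"
  by (intro dir_deriv_works smooth_differentiable)

lemma times_cont_differentiable_Suc_imp:
  "times_cont_differentiable (Suc n) \<phi> \<Longrightarrow> times_cont_differentiable n \<phi>"
  by (induction n arbitrary: \<phi>) (auto intro: differentiable_imp_continuous_on)

lemma times_cont_differentiable_add:
  "times_cont_differentiable n f \<Longrightarrow> times_cont_differentiable n g \<Longrightarrow>
    times_cont_differentiable n (\<lambda>x. f x + g x)"
proof (induction n arbitrary: f g)
  case (Suc n)
  have d: "((\<lambda>x. f x + g x) has_derivative (\<lambda>v. dir_deriv v f x + dir_deriv v g x)) (at x)" for x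
    using Suc.prems by (intro has_derivative_add dir_deriv_works) auto
  have "dir_deriv v (\<lambda>x. f x + g x) = (\<lambda>x. dir_deriv v f x + dir_deriv v g x)" for v
    using dir_deriv_eqI[OF d] by blast
  then show ?case
    using Suc differentiable_on_UNIVI[OF d] by auto
qed (auto intro: continuous_intros)

lemma times_cont_differentiable_mult:
  "times_cont_differentiable n f \<Longrightarrow> times_cont_differentiable n g \<Longrightarrow>
    times_cont_differentiable n (\<lambda>x. f x * g x)"
proof (induction n arbitrary: f g)
  case (Suc n)
  have d: "((\<lambda>x. f x * g x) has_derivative (\<lambda>v. f x * dir_deriv v g x + dir_deriv v f x * g x)) (at x)" for x
    using Suc.prems by (intro has_derivative_mult dir_deriv_works) auto
  have "dir_deriv v (\<lambda>x. f x * g x) = (\<lambda>x. f x * dir_deriv v g x + dir_deriv v f x * g x)" for v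
    using dir_deriv_eqI[OF d] by blast
  \<comment> \<open>The product rule mixes derivatives of one factor with the other factor itself,
    so f and g are also needed at the lower order.\<close>
  moreover have "times_cont_differentiable n f" "times_cont_differentiable n g"
    using Suc.prems by (auto intro: times_cont_differentiable_Suc_imp)
  ultimately show ?case
    using Suc differentiable_on_UNIVI[OF d] by (auto intro!: times_cont_differentiable_add)
qed (auto intro: continuous_intros)

lemma times_cont_differentiable_const: "times_cont_differentiable n (\<lambda>x. c)"
proof (induction n arbitrary: c)
  case (Suc n)
  have "dir_deriv v (\<lambda>x. c) = (\<lambda>x. 0)" for v :: 'a
    by (rule ext) (rule dir_deriv_eqI[OF has_derivative_const])
  then show ?case using Suc by simp
qed simp

lemma times_cont_differentiable_compose_affine:
  assumes lin: "bounded_linear lin"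
  shows "times_cont_differentiable n g \<Longrightarrow> times_cont_differentiable n (\<lambda>x. c * g (lin x + b))"
proof (induction n arbitrary: g c)
  case 0
  then show ?case
    by (auto intro!: continuous_intros continuous_on_compose2[of UNIV g] linear_continuous_on[OF lin])
next
  case (Suc n)
  have d: "((\<lambda>x. c * g (lin x + b)) has_derivative (\<lambda>v. c * dir_deriv (lin v) g (lin x + b))) (at x)" for x
  proof -
    have "((\<lambda>x. lin x + b) has_derivative lin) (at x)"
      by (rule has_derivative_eq_rhs[OF has_derivative_add[OF bounded_linear_imp_has_derivative[OF lin] has_derivative_const]]) simp
    from has_derivative_compose[OF this dir_deriv_works] Suc.prems
    show ?thesis by (intro has_derivative_mult_right) auto
  qed
  have "dir_deriv v (\<lambda>x. c * g (lin x + b)) = (\<lambda>x. c * dir_deriv (lin v) g (lin x + b))" for v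
    using dir_deriv_eqI[OF d] by blast
  then show ?case
    using Suc differentiable_on_UNIVI[OF d] by auto
qed

lemma smooth_const: "smooth (\<lambda>x. c)"
  by (simp add: smooth_def times_cont_differentiable_const)

lemma smooth_mult: "smooth f \<Longrightarrow> smooth g \<Longrightarrow> smooth (\<lambda>x. f x * g x)"
  by (simp add: smooth_def times_cont_differentiable_mult)

lemma smooth_prod: "(\<And>i. i \<in> A \<Longrightarrow> smooth (f i)) \<Longrightarrow> smooth (\<lambda>x. \<Prod>i\<in>A. f i x)"
  by (induction A rule: infinite_finite_induct) (auto intro: smooth_mult smooth_const)

lemma smooth_compose_affine:
  assumes "bounded_linear lin" "smooth g" shows "smooth (\<lambda>x. g (lin x + b))"
  using times_cont_differentiable_compose_affine[OF assms(1), of _ g 1 b] assms(2) by (simp add: smooth_def)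

text \<open>A set of functions closed under differentiation consists of smooth functions. It serves
  the Hermite functions and the flat functions behind the bump, whose derivatives of every order
  stay in an explicit family.\<close>

lemma smooth_of_derivative_closed:
  assumes S: "\<And>f. f \<in> S \<Longrightarrow> \<exists>g\<in>S. \<forall>u. (f has_real_derivative g u) (at u)" and f: "f \<in> S"
  shows "smooth (\<lambda>u. complex_of_real (f u))"
proof -
  \<comment> \<open>The scalar c makes the claim inductive: the derivative in direction v is v times
    the ordinary derivative.\<close>
  have "times_cont_differentiable n (\<lambda>u. complex_of_real c * complex_of_real (f u))" if "f \<in> S" for n f c
    using that
  proof (induction n arbitrary: f c)
    case 0
    then obtain g where "\<forall>u. (f has_real_derivative g u) (at u)" using S by blast
    then have "continuous_on UNIV f"
      by (auto intro!: continuous_at_imp_continuous_on DERIV_isCont)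
    then show ?case by (auto intro!: continuous_intros)
  next
    case (Suc n)
    then obtain g where g: "g \<in> S" "\<forall>u. (f has_real_derivative g u) (at u)" using S by blast
    have d: "((\<lambda>u. complex_of_real c * complex_of_real (f u)) has_derivative (\<lambda>v. complex_of_real (c * v) * complex_of_real (g u))) (at u)" for u
    proof -
      have "(f has_derivative (\<lambda>v. g u * v)) (at u)"
        using g(2) by (simp add: has_field_derivative_def)
      then have "((\<lambda>u. complex_of_real c * complex_of_real (f u)) has_derivative (\<lambda>v. complex_of_real c * complex_of_real (g u * v))) (at u)"
        by (intro has_derivative_mult_right has_derivative_of_real)
      then show ?thesis by (simp add: mult_ac)
    qed
    have "dir_deriv v (\<lambda>u. complex_of_real c * complex_of_real (f u)) = (\<lambda>u. complex_of_real (c * v) * complex_of_real (g u))" for v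
      using dir_deriv_eqI[OF d] by blast
    then show ?case
      using Suc.IH[OF g(1)] differentiable_on_UNIVI[OF d] by (auto simp del: of_real_mult)
  qed
  from this[OF f, of _ 1] show ?thesis by (simp add: smooth_def)
qed

inductive_set hermite_gauss_span :: "(real \<Rightarrow> real) set" where
  "hermite_gauss n \<in> hermite_gauss_span"
| "f \<in> hermite_gauss_span \<Longrightarrow> g \<in> hermite_gauss_span \<Longrightarrow> (\<lambda>u. a * f u + b * g u) \<in> hermite_gauss_span"

lemma smooth_hermite_fun: "smooth (\<lambda>u. complex_of_real (hermite_fun n u))"
proof (rule smooth_of_derivative_closed[of hermite_gauss_span])
  let ?c = "(2 ^ n * fact n * sqrt pi) powr (- 1 / 2) :: real"
  \<comment> \<open>The span is generated by combinations of two members, so a single multiple gets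
    a zero second term.\<close>
  have "(\<lambda>u. ?c * hermite_gauss n u + 0 * hermite_gauss n u) \<in> hermite_gauss_span"
    by (intro hermite_gauss_span.intros)
  then show "hermite_fun n \<in> hermite_gauss_span"
    by (simp add: hermite_fun_eq[abs_def])
  show "\<exists>g\<in>hermite_gauss_span. \<forall>u. (f has_real_derivative g u) (at u)" if "f \<in> hermite_gauss_span" for f
    using that
  proof induction
    case (1 n)
    have "(\<lambda>u. real n * hermite_gauss (n - 1) u + (-1/2) * hermite_gauss (Suc n) u) \<in> hermite_gauss_span"
      by (intro hermite_gauss_span.intros)
    then show ?case using hermite_gauss_has_derivative[of n] by (rule_tac bexI) auto
  next
    case (2 f g a b)
    then obtain f' g' where "f' \<in> hermite_gauss_span" "\<forall>u. (f has_real_derivative f' u) (at u)"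
      "g' \<in> hermite_gauss_span" "\<forall>u. (g has_real_derivative g' u) (at u)" by blast
    then show ?case
      by (intro bexI[of _ "\<lambda>u. a * f' u + b * g' u"] allI DERIV_add DERIV_cmult hermite_gauss_span.intros) auto
  qed
qed

text \<open>The standard smooth function e^(-1/u), flat at 0, with a polynomial in 1/u in front so
  that the family is closed under differentiation: the derivative turns p into X^2 (p - p').\<close>

definition flat_fun :: "real poly \<Rightarrow> real \<Rightarrow> real" where
  "flat_fun p u = (if u > 0 then poly p (1 / u) * exp (- (1 / u)) else 0)"

lemma flat_fun_tendsto_0: "(flat_fun p \<longlongrightarrow> 0) (at_right 0)"
proof -
  have "((\<lambda>t. poly p t * exp (- t)) \<longlongrightarrow> 0) at_top"
  proof -
    have "((\<lambda>t. \<Sum>i\<le>degree p. coeff p i * (t ^ i / exp t)) \<longlongrightarrow> (\<Sum>i\<le>degree p. coeff p i * 0)) at_top"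
      by (intro tendsto_sum tendsto_mult tendsto_const tendsto_power_div_exp_0)
    then show ?thesis by (simp add: poly_altdef sum_distrib_right exp_minus divide_inverse mult.assoc)
  qed
  then have "((\<lambda>u. poly p (inverse u) * exp (- inverse u)) \<longlongrightarrow> 0) (at_right 0)"
    by (rule filterlim_compose[OF _ filterlim_inverse_at_top_right])
  then show ?thesis
    by (rule Lim_transform_eventually)
       (auto simp: eventually_at_filter flat_fun_def inverse_eq_divide)
qed

lemma flat_fun_has_derivative:
  "(flat_fun p has_real_derivative flat_fun (monom 1 2 * (p - pderiv p)) u) (at u)"
proof -
  consider "u > 0" | "u < 0" | "u = 0" by linarith
  then show ?thesis
  proof cases
    case 1
    have "((\<lambda>u. poly p (1 / u) * exp (- (1 / u))) has_real_derivative flat_fun (monom 1 2 * (p - pderiv p)) u) (at u)"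
      using 1 by (auto intro!: derivative_eq_intros DERIV_chain2[OF poly_DERIV]
          simp: flat_fun_def poly_monom power2_eq_square field_simps)
    then show ?thesis
      by (rule DERIV_cong_ev[THEN iffD1, OF refl _ refl, rotated])
         (use 1 in \<open>auto simp: flat_fun_def eventually_nhds intro!: exI[of _ "{0<..}"]\<close>)
  next
    case 2
    have "((\<lambda>u. 0) has_real_derivative flat_fun (monom 1 2 * (p - pderiv p)) u) (at u)"
      using 2 by (simp add: flat_fun_def)
    then show ?thesis
      by (rule DERIV_cong_ev[THEN iffD1, OF refl _ refl, rotated])
         (use 2 in \<open>auto simp: flat_fun_def eventually_nhds intro!: exI[of _ "{..<0}"]\<close>)
  next
    case 3
    have "((\<lambda>h. flat_fun p h / h) \<longlongrightarrow> 0) (at 0)"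
    proof (rule filterlim_split_at)
      show "((\<lambda>h. flat_fun p h / h) \<longlongrightarrow> 0) (at_left 0)"
        by (rule tendsto_eventually) (auto simp: eventually_at_filter flat_fun_def)
      \<comment> \<open>The difference quotient at 0 from the right is again a flat function, since
        dividing by h multiplies p by X.\<close>
      have "(flat_fun (monom 1 1 * p) \<longlongrightarrow> 0) (at_right 0)" by (rule flat_fun_tendsto_0)
      then show "((\<lambda>h. flat_fun p h / h) \<longlongrightarrow> 0) (at_right 0)"
        by (rule Lim_transform_eventually)
           (auto simp: eventually_at_filter flat_fun_def poly_monom)
    qed
    then show ?thesis
      by (simp add: 3 has_field_derivative_iff flat_fun_def)
  qed
qed

text \<open>The factor e^2 normalises the value at 0 to 1, as \<open>flat_fun 1 1\<close> is 1/e;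
  for this reason a cutoff by bump(N u) tends to no cutoff as N goes to 0.\<close>

definition bump :: "real \<Rightarrow> real" where
  "bump u = exp 2 * (flat_fun 1 (1 - u) * flat_fun 1 (1 + u))"

lemma bump_0 [simp]: "bump 0 = 1"
  using exp_double[of "1::real"] by (simp add: bump_def flat_fun_def exp_minus power2_eq_square field_simps)

lemma bump_outside: "\<bar>u\<bar> \<ge> 1 \<Longrightarrow> bump u = 0"
  by (auto simp: bump_def flat_fun_def)

lemma bump_nonneg: "0 \<le> bump u"
  by (auto simp: bump_def flat_fun_def)

lemma smooth_bump: "smooth (\<lambda>u. complex_of_real (bump u))"
proof -
  have f: "smooth (\<lambda>u. complex_of_real (flat_fun 1 u))"
    by (rule smooth_of_derivative_closed[of "range flat_fun"]) (use flat_fun_has_derivative in blast)+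
  have b1: "bounded_linear (\<lambda>u::real. u)" and b2: "bounded_linear (\<lambda>u::real. - u)"
    by (auto intro: bounded_linear_ident bounded_linear_minus)
  have "smooth (\<lambda>u. complex_of_real (exp 2) * (complex_of_real (flat_fun 1 (- u + 1)) * complex_of_real (flat_fun 1 (u + 1))))"
    by (intro smooth_mult smooth_const smooth_compose_affine[OF b1 f] smooth_compose_affine[OF b2 f])
  then show ?thesis by (simp add: bump_def add.commute)
qed

text \<open>Real derivatives with uniform bounds, as needed to dominate the truncated Hermite
  functions; smoothness in the sense of \<open>dir_deriv\<close> gives no such bounds
  directly.\<close>

lemma bump_derivatives:
  obtains b1 b2 C where
    "\<And>u. (bump has_real_derivative b1 u) (at u)" "\<And>u. (b1 has_real_derivative b2 u) (at u)"
    "\<And>u. \<bar>bump u\<bar> \<le> C" "\<And>u. \<bar>b1 u\<bar> \<le> C" "\<And>u. \<bar>b2 u\<bar> \<le> C" "continuous_on UNIV b2"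
proof -
  \<comment> \<open>\<psi> k is the k-th derivative of \<open>flat_fun 1\<close>. The products T i j
    below are closed under differentiation up to sums, with a minus sign from the inner function 1 -
    u.\<close>
  define \<psi> where "\<psi> k = flat_fun (((\<lambda>p. monom 1 2 * (p - pderiv p)) ^^ k) 1)" for k :: nat
  have \<psi>: "(\<psi> k has_real_derivative \<psi> (Suc k) u) (at u)" for k u
    unfolding \<psi>_def using flat_fun_has_derivative by simp
  have \<psi>0: "\<psi> k u = 0" if "u \<le> 0" for k u using that by (simp add: \<psi>_def flat_fun_def)
  have \<psi>1: "((\<lambda>u. \<psi> k (1 - u)) has_real_derivative - \<psi> (Suc k) (1 - u)) (at u)" for k u
  proof -
    have "((\<lambda>u. 1 - u) has_real_derivative - 1) (at u)" by (auto intro!: derivative_eq_intros)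
    from DERIV_chain2[OF \<psi> this] show ?thesis by simp
  qed
  have \<psi>2: "((\<lambda>u. \<psi> k (1 + u)) has_real_derivative \<psi> (Suc k) (1 + u)) (at u)" for k u
  proof -
    have "((\<lambda>u. 1 + u) has_real_derivative 1) (at u)" by (auto intro!: derivative_eq_intros)
    from DERIV_chain2[OF \<psi> this] show ?thesis by simp
  qed
  define T where "T i j u = exp 2 * (\<psi> i (1 - u) * \<psi> j (1 + u))" for i j u
  have T: "(T i j has_real_derivative T i (Suc j) u - T (Suc i) j u) (at u)" for i j u
  proof -
    have "(T i j has_real_derivative exp 2 * (- \<psi> (Suc i) (1 - u) * \<psi> j (1 + u) + \<psi> (Suc j) (1 + u) * \<psi> i (1 - u))) (at u)"
      unfolding T_def[abs_def] by (intro DERIV_cmult DERIV_mult \<psi>1 \<psi>2)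
    then show ?thesis by (simp add: T_def algebra_simps)
  qed
  have T_cont: "continuous_on A (T i j)" for A i j
    by (auto intro!: continuous_at_imp_continuous_on DERIV_isCont T)
  have T_out: "T i j u = 0" if "\<bar>u\<bar> > 1" for i j u using that by (cases "u > 0") (simp_all add: T_def \<psi>0)
  have T_bdd: "\<exists>C. \<forall>u. \<bar>T i j u\<bar> \<le> C" for i j
  proof -
    have "compact (T i j ` {-1..1})" by (intro compact_continuous_image T_cont) simp
    then obtain C where C: "\<forall>x\<in>T i j ` {-1..1}. norm x \<le> C"
      using compact_imp_bounded bounded_iff by metis
    have "\<bar>T i j u\<bar> \<le> max C 0" for u
      using C T_out[of u i j] by (cases "u \<in> {-1..1}") (force simp: le_max_iff_disj)+
    then show ?thesis by blast
  qed
  have bump: "bump = T 0 0" by (auto simp: bump_def T_def \<psi>_def)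
  define b1 where "b1 u = T 0 1 u - T 1 0 u" for u
  define b2 where "b2 u = (T 0 2 u - T 1 1 u) - (T 1 1 u - T 2 0 u)" for u
  from T_bdd obtain C where C: "\<forall>i j u. \<bar>T i j u\<bar> \<le> C i j" by metis
  let ?C = "C 0 0 + C 0 1 + C 1 0 + C 0 2 + 2 * C 1 1 + C 2 0"
  have C0: "0 \<le> C i j" for i j using C[rule_format, of i j 0] by linarith
  show thesis
  proof (rule that)
    show "(bump has_real_derivative b1 u) (at u)" for u
      using T[of 0 0 u] by (simp add: bump b1_def)
    show "(b1 has_real_derivative b2 u) (at u)" for u
      unfolding b1_def[abs_def] b2_def using T[of 0 1 u] T[of 1 0 u]
      by (intro DERIV_diff) (simp_all add: numeral_2_eq_2)
    show "\<bar>bump u\<bar> \<le> ?C" "\<bar>b1 u\<bar> \<le> ?C" "\<bar>b2 u\<bar> \<le> ?C" for u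
      unfolding bump b1_def b2_def
      using C[rule_format, of 0 0 u] C[rule_format, of 0 1 u] C[rule_format, of 1 0 u] C[rule_format, of 0 2 u]
        C[rule_format, of 1 1 u] C[rule_format, of 2 0 u]
        C0[of 0 0] C0[of 0 1] C0[of 1 0] C0[of 0 2] C0[of 1 1] C0[of 2 0] by linarith+
    show "continuous_on UNIV b2" unfolding b2_def by (intro continuous_intros T_cont)
  qed
qed

section \<open>Compactly supported functions and integration by parts\<close>

lemma test_functions_iff:
  "\<phi> \<in> test_functions \<longleftrightarrow> smooth \<phi> \<and> (\<exists>R. \<forall>x. x \<notin> cball 0 R \<longrightarrow> \<phi> x = 0)"
proof
  assume "\<phi> \<in> test_functions"
  then have s: "smooth \<phi>" and c: "compact (closure {x. \<phi> x \<noteq> 0})"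
    by (auto simp: test_functions_def smooth_def)
  obtain R where "\<forall>x\<in>closure {x. \<phi> x \<noteq> 0}. norm x \<le> R"
    using compact_imp_bounded[OF c] bounded_iff by metis
  then have "\<forall>x. x \<notin> cball 0 R \<longrightarrow> \<phi> x = 0"
    using closure_subset[of "{x. \<phi> x \<noteq> 0}"] by auto
  with s show "smooth \<phi> \<and> (\<exists>R. \<forall>x. x \<notin> cball 0 R \<longrightarrow> \<phi> x = 0)" by blast
next
  assume a: "smooth \<phi> \<and> (\<exists>R. \<forall>x. x \<notin> cball 0 R \<longrightarrow> \<phi> x = 0)"
  then obtain R where "\<forall>x. x \<notin> cball 0 R \<longrightarrow> \<phi> x = 0" by blast
  then have "{x. \<phi> x \<noteq> 0} \<subseteq> cball 0 R" by blast
  then have "bounded {x. \<phi> x \<noteq> 0}" by (rule bounded_subset[OF bounded_cball])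
  then have "compact (closure {x. \<phi> x \<noteq> 0})" by (simp add: compact_eq_bounded_closed bounded_closure)
  then show "\<phi> \<in> test_functions" using a by (auto simp: test_functions_def smooth_def)
qed

lemma dir_deriv_vanishes:
  assumes "\<forall>x. x \<notin> cball 0 R \<longrightarrow> \<phi> x = 0" "x \<notin> cball 0 R"
  shows "dir_deriv v \<phi> x = 0"
proof -
  have "((\<lambda>x. 0) has_derivative (\<lambda>v. 0)) (at x)" by simp
  then have "(\<phi> has_derivative (\<lambda>v. 0)) (at x)"
    by (rule has_derivative_transform_within_open[OF _ open_Compl[OF closed_cball[of 0 R]]]) (use assms in auto)
  then show ?thesis by (rule dir_deriv_eqI)
qed

lemma test_functions_dir_deriv: "\<phi> \<in> test_functions \<Longrightarrow> dir_deriv v \<phi> \<in> test_functions"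
  unfolding test_functions_iff using smooth_dir_deriv dir_deriv_vanishes by blast

lemma compact_support_integrable:
  fixes u :: "'a::euclidean_space \<Rightarrow> complex"
  assumes "continuous_on UNIV u" "\<forall>x. x \<notin> cball 0 R \<longrightarrow> u x = 0"
  shows "integrable lborel u" and "u \<in> L2 lborel"
proof -
  have i: "integrable lborel f" if "continuous_on UNIV f" "\<forall>x. x \<notin> cball 0 R \<longrightarrow> f x = 0"
    for f :: "'a \<Rightarrow> 'b::{banach, second_countable_topology}"
  proof -
    have "integrable lborel (\<lambda>x. indicator (cball 0 R) x *\<^sub>R f x)"
      by (rule borel_integrable_compact) (auto intro: continuous_on_subset[OF that(1)])
    also have "(\<lambda>x. indicator (cball 0 R) x *\<^sub>R f x) = f"
      using that(2) by (auto simp: indicator_def)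
    finally show ?thesis .
  qed
  show "integrable lborel u" by (rule i) (use assms in auto)
  have "integrable lborel (\<lambda>x. (norm (u x))\<^sup>2)"
    by (rule i) (use assms in \<open>auto intro!: continuous_intros\<close>)
  then show "u \<in> L2 lborel"
    using borel_measurable_continuous_onI[OF assms(1)] by (simp add: L2_def)
qed

lemma test_function_facts:
  assumes "\<phi> \<in> test_functions"
  shows "integrable lborel \<phi>" "\<phi> \<in> L2 lborel" "continuous_on UNIV \<phi>"
  using assms compact_support_integrable[of \<phi>] smooth_continuous by (auto simp: test_functions_iff)

text \<open>By translation invariance the difference quotients of \<^term>\<open>u\<close> integrate to zero.\<close>

lemma integral_directional_derivative:
  fixes u :: "'a::euclidean_space \<Rightarrow> complex"
  assumes u: "continuous_on UNIV u" and u': "continuous_on UNIV u'"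
    and supp: "\<forall>x. x \<notin> cball 0 R \<longrightarrow> u x = 0"
    and deriv: "\<And>x. ((\<lambda>t. u (x + t *\<^sub>R v)) has_vector_derivative u' x) (at 0)"
  shows "(LINT x|lborel. u' x) = 0"
proof -
  \<comment> \<open>The hypothesis concerns the parameter 0 only, but for every base point; moving
    the base point along the line gives the derivative at every parameter.\<close>
  have deriv_s: "((\<lambda>t. u (x + t *\<^sub>R v)) has_vector_derivative u' (x + s *\<^sub>R v)) (at s)" for x s
  proof -
    have "((\<lambda>t. u ((x + s *\<^sub>R v) + t *\<^sub>R v)) has_vector_derivative u' (x + s *\<^sub>R v)) (at (s - s))"
      using deriv[of "x + s *\<^sub>R v"] by simp
    moreover have "((\<lambda>t. t - s) has_vector_derivative 1) (at s)"
      by (auto intro!: derivative_eq_intros)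
    ultimately show ?thesis
      using vector_diff_chain_at[of "\<lambda>t. t - s" 1 s "\<lambda>t. u ((x + s *\<^sub>R v) + t *\<^sub>R v)" "u' (x + s *\<^sub>R v)"]
      by (simp add: o_def algebra_simps)
  qed
  have u'_out: "u' x = 0" if "x \<notin> cball 0 R" for x
  proof -
    have "((\<lambda>t. x + t *\<^sub>R v) \<longlongrightarrow> x) (at (0::real))" by (auto intro!: tendsto_eq_intros)
    then have "\<forall>\<^sub>F t in at (0::real). x + t *\<^sub>R v \<in> - cball 0 R"
      using that by (rule_tac topological_tendstoD) (auto simp: open_Compl)
    then have ev: "\<forall>\<^sub>F t in nhds (0::real). u (x + t *\<^sub>R v) = 0"
      using supp that by (auto simp: eventually_at_filter elim!: eventually_mono)
    have "((\<lambda>t. 0) has_vector_derivative u' x) (at (0::real))"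
      using deriv[of x] ev supp that
      by (subst (asm) has_vector_derivative_cong_ev[where g="\<lambda>_. 0"]) auto
    then show ?thesis
      using vector_derivative_unique_at[OF _ has_vector_derivative_const] by blast
  qed
  have "compact (u' ` cball 0 R)"
    by (intro compact_continuous_image continuous_on_subset[OF u']) auto
  then obtain M where M: "\<forall>y\<in>u' ` cball 0 R. norm y \<le> M"
    using compact_imp_bounded bounded_iff by metis
  have bd: "norm (u' x) \<le> max M 0" for x
    using M u'_out[of x] by (cases "x \<in> cball 0 R") (auto simp: le_max_iff_disj)
  define t where "t n = inverse (real (Suc n))" for n
  have t: "0 < t n" "t n \<le> 1" for n by (auto simp: t_def inverse_le_1_iff)
  have t0: "t \<longlonglongrightarrow> 0" unfolding t_def[abs_def] by (rule LIMSEQ_inverse_real_of_nat)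
  define D where "D n x = (u (x + t n *\<^sub>R v) - u x) /\<^sub>R t n" for n x
  have ui: "integrable lborel u" by (rule compact_support_integrable(1)[OF u supp])
  have [measurable]: "u \<in> borel_measurable borel" "u' \<in> borel_measurable borel"
    by (intro borel_measurable_continuous_onI u u')+
  have "(LINT x|lborel. D n x) = 0" for n
  proof -
    have "integrable lborel (\<lambda>x. u (t n *\<^sub>R v + 1 *\<^sub>R x))"
      using lborel_integral_affine(2)[of u 1 "t n *\<^sub>R v"] ui by simp
    then have s: "integrable lborel (\<lambda>x. u (x + t n *\<^sub>R v))" by (simp add: add.commute)
    have "(LINT x|lborel. u (x + t n *\<^sub>R v)) = (LINT x|lborel. u x)"
      using lborel_integral_affine(1)[of u 1 "t n *\<^sub>R v"] by (simp add: add.commute)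
    then show ?thesis unfolding D_def using ui s by simp
  qed
  moreover have "(\<lambda>n. LINT x|lborel. D n x) \<longlonglongrightarrow> (LINT x|lborel. u' x)"
  proof (rule integral_dominated_convergence[where w="\<lambda>x. max M 0 * indicator (cball 0 (R + norm v)) x"])
    show "AE x in lborel. (\<lambda>n. D n x) \<longlonglongrightarrow> u' x"
    proof (intro AE_I2)
      fix x
      have "((\<lambda>h. (u (x + h *\<^sub>R v) - u x) /\<^sub>R h) \<longlongrightarrow> u' x) (at 0)"
      proof -
        have "((\<lambda>h. norm (u (x + h *\<^sub>R v) - u x - h *\<^sub>R u' x) / norm h) \<longlongrightarrow> 0) (at 0)"
          using deriv[of x] by (simp add: has_vector_derivative_def has_derivative_at)
        then have "((\<lambda>h. norm ((u (x + h *\<^sub>R v) - u x) /\<^sub>R h - u' x)) \<longlongrightarrow> 0) (at 0)"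
        proof (rule Lim_transform_eventually)
          show "\<forall>\<^sub>F h in at 0. norm (u (x + h *\<^sub>R v) - u x - h *\<^sub>R u' x) / norm h = norm ((u (x + h *\<^sub>R v) - u x) /\<^sub>R h - u' x)"
            unfolding eventually_at_filter
          proof (intro always_eventually allI impI)
            fix h :: real assume "h \<noteq> 0"
            then have "(u (x + h *\<^sub>R v) - u x) /\<^sub>R h - u' x = (u (x + h *\<^sub>R v) - u x - h *\<^sub>R u' x) /\<^sub>R h"
              by (simp add: scaleR_diff_right)
            then show "norm (u (x + h *\<^sub>R v) - u x - h *\<^sub>R u' x) / norm h = norm ((u (x + h *\<^sub>R v) - u x) /\<^sub>R h - u' x)"
              by (simp add: divide_inverse mult.commute)
          qed
        qed
        then show ?thesis using Lim_null tendsto_norm_zero_iff by blast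
      qed
      then show "(\<lambda>n. D n x) \<longlonglongrightarrow> u' x"
        unfolding D_def by (rule filterlim_compose) (use t0 t in \<open>auto simp: filterlim_at less_imp_neq[symmetric]\<close>)
    qed
    \<comment> \<open>By the mean value inequality the quotients are bounded by the bound of u'. As
      t_n \<le> 1, they vanish outside the ball enlarged by |v|.\<close>
    show "AE x in lborel. norm (D n x) \<le> max M 0 * indicator (cball 0 (R + norm v)) x" for n
    proof (intro AE_I2)
      fix x
      show "norm (D n x) \<le> max M 0 * indicator (cball 0 (R + norm v)) x"
      proof (cases "x \<in> cball 0 (R + norm v)")
        case True
        have "norm (u (x + t n *\<^sub>R v) - u (x + 0 *\<^sub>R v)) \<le> max M 0 * norm (t n - 0)"
        proof (rule differentiable_bound[of UNIV "\<lambda>s. u (x + s *\<^sub>R v)" "\<lambda>s h. h *\<^sub>R u' (x + s *\<^sub>R v)"])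
          show "((\<lambda>s. u (x + s *\<^sub>R v)) has_derivative (\<lambda>h. h *\<^sub>R u' (x + s *\<^sub>R v))) (at s within UNIV)" for s
            using deriv_s by (simp add: has_vector_derivative_def)
          show "onorm (\<lambda>h. h *\<^sub>R u' (x + s *\<^sub>R v)) \<le> max M 0" for s
            by (rule onorm_le) (use bd[of "x + s *\<^sub>R v"] in \<open>auto intro!: mult_left_mono simp: mult.commute[of "max M 0"]\<close>)
        qed auto
        moreover have "norm (D n x) = norm (u (x + t n *\<^sub>R v) - u (x + 0 *\<^sub>R v)) / t n"
          using t[of n] by (simp add: D_def divide_inverse mult.commute)
        ultimately show ?thesis using True t[of n] by (simp add: pos_divide_le_eq)
      next
        case False
        have "norm x \<le> norm (x + t n *\<^sub>R v) + norm (t n *\<^sub>R v)"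
          using norm_triangle_ineq4[of "x + t n *\<^sub>R v" "t n *\<^sub>R v"] by simp
        moreover have "norm (t n *\<^sub>R v) \<le> norm v"
          using t[of n] by (simp add: mult_left_le_one_le)
        ultimately have "x + t n *\<^sub>R v \<notin> cball 0 R" "x \<notin> cball 0 R"
          using False norm_ge_zero[of v] by (auto simp del: norm_ge_zero norm_scaleR)
        then show ?thesis using supp False by (simp add: D_def)
      qed
    qed
    show "integrable lborel (\<lambda>x::'a. max M 0 * indicator (cball 0 (R + norm v)) x)"
      by (intro integrable_mult_right integrable_real_indicator)
         (use emeasure_lborel_cball_finite[of "0::'a" "R + norm v"] in auto)
    show "D n \<in> borel_measurable lborel" for n unfolding D_def[abs_def] by measurable
  qed simp
  ultimately show ?thesis by (simp add: LIMSEQ_const_iff)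
qed

lemma smooth_line_derivative:
  assumes "smooth \<phi>" shows "((\<lambda>t. \<phi> (x + t *\<^sub>R v)) has_vector_derivative dir_deriv v \<phi> x) (at 0)"
proof -
  have "((\<lambda>t. x + t *\<^sub>R v) has_derivative (\<lambda>t. t *\<^sub>R v)) (at 0)"
    by (auto intro!: derivative_eq_intros)
  from has_derivative_compose[OF this, of \<phi> "\<lambda>v. dir_deriv v \<phi> x"] smooth_has_derivative[OF assms, of x]
  have d: "((\<lambda>t. \<phi> (x + t *\<^sub>R v)) has_derivative (\<lambda>t. dir_deriv (t *\<^sub>R v) \<phi> x)) (at 0)" by simp
  have "dir_deriv (t *\<^sub>R v) \<phi> x = t *\<^sub>R dir_deriv v \<phi> x" for t
    using linear_scale[OF has_derivative_linear[OF smooth_has_derivative[OF assms, of x]]] by blast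
  with d show ?thesis by (simp add: has_vector_derivative_def)
qed

text \<open>The function D\<phi> w - \<phi> w1 has derivative DD\<phi> w - \<phi> w2 along v, the
  mixed terms cancelling, and it inherits compact support from \<phi>. The factor w may thus be an
  oscillating mode without decay, described by its derivatives along v alone.\<close>

lemma integrate_by_parts_twice:
  assumes \<phi>: "\<phi> \<in> test_functions"
    and w: "continuous_on UNIV w" "continuous_on UNIV w1" "continuous_on UNIV w2"
    and d1: "\<And>x. ((\<lambda>t. w (x + t *\<^sub>R v)) has_vector_derivative w1 x) (at 0)"
    and d2: "\<And>x. ((\<lambda>t. w1 (x + t *\<^sub>R v)) has_vector_derivative w2 x) (at 0)"
  shows "(LINT x|lborel. dir_deriv v (dir_deriv v \<phi>) x * w x) = (LINT x|lborel. \<phi> x * w2 x)"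
proof -
  let ?D = "dir_deriv v \<phi>" and ?DD = "dir_deriv v (dir_deriv v \<phi>)"
  have s: "smooth \<phi>" using \<phi> by (simp add: test_functions_iff)
  obtain R where R: "\<forall>x. x \<notin> cball 0 R \<longrightarrow> \<phi> x = 0" using \<phi> by (auto simp: test_functions_iff)
  have RD: "\<forall>x. x \<notin> cball 0 R \<longrightarrow> ?D x = 0" using dir_deriv_vanishes[OF R] by blast
  have RDD: "\<forall>x. x \<notin> cball 0 R \<longrightarrow> ?DD x = 0" using dir_deriv_vanishes[OF RD] by blast
  note c = smooth_continuous[OF s] smooth_continuous[OF smooth_dir_deriv[OF s]]
    smooth_continuous[OF smooth_dir_deriv[OF smooth_dir_deriv[OF s]]]
  have "(LINT x|lborel. ?DD x * w x - \<phi> x * w2 x) = 0"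
  proof (rule integral_directional_derivative[where u="\<lambda>x. ?D x * w x - \<phi> x * w1 x" and v=v and R=R])
    show "((\<lambda>t. ?D (x + t *\<^sub>R v) * w (x + t *\<^sub>R v) - \<phi> (x + t *\<^sub>R v) * w1 (x + t *\<^sub>R v)) has_vector_derivative
        ?DD x * w x - \<phi> x * w2 x) (at 0)" for x
      by (rule has_vector_derivative_eq_rhs[OF has_vector_derivative_diff[OF
            has_vector_derivative_mult[OF smooth_line_derivative[OF smooth_dir_deriv[OF s]] d1]
            has_vector_derivative_mult[OF smooth_line_derivative[OF s] d2]]]) simp
  qed (use c w R RD in \<open>auto intro!: continuous_intros\<close>)
  moreover have "integrable lborel (\<lambda>x. ?DD x * w x)"
    by (rule compact_support_integrable(1)[of _ R]) (use c w RDD in \<open>auto intro!: continuous_intros\<close>)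
  moreover have "integrable lborel (\<lambda>x. \<phi> x * w2 x)"
    by (rule compact_support_integrable(1)[of _ R]) (use c w R in \<open>auto intro!: continuous_intros\<close>)
  ultimately show ?thesis by simp
qed

section \<open>The Grushin operator on test functions\<close>

lemma hermite_fun_deriv_continuous [continuous_intros]:
  "continuous_on A f \<Longrightarrow> continuous_on A (\<lambda>x. hermite_fun_deriv n (f x))"
  unfolding hermite_fun_deriv_def by (intro continuous_intros) auto

lemma prod_line_derivative:
  fixes A :: "'m::finite \<Rightarrow> real \<Rightarrow> complex" and x :: "real^'m"
  assumes "(A i has_vector_derivative D) (at (x $ i))"
  shows "((\<lambda>t. \<Prod>l\<in>UNIV. A l ((x + t *\<^sub>R axis i 1) $ l)) has_vector_derivative
      D * (\<Prod>l\<in>UNIV - {i}. A l (x $ l))) (at 0)"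
proof -
  have eq: "(\<Prod>l\<in>UNIV. A l ((x + t *\<^sub>R axis i 1) $ l)) = A i (x $ i + t) * (\<Prod>l\<in>UNIV - {i}. A l (x $ l))" for t
    by (subst prod.remove[of UNIV i]) (auto simp: axis_def intro!: prod.cong)
  have "((\<lambda>t. x $ i + t) has_vector_derivative 1) (at 0)"
    by (auto intro!: derivative_eq_intros)
  then have "((\<lambda>t. A i (x $ i + t)) has_vector_derivative D) (at 0)"
    using vector_diff_chain_at[of "\<lambda>t. x $ i + t" 1 0 "A i" D] assms by (simp add: o_def)
  then show ?thesis unfolding eq by (intro has_vector_derivative_mult_left)
qed

text \<open>The integral kernel of \<open>calG\<close> up to a constant: the Hermite factor is real
  and the character already has the sign of the Fourier integral, so no conjugate appears.\<close>

definition grushin_mode :: "nat^'m::finite \<Rightarrow> real^'n::finite \<Rightarrow> (real^'m) \<times> (real^'n) \<Rightarrow> complex" where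
  "grushin_mode k \<xi> = (\<lambda>p. sherm k \<xi> (fst p) * cis (- (\<xi> \<bullet> snd p)))"

lemma hermite_scaled_prod:
  "complex_of_real (hermite_scaled k \<tau> x) = of_real (\<tau> powr (real CARD('m) / 4)) *
     (\<Prod>l\<in>UNIV. complex_of_real (hermite_fun (k $ l) (sqrt \<tau> * x $ l)))"
  for k :: "nat^'m::finite"
  by (simp add: hermite_scaled_def hermite_multi_def)

text \<open>Here the choice in \<open>partial_fourier\<close> is resolved. The slices are
  integrable, so their Fourier integrals form a jointly measurable version; uniqueness identifies it
  with the partial transform, and Fubini merges the two integrations.\<close>

lemma calG_compact_support:
  fixes \<psi> :: "(real^'m::finite) \<times> (real^'n::finite) \<Rightarrow> complex"
  assumes c: "continuous_on UNIV \<psi>" and supp: "\<forall>x. x \<notin> cball 0 R \<longrightarrow> \<psi> x = 0"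
  shows "AE q in Gamma_measure. calG \<psi> q = of_real ((2 * pi) powr (- real CARD('n) / 2)) *
      (LINT p|lborel. \<psi> p * grushin_mode (fst q) (snd q) p)"
proof -
  let ?c = "complex_of_real ((2 * pi) powr (- real CARD('n) / 2))"
  have L2: "\<psi> \<in> L2 lborel" by (rule compact_support_integrable(2)[OF c supp])
  have [measurable]: "\<psi> \<in> borel_measurable (lborel \<Otimes>\<^sub>M lborel)"
    using L2_measurable[OF L2] unfolding lborel_prod .
  define F where "F p = fourier_integral (\<lambda>x''. \<psi> (fst p, x'')) (snd p)" for p
  have "F \<in> borel_measurable (lborel \<Otimes>\<^sub>M lborel)"
    unfolding F_def[abs_def] fourier_integral_def by measurable
  then have F_meas: "F \<in> borel_measurable lborel" unfolding lborel_prod .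
  have slice_c: "continuous_on UNIV (\<lambda>x''. \<psi> (x', x''))" for x'
    by (rule continuous_on_compose2[OF c]) (auto intro!: continuous_intros)
  have slice_0: "\<forall>x''. x'' \<notin> cball 0 R \<longrightarrow> \<psi> (x', x'') = 0" for x'
  proof (intro allI impI)
    fix x'' :: "real^'n" assume "x'' \<notin> cball 0 R"
    then have "(x', x'') \<notin> cball 0 R" using norm_snd_le[of x'' x'] by auto
    then show "\<psi> (x', x'') = 0" using supp by blast
  qed
  note slice = compact_support_integrable[OF slice_c slice_0]
  have "AE y in lborel. is_fourier_L2 (\<lambda>x. \<psi> (y, x)) (\<lambda>\<xi>. F (y, \<xi>))"
    using fourier_integral_L1_L2[OF slice] slice(2) by (auto simp: F_def is_fourier_L2_iff)
  then have pf: "AE p in lborel. partial_fourier \<psi> p = F p"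
    by (rule partial_fourier_unique[OF L2 F_meas])
  show ?thesis
    unfolding AE_Gamma using AE_lborel_fibres(2)[OF pf] AE_partial_fourier_slice[OF L2] AE_frequency_nonzero
  proof eventually_elim
    case (elim \<xi>)
    show ?case
    proof
      fix k :: "nat^'m"
      have F_slice: "(\<lambda>x. F (x, \<xi>)) \<in> borel_measurable lborel"
        using measurable_compose[OF _ F_meas, of "\<lambda>x. (x, \<xi>)" lborel] by measurable
      have "calG \<psi> (k, \<xi>) = L2_inner lborel (\<lambda>x. F (x, \<xi>)) (sherm k \<xi>)"
        unfolding calG_eq using elim F_slice
        by (intro L2_inner_cong_AE F_slice L2_measurable[where M=lborel] hermite_scaled_L2) auto
      also have "\<dots> = (LINT x|lborel. ?c * (LINT y|lborel. \<psi> (x, y) * grushin_mode k \<xi> (x, y)))"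
        unfolding L2_inner_def complex_cnj_complex_of_real
      proof (intro Bochner_Integration.integral_cong refl)
        fix x
        have "(LINT y|lborel. \<psi> (x, y) * grushin_mode k \<xi> (x, y)) = (LINT y|lborel. (\<psi> (x, y) * cis (- (\<xi> \<bullet> y))) * sherm k \<xi> x)"
          by (simp add: grushin_mode_def mult_ac)
        then show "F (x, \<xi>) * sherm k \<xi> x = ?c * (LINT y|lborel. \<psi> (x, y) * grushin_mode k \<xi> (x, y))"
          unfolding integral_mult_left_zero by (simp add: F_def fourier_integral_def)
      qed
      also have "\<dots> = ?c * (LINT x|lborel. LINT y|lborel. \<psi> (x, y) * grushin_mode k \<xi> (x, y))"
        by (rule integral_mult_right_zero)
      also have "(LINT x|lborel. LINT y|lborel. \<psi> (x, y) * grushin_mode k \<xi> (x, y)) = (LINT p|lborel. \<psi> p * grushin_mode k \<xi> p)"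
      proof -
        have "integrable lborel (\<lambda>p. \<psi> p * grushin_mode k \<xi> p)"
          by (rule compact_support_integrable(1)[of _ R])
             (use supp in \<open>auto simp: grushin_mode_def hermite_scaled_prod intro!: continuous_intros c\<close>)
        then have "integrable (lborel \<Otimes>\<^sub>M lborel) (\<lambda>p. \<psi> p * grushin_mode k \<xi> p)" unfolding lborel_prod .
        from lborel_pair.integral_fst'[OF this] show ?thesis unfolding lborel_prod .
      qed
      finally show "calG \<psi> (k, \<xi>) = ?c * (LINT p|lborel. \<psi> p * grushin_mode (fst (k, \<xi>)) (snd (k, \<xi>)) p)" by simp
    qed
  qed
qed

lemma grushin_eq:
  "grushin \<phi> p = - (\<Sum>i\<in>UNIV. dir_deriv (axis i 1, 0) (dir_deriv (axis i 1, 0) \<phi>) p)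
     - of_real ((norm (fst p))\<^sup>2) * (\<Sum>j\<in>UNIV. dir_deriv (0, axis j 1) (dir_deriv (0, axis j 1) \<phi>) p)"
  by (simp add: grushin_def case_prod_beta')

lemma grushin_compact_support:
  assumes "\<phi> \<in> test_functions"
  shows "continuous_on UNIV (grushin \<phi>)" and "\<exists>R. \<forall>x. x \<notin> cball 0 R \<longrightarrow> \<phi> x = 0 \<and> grushin \<phi> x = 0"
proof -
  have c: "continuous_on UNIV (dir_deriv v (dir_deriv v \<phi>))" for v
    using test_function_facts(3)[OF test_functions_dir_deriv[OF test_functions_dir_deriv[OF assms]]] .
  show "continuous_on UNIV (grushin \<phi>)"
    unfolding grushin_eq[abs_def] by (intro continuous_intros c)
  obtain R where R: "\<forall>x. x \<notin> cball 0 R \<longrightarrow> \<phi> x = 0" using assms by (auto simp: test_functions_iff)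
  have "dir_deriv v (dir_deriv v \<phi>) x = 0" if "x \<notin> cball 0 R" for v x
    using dir_deriv_vanishes[of R "dir_deriv v \<phi>"] dir_deriv_vanishes[OF R] that by blast
  then have "\<forall>x. x \<notin> cball 0 R \<longrightarrow> \<phi> x = 0 \<and> grushin \<phi> x = 0"
    using R by (simp add: grushin_eq)
  then show "\<exists>R. \<forall>x. x \<notin> cball 0 R \<longrightarrow> \<phi> x = 0 \<and> grushin \<phi> x = 0" by blast
qed

text \<open>Each pure second derivative is moved onto the mode separately: those in x' give the
  oscillator equation at scale |\<xi>|, those in x'' the factors - \<xi>_j^2.\<close>

lemma integral_grushin_mode:
  fixes \<phi> :: "(real^'m::finite) \<times> (real^'n::finite) \<Rightarrow> complex"
  assumes \<phi>: "\<phi> \<in> test_functions"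
  shows "(LINT p|lborel. grushin \<phi> p * grushin_mode k \<xi> p)
     = of_real (Theta (k, \<xi>)) * (LINT p|lborel. \<phi> p * grushin_mode k \<xi> p)"
proof -
  let ?W = "grushin_mode k \<xi> :: (real^'m) \<times> (real^'n) \<Rightarrow> complex"
  let ?\<tau> = "norm \<xi>" and ?\<sigma> = "sqrt (norm \<xi>)"
  let ?C = "complex_of_real (?\<tau> powr (real CARD('m) / 4))"
  let ?A = "\<lambda>l u. complex_of_real (hermite_fun (k $ l) (?\<sigma> * u))"
  let ?A1 = "\<lambda>l u. complex_of_real (?\<sigma> * hermite_fun_deriv (k $ l) (?\<sigma> * u))"
  let ?e = "\<lambda>p. cis (- (\<xi> \<bullet> snd p))"
  have W: "?W = (\<lambda>p. ?C * (\<Prod>l\<in>UNIV. ?A l (fst p $ l)) * ?e p)"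
    by (auto simp: grushin_mode_def hermite_scaled_prod)
  obtain R where R: "\<forall>x. x \<notin> cball 0 R \<longrightarrow> \<phi> x = 0" using \<phi> by (auto simp: test_functions_iff)
  have \<phi>c: "continuous_on UNIV \<phi>" by (rule test_function_facts(3)[OF \<phi>])
  have Wc: "continuous_on UNIV ?W" unfolding W by (intro continuous_intros)
  have A: "(?A l has_vector_derivative ?A1 l u) (at u)" for l u
  proof -
    have "((\<lambda>u. hermite_fun (k $ l) (?\<sigma> * u)) has_real_derivative hermite_fun_deriv (k $ l) (?\<sigma> * u) * ?\<sigma>) (at u)"
      by (rule DERIV_chain2[OF hermite_fun_has_derivative]) (auto intro!: derivative_eq_intros)
    then show ?thesis
      by (intro has_vector_derivative_of_real) (simp add: has_real_derivative_iff_has_vector_derivative mult.commute)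
  qed
  have A1: "(?A1 l has_vector_derivative of_real (?\<tau> * (?\<tau> * u\<^sup>2 - (2 * real (k $ l) + 1))) * ?A l u) (at u)" for l u
  proof -
    have "((\<lambda>u. ?\<sigma> * hermite_fun_deriv (k $ l) (?\<sigma> * u)) has_real_derivative
        ?\<sigma> * (((?\<sigma> * u)\<^sup>2 - (2 * real (k $ l) + 1)) * hermite_fun (k $ l) (?\<sigma> * u) * ?\<sigma>)) (at u)"
      by (intro DERIV_cmult DERIV_chain2[OF hermite_fun_deriv_has_derivative]) (auto intro!: derivative_eq_intros)
    moreover have "?\<sigma> * (((?\<sigma> * u)\<^sup>2 - (2 * real (k $ l) + 1)) * hermite_fun (k $ l) (?\<sigma> * u) * ?\<sigma>)
        = ?\<tau> * (?\<tau> * u\<^sup>2 - (2 * real (k $ l) + 1)) * hermite_fun (k $ l) (?\<sigma> * u)"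
    proof -
      have "?\<sigma> * (((?\<sigma> * u)\<^sup>2 - (2 * real (k $ l) + 1)) * hermite_fun (k $ l) (?\<sigma> * u) * ?\<sigma>)
          = ?\<sigma>\<^sup>2 * (?\<sigma>\<^sup>2 * u\<^sup>2 - (2 * real (k $ l) + 1)) * hermite_fun (k $ l) (?\<sigma> * u)"
        unfolding power_mult_distrib by (simp only: power2_eq_square mult_ac)
      then show ?thesis by simp
    qed
    ultimately have "((\<lambda>u. ?\<sigma> * hermite_fun_deriv (k $ l) (?\<sigma> * u)) has_real_derivative
        ?\<tau> * (?\<tau> * u\<^sup>2 - (2 * real (k $ l) + 1)) * hermite_fun (k $ l) (?\<sigma> * u)) (at u)"
      by (simp only:)
    then have "(?A1 l has_vector_derivative
        of_real (?\<tau> * (?\<tau> * u\<^sup>2 - (2 * real (k $ l) + 1)) * hermite_fun (k $ l) (?\<sigma> * u))) (at u)"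
      by (rule has_vector_derivative_of_real)
    then show ?thesis by (simp only: of_real_mult)
  qed
  have x_part: "(LINT p|lborel. dir_deriv (axis i 1, 0) (dir_deriv (axis i 1, 0) \<phi>) p * ?W p)
      = (LINT p|lborel. \<phi> p * (of_real (?\<tau> * (?\<tau> * (fst p $ i)\<^sup>2 - (2 * real (k $ i) + 1))) * ?W p))" for i
  proof (rule integrate_by_parts_twice[OF \<phi> Wc])
    let ?W1 = "\<lambda>p. ?C * (?A1 i (fst p $ i) * (\<Prod>l\<in>UNIV - {i}. ?A l (fst p $ l))) * ?e p"
    show "continuous_on UNIV ?W1" by (intro continuous_intros)
    show "continuous_on UNIV (\<lambda>p. of_real (?\<tau> * (?\<tau> * (fst p $ i)\<^sup>2 - (2 * real (k $ i) + 1))) * ?W p)"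
      by (intro continuous_intros Wc)
    fix p :: "(real^'m) \<times> (real^'n)"
    have "((\<lambda>t. ?C * (\<Prod>l\<in>UNIV. ?A l ((fst p + t *\<^sub>R axis i 1) $ l)) * ?e p) has_vector_derivative ?W1 p) (at 0)"
      by (intro has_vector_derivative_mult_left has_vector_derivative_mult_right prod_line_derivative A)
    then show "((\<lambda>t. ?W (p + t *\<^sub>R (axis i 1, 0))) has_vector_derivative ?W1 p) (at 0)"
      unfolding W by simp
    \<comment> \<open>The first derivative is again a product over coordinates, with the i-th factor
      replaced by its derivative, so the product rule for lines applies a second time.\<close>
    let ?B = "\<lambda>l. if l = i then ?A1 i else ?A l"
    have B: "(\<Prod>l\<in>UNIV. ?B l (x $ l)) = ?A1 i (x $ i) * (\<Prod>l\<in>UNIV - {i}. ?A l (x $ l))" for x :: "real^'m"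
      by (subst prod.remove[of UNIV i]) (auto intro!: prod.cong)
    have B': "(\<Prod>l\<in>UNIV - {i}. ?B l (x $ l)) = (\<Prod>l\<in>UNIV - {i}. ?A l (x $ l))" for x :: "real^'m"
      by (auto intro!: prod.cong)
    have A': "(\<Prod>l\<in>UNIV. ?A l (x $ l)) = ?A i (x $ i) * (\<Prod>l\<in>UNIV - {i}. ?A l (x $ l))" for x :: "real^'m"
      by (subst prod.remove[of UNIV i]) auto
    let ?D = "of_real (?\<tau> * (?\<tau> * (fst p $ i)\<^sup>2 - (2 * real (k $ i) + 1))) * ?A i (fst p $ i)"
    have "((\<lambda>t. ?C * (\<Prod>l\<in>UNIV. ?B l ((fst p + t *\<^sub>R axis i 1) $ l)) * ?e p) has_vector_derivative
        ?C * (?D * (\<Prod>l\<in>UNIV - {i}. ?B l (fst p $ l))) * ?e p) (at 0)"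
      by (intro has_vector_derivative_mult_left has_vector_derivative_mult_right prod_line_derivative)
         (simp add: A1 del: of_real_mult)
    then have "((\<lambda>t. ?W1 (p + t *\<^sub>R (axis i 1, 0))) has_vector_derivative
        ?C * (?D * (\<Prod>l\<in>UNIV - {i}. ?A l (fst p $ l))) * ?e p) (at 0)"
      unfolding B B' by simp
    also have "?C * (?D * (\<Prod>l\<in>UNIV - {i}. ?A l (fst p $ l))) * ?e p
      = of_real (?\<tau> * (?\<tau> * (fst p $ i)\<^sup>2 - (2 * real (k $ i) + 1))) * ?W p"
      unfolding W A' by (simp only: mult_ac)
    finally show "((\<lambda>t. ?W1 (p + t *\<^sub>R (axis i 1, 0))) has_vector_derivative
        of_real (?\<tau> * (?\<tau> * (fst p $ i)\<^sup>2 - (2 * real (k $ i) + 1))) * ?W p) (at 0)" .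
  qed
  \<comment> \<open>The weight |x'|^2 is constant along the x'' directions and is absorbed into the
    function that gets differentiated.\<close>
  have y_part: "(LINT p|lborel. dir_deriv (0, axis j 1) (dir_deriv (0, axis j 1) \<phi>) p * (of_real ((norm (fst p))\<^sup>2) * ?W p))
      = (LINT p|lborel. \<phi> p * (of_real (- (\<xi> $ j)\<^sup>2) * (of_real ((norm (fst p))\<^sup>2) * ?W p)))" for j
  proof (rule integrate_by_parts_twice[OF \<phi>])
    let ?V = "\<lambda>p. of_real ((norm (fst p))\<^sup>2) * ?W p"
    show "continuous_on UNIV ?V" "continuous_on UNIV (\<lambda>p. (- \<i> * \<xi> $ j) * ?V p)"
      "continuous_on UNIV (\<lambda>p. of_real (- (\<xi> $ j)\<^sup>2) * ?V p)"
      by (intro continuous_intros Wc)+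
    have V: "((\<lambda>t. c * ?V (p + t *\<^sub>R (0, axis j 1))) has_vector_derivative c * ((- \<i> * \<xi> $ j) * ?V p)) (at 0)" for p c
    proof -
      have e: "?e (p + t *\<^sub>R (0, axis j 1)) = ?e p * cis (- (\<xi> $ j * t))" for t
        by (simp add: inner_add_right inner_axis cis_mult algebra_simps)
      have "((\<lambda>t. cis (- (\<xi> $ j * t))) has_vector_derivative - \<i> * \<xi> $ j) (at 0)"
        using cis_has_vector_derivative[of "\<xi> $ j" 0] by simp
      then have "((\<lambda>t. (c * of_real ((norm (fst p))\<^sup>2) * (?C * (\<Prod>l\<in>UNIV. ?A l (fst p $ l))) * ?e p) * cis (- (\<xi> $ j * t)))
          has_vector_derivative (c * of_real ((norm (fst p))\<^sup>2) * (?C * (\<Prod>l\<in>UNIV. ?A l (fst p $ l))) * ?e p) * (- \<i> * \<xi> $ j)) (at 0)"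
        by (rule has_vector_derivative_mult_right)
      then show ?thesis unfolding W e by (simp add: mult_ac)
    qed
    show "((\<lambda>t. ?V (p + t *\<^sub>R (0, axis j 1))) has_vector_derivative (- \<i> * \<xi> $ j) * ?V p) (at 0)" for p
      using V[of 1 p] by simp
    show "((\<lambda>t. (- \<i> * \<xi> $ j) * ?V (p + t *\<^sub>R (0, axis j 1))) has_vector_derivative of_real (- (\<xi> $ j)\<^sup>2) * ?V p) (at 0)" for p
      using V[of "- \<i> * \<xi> $ j" p] by (simp add: power2_eq_square mult_ac)
  qed
  have DD: "integrable lborel (\<lambda>p. dir_deriv v (dir_deriv v \<phi>) p * f p)"
    "integrable lborel (\<lambda>p. \<phi> p * f p)" if "continuous_on UNIV f" for v f
  proof -
    show "integrable lborel (\<lambda>p. \<phi> p * f p)"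
      by (rule compact_support_integrable(1)[of _ R]) (use R \<phi>c that in \<open>auto intro!: continuous_intros\<close>)
    have "dir_deriv v (dir_deriv v \<phi>) x = 0" if "x \<notin> cball 0 R" for x
      using dir_deriv_vanishes[of R "dir_deriv v \<phi>"] dir_deriv_vanishes[OF R] that by blast
    moreover have "continuous_on UNIV (dir_deriv v (dir_deriv v \<phi>))"
      using test_function_facts(3)[OF test_functions_dir_deriv[OF test_functions_dir_deriv[OF \<phi>]]] .
    ultimately show "integrable lborel (\<lambda>p. dir_deriv v (dir_deriv v \<phi>) p * f p)"
      using that by (intro compact_support_integrable(1)[of _ R]) (auto intro!: continuous_intros)
  qed
  have c1: "continuous_on UNIV (\<lambda>p. of_real ((norm (fst p))\<^sup>2) * ?W p)"
    "continuous_on UNIV (\<lambda>p. of_real (?\<tau> * (?\<tau> * (fst p $ i)\<^sup>2 - (2 * real (k $ i) + 1))) * ?W p)"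
    "continuous_on UNIV (\<lambda>p. of_real (- (\<xi> $ j)\<^sup>2) * (of_real ((norm (fst p))\<^sup>2) * ?W p))" for i j
    by (intro continuous_intros Wc)+
  define P where "P i = dir_deriv (axis i 1, 0) (dir_deriv (axis i 1, 0) \<phi>)" for i
  define Q where "Q j = dir_deriv (0, axis j 1) (dir_deriv (0, axis j 1) \<phi>)" for j
  define N where "N p = (norm (fst p))\<^sup>2" for p :: "(real^'m) \<times> (real^'n)"
  define a where "a i p = ?\<tau> * (?\<tau> * (fst p $ i)\<^sup>2 - (2 * real (k $ i) + 1))" for i and p :: "(real^'m) \<times> (real^'n)"
  define W where "W = ?W"
  note x = x_part[folded P_def a_def W_def] and y = y_part[folded Q_def N_def W_def]
  have i1: "integrable lborel (\<lambda>p. P i p * W p)" "integrable lborel (\<lambda>p. \<phi> p * (of_real (a i p) * W p))" for i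
    unfolding P_def a_def W_def by (rule DD(1)[OF Wc], rule DD(2)[OF c1(2)])
  have i2: "integrable lborel (\<lambda>p. Q j p * (of_real (N p) * W p))"
    "integrable lborel (\<lambda>p. \<phi> p * (of_real (- (\<xi> $ j)\<^sup>2) * (of_real (N p) * W p)))" for j
    unfolding Q_def N_def W_def by (rule DD(1)[OF c1(1)], rule DD(2)[OF c1(3)])
  have g: "grushin \<phi> p * W p = - (\<Sum>i\<in>UNIV. P i p * W p) - (\<Sum>j\<in>UNIV. Q j p * (of_real (N p) * W p))" for p
  proof -
    have e: "grushin \<phi> p = - (\<Sum>i\<in>UNIV. P i p) - of_real (N p) * (\<Sum>j\<in>UNIV. Q j p)"
      by (simp add: grushin_eq P_def Q_def N_def)
    have "grushin \<phi> p * W p = - ((\<Sum>i\<in>UNIV. P i p) * W p) - (\<Sum>j\<in>UNIV. Q j p) * (of_real (N p) * W p)"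
      unfolding e by (simp add: algebra_simps)
    then show ?thesis by (simp only: sum_distrib_right)
  qed
  \<comment> \<open>The oscillator contributes - |\<xi>|^2 |x'|^2 and the weighted x'' part +
    |\<xi>|^2 |x'|^2. These cancel, and only |\<xi>| (2|k| + d') remains.\<close>
  have t: "- (\<Sum>i\<in>UNIV. \<phi> p * (of_real (a i p) * W p)) - (\<Sum>j\<in>UNIV. \<phi> p * (of_real (- (\<xi> $ j)\<^sup>2) * (of_real (N p) * W p)))
      = of_real (Theta (k, \<xi>)) * (\<phi> p * W p)" for p
  proof -
    have "(\<Sum>i\<in>UNIV. a i p) = ?\<tau> * (?\<tau> * N p - (2 * real (\<Sum>i\<in>UNIV. k $ i) + real CARD('m)))"
      by (simp add: a_def N_def norm_vec_sq sum_distrib_left[symmetric] sum_subtractf sum.distrib)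
    moreover have "(\<Sum>j\<in>UNIV. - (\<xi> $ j)\<^sup>2) = - ?\<tau>\<^sup>2"
      by (simp add: norm_vec_sq sum_negf)
    ultimately have T: "- (\<Sum>i\<in>UNIV. a i p) - (\<Sum>j\<in>UNIV. - (\<xi> $ j)\<^sup>2) * N p = Theta (k, \<xi>)"
      by (simp add: Theta_def algebra_simps power2_eq_square)
    have "\<phi> p * (of_real (a i p) * W p) = of_real (a i p) * (\<phi> p * W p)" for i
      by (simp only: mult.left_commute)
    then have s1: "(\<Sum>i\<in>UNIV. \<phi> p * (of_real (a i p) * W p)) = of_real (\<Sum>i\<in>UNIV. a i p) * (\<phi> p * W p)"
      by (simp only: of_real_sum sum_distrib_right)
    have "\<phi> p * (of_real (- (\<xi> $ j)\<^sup>2) * (of_real (N p) * W p)) = of_real (- (\<xi> $ j)\<^sup>2) * (of_real (N p) * (\<phi> p * W p))" for j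
      by (simp only: mult.left_commute)
    then have s2: "(\<Sum>j\<in>UNIV. \<phi> p * (of_real (- (\<xi> $ j)\<^sup>2) * (of_real (N p) * W p)))
        = of_real (\<Sum>j\<in>UNIV. - (\<xi> $ j)\<^sup>2) * (of_real (N p) * (\<phi> p * W p))"
      by (simp only: of_real_sum sum_distrib_right)
    show ?thesis
      unfolding s1 s2 T[symmetric]
      by (simp only: of_real_diff of_real_minus of_real_mult left_diff_distrib minus_mult_left mult.assoc)
  qed
  have "(LINT p|lborel. grushin \<phi> p * W p)
      = - (\<Sum>i\<in>UNIV. LINT p|lborel. P i p * W p) - (\<Sum>j\<in>UNIV. LINT p|lborel. Q j p * (of_real (N p) * W p))"
    unfolding g by (simp add: Bochner_Integration.integral_sum i1(1) i2(1))
  also have "\<dots> = - (\<Sum>i\<in>UNIV. LINT p|lborel. \<phi> p * (of_real (a i p) * W p))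
      - (\<Sum>j\<in>UNIV. LINT p|lborel. \<phi> p * (of_real (- (\<xi> $ j)\<^sup>2) * (of_real (N p) * W p)))"
    by (simp only: x y)
  also have "\<dots> = (LINT p|lborel. - (\<Sum>i\<in>UNIV. \<phi> p * (of_real (a i p) * W p))
      - (\<Sum>j\<in>UNIV. \<phi> p * (of_real (- (\<xi> $ j)\<^sup>2) * (of_real (N p) * W p))))"
    using i1(2) i2(2) by (simp add: Bochner_Integration.integral_sum del: of_real_minus of_real_power mult_minus_left)
  also have "\<dots> = of_real (Theta (k, \<xi>)) * (LINT p|lborel. \<phi> p * W p)"
    unfolding t by (rule integral_mult_right_zero)
  finally show ?thesis unfolding W_def .
qed

lemma calG_grushin:
  fixes \<phi> :: "(real^'m::finite) \<times> (real^'n::finite) \<Rightarrow> complex"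
  assumes \<phi>: "\<phi> \<in> test_functions"
  shows "grushin \<phi> \<in> L2 lborel" and "AE q in Gamma_measure. calG (grushin \<phi>) q = mult_Theta (calG \<phi>) q"
proof -
  obtain R where R: "\<forall>x. x \<notin> cball 0 R \<longrightarrow> \<phi> x = 0" "\<forall>x. x \<notin> cball 0 R \<longrightarrow> grushin \<phi> x = 0"
    using grushin_compact_support(2)[OF \<phi>] by blast
  note c = grushin_compact_support(1)[OF \<phi>]
  show "grushin \<phi> \<in> L2 lborel" by (rule compact_support_integrable(2)[OF c R(2)])
  show "AE q in Gamma_measure. calG (grushin \<phi>) q = mult_Theta (calG \<phi>) q"
    using calG_compact_support[OF c R(2)] calG_compact_support[OF test_function_facts(3)[OF \<phi>] R(1)]
    by eventually_elim (simp add: integral_grushin_mode[OF \<phi>] mult_Theta_def)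
qed

lemma mult_Theta_measurable:
  fixes F :: "(nat^'m::finite) \<times> (real^'n::finite) \<Rightarrow> complex"
  assumes "F \<in> borel_measurable Gamma_measure"
  shows "mult_Theta F \<in> borel_measurable Gamma_measure"
proof -
  have "Theta \<in> borel_measurable (Gamma_measure :: ((nat^'m) \<times> (real^'n)) measure)"
    unfolding Gamma_measure_def Theta_def by (intro measurable_pair_measure_countable1) auto
  with assms show ?thesis unfolding mult_Theta_def by measurable
qed

text \<open>Unitarity of \<open>calG\<close> carries both sides of the weak equation to the
  frequency side, where \<Theta> is real and may be moved from one factor to the other.\<close>

lemma Dom_bbG_weak_grushin:
  fixes f :: "(real^'m::finite) \<times> (real^'n::finite) \<Rightarrow> complex"
  assumes "f \<in> Dom_bbG"
  shows "is_weak_grushin f (bbG f)"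
proof -
  have f: "f \<in> L2 lborel" and T: "mult_Theta (calG f) \<in> L2 Gamma_measure"
    using assms by (auto simp: Dom_bbG_def)
  have h: "bbG f \<in> L2 lborel" and cal: "AE q in Gamma_measure. calG (bbG f) q = mult_Theta (calG f) q"
    using calG_surj[OF T] by (auto simp: bbG_def)
  show ?thesis
    unfolding is_weak_grushin_def
  proof (intro conjI h ballI)
    fix \<phi> :: "(real^'m) \<times> (real^'n) \<Rightarrow> complex" assume \<phi>: "\<phi> \<in> test_functions"
    note \<phi>2 = test_function_facts(2)[OF \<phi>]
    have "L2_inner lborel (grushin \<phi>) f = L2_inner Gamma_measure (calG (grushin \<phi>)) (calG f)"
      by (rule calG_inner[OF calG_grushin(1)[OF \<phi>] f, symmetric])
    also have "\<dots> = (LINT q|Gamma_measure. mult_Theta (calG \<phi>) q * cnj (calG f q))"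
    proof -
      have [measurable]: "calG (grushin \<phi>) \<in> borel_measurable Gamma_measure" "calG f \<in> borel_measurable Gamma_measure"
        "calG \<phi> \<in> borel_measurable Gamma_measure"
        by (intro calG_measurable calG_grushin(1) \<phi> f \<phi>2)+
      note [measurable] = mult_Theta_measurable[OF calG_measurable[OF \<phi>2]]
      show ?thesis
        unfolding L2_inner_def using calG_grushin(2)[OF \<phi>]
        by (intro integral_cong_AE) auto
    qed
    also have "\<dots> = L2_inner Gamma_measure (calG \<phi>) (mult_Theta (calG f))"
      by (simp add: L2_inner_def mult_Theta_def mult_ac)
    also have "\<dots> = L2_inner Gamma_measure (calG \<phi>) (calG (bbG f))"
      using cal by (intro L2_inner_cong_AE L2_measurable[where M=Gamma_measure] calG_L2 \<phi>2 h T) auto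
    also have "\<dots> = L2_inner lborel \<phi> (bbG f)" by (rule calG_inner[OF \<phi>2 h])
    finally show "L2_inner lborel (grushin \<phi>) f = L2_inner lborel \<phi> (bbG f)" .
  qed
qed

section \<open>The weak equation and the transform\<close>

definition laplacian :: "(real^'n::finite \<Rightarrow> complex) \<Rightarrow> real^'n \<Rightarrow> complex" where
  "laplacian b x = (\<Sum>j\<in>UNIV. dir_deriv (axis j 1) (dir_deriv (axis j 1) b) x)"

lemma laplacian_test_function:
  assumes "b \<in> test_functions"
  shows "integrable lborel (laplacian b)" "laplacian b \<in> L2 lborel" "continuous_on UNIV (laplacian b)"
proof -
  note D = test_function_facts[OF test_functions_dir_deriv[OF test_functions_dir_deriv[OF assms]]]
  show "integrable lborel (laplacian b)"
    unfolding laplacian_def[abs_def] by (intro Bochner_Integration.integrable_sum D)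
  show "laplacian b \<in> L2 lborel"
    unfolding laplacian_def[abs_def] by (intro L2_sum D)
  show "continuous_on UNIV (laplacian b)"
    unfolding laplacian_def[abs_def] by (intro continuous_on_sum D)
qed

text \<open>Integration by parts against the character, coordinate by coordinate.\<close>

lemma fourier_integral_laplacian:
  assumes b: "b \<in> test_functions"
  shows "fourier_integral (laplacian b) \<xi> = - of_real ((norm \<xi>)\<^sup>2) * fourier_integral b (\<xi>::real^'n::finite)"
proof -
  let ?e = "\<lambda>x. cis (- (\<xi> \<bullet> x))"
  have ibp: "(LINT x|lborel. dir_deriv (axis j 1) (dir_deriv (axis j 1) b) x * ?e x)
      = (LINT x|lborel. b x * (of_real (- (\<xi> $ j)\<^sup>2) * ?e x))" for j
  proof (rule integrate_by_parts_twice[OF b])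
    show "continuous_on UNIV ?e" "continuous_on UNIV (\<lambda>x. (- \<i> * \<xi> $ j) * ?e x)"
      "continuous_on UNIV (\<lambda>x. of_real (- (\<xi> $ j)\<^sup>2) * ?e x)"
      by (intro continuous_intros)+
    have V: "((\<lambda>t. c * ?e (x + t *\<^sub>R axis j 1)) has_vector_derivative c * ((- \<i> * \<xi> $ j) * ?e x)) (at 0)" for x c
    proof -
      have e: "?e (x + t *\<^sub>R axis j 1) = ?e x * cis (- (\<xi> $ j * t))" for t
        by (simp add: inner_add_right inner_axis cis_mult algebra_simps)
      have "((\<lambda>t. cis (- (\<xi> $ j * t))) has_vector_derivative - \<i> * \<xi> $ j) (at 0)"
        using cis_has_vector_derivative[of "\<xi> $ j" 0] by simp
      then have "((\<lambda>t. (c * ?e x) * cis (- (\<xi> $ j * t))) has_vector_derivative (c * ?e x) * (- \<i> * \<xi> $ j)) (at 0)"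
        by (rule has_vector_derivative_mult_right)
      then show ?thesis unfolding e by (simp add: mult_ac)
    qed
    show "((\<lambda>t. ?e (x + t *\<^sub>R axis j 1)) has_vector_derivative (- \<i> * \<xi> $ j) * ?e x) (at 0)" for x
      using V[of 1 x] by simp
    show "((\<lambda>t. (- \<i> * \<xi> $ j) * ?e (x + t *\<^sub>R axis j 1)) has_vector_derivative of_real (- (\<xi> $ j)\<^sup>2) * ?e x) (at 0)" for x
      using V[of "- \<i> * \<xi> $ j" x] by (simp add: power2_eq_square mult_ac)
  qed
  have int: "integrable lborel (\<lambda>x. g x * ?e x)" if "integrable lborel g" for g
    using that by (rule Bochner_Integration.integrable_bound)
      (use borel_measurable_integrable[OF that] in \<open>auto simp: norm_mult\<close>)
  have "(LINT x|lborel. laplacian b x * ?e x) = (LINT x|lborel. (\<Sum>j\<in>UNIV. dir_deriv (axis j 1) (dir_deriv (axis j 1) b) x * ?e x))"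
    by (simp add: laplacian_def sum_distrib_right)
  also have "\<dots> = (\<Sum>j\<in>UNIV. LINT x|lborel. dir_deriv (axis j 1) (dir_deriv (axis j 1) b) x * ?e x)"
    by (intro Bochner_Integration.integral_sum int test_function_facts(1) test_functions_dir_deriv b)
  also have "\<dots> = (\<Sum>j\<in>UNIV. of_real (- (\<xi> $ j)\<^sup>2) * (LINT x|lborel. b x * ?e x))"
  proof -
    have "(LINT x|lborel. b x * (of_real (- (\<xi> $ j)\<^sup>2) * ?e x)) = of_real (- (\<xi> $ j)\<^sup>2) * (LINT x|lborel. b x * ?e x)" for j
      unfolding integral_mult_right_zero[symmetric] by (simp only: mult.left_commute)
    then show ?thesis unfolding ibp by (simp only:)
  qed
  also have "\<dots> = - of_real ((norm \<xi>)\<^sup>2) * (LINT x|lborel. b x * ?e x)"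
    by (simp add: norm_vec_sq sum_negf sum_distrib_right)
  finally show ?thesis by (simp add: fourier_integral_def)
qed

text \<open>A product bump of half-width 1/N around y. Translation by y produces a character on the
  frequency side; varying N avoids common zeros of the transforms.\<close>

definition bump_vec :: "real \<Rightarrow> real^'n::finite \<Rightarrow> real^'n \<Rightarrow> complex" where
  "bump_vec N y x = (\<Prod>j\<in>UNIV. of_real (bump (N * (x $ j - y $ j))))"

text \<open>The additional smooth factors A j let the same statement cover plain bumps and truncated
  Hermite functions.\<close>

lemma bump_prod_test_function:
  fixes A :: "'n::finite \<Rightarrow> real \<Rightarrow> complex"
  assumes "\<And>j. smooth (A j)" and "0 < N"
  shows "(\<lambda>x::real^'n. \<Prod>j\<in>UNIV. of_real (bump (N * (x $ j - y $ j))) * A j (x $ j)) \<in> test_functions"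
  unfolding test_functions_iff
proof
  have 1: "smooth (\<lambda>x::real^'n. complex_of_real (bump (N * (x $ j - y $ j))))" for j
  proof -
    have "bounded_linear (\<lambda>x::real^'n. N * x $ j)"
      by (intro bounded_linear_const_mult bounded_linear_vec_nth)
    from smooth_compose_affine[OF this smooth_bump, of "- N * y $ j"]
    show ?thesis by (simp add: algebra_simps)
  qed
  have 2: "smooth (\<lambda>x::real^'n. A j (x $ j))" for j
    using smooth_compose_affine[OF bounded_linear_vec_nth assms(1)[of j], of j 0] by simp
  show "smooth (\<lambda>x::real^'n. \<Prod>j\<in>UNIV. of_real (bump (N * (x $ j - y $ j))) * A j (x $ j))"
    by (intro smooth_prod smooth_mult 1 2)
  show "\<exists>R. \<forall>x::real^'n. x \<notin> cball 0 R \<longrightarrow> (\<Prod>j\<in>UNIV. of_real (bump (N * (x $ j - y $ j))) * A j (x $ j)) = 0"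
  proof (intro exI allI impI)
    fix x :: "real^'n"
    \<comment> \<open>On the support each coordinate satisfies |x_j| < |y_j| + 1/N; the sum bounds
      the l1 norm and hence the Euclidean norm.\<close>
    assume x: "x \<notin> cball 0 (\<Sum>j\<in>UNIV. \<bar>y $ j\<bar> + 1 / N)"
    have "\<exists>j. \<bar>x $ j - y $ j\<bar> \<ge> 1 / N"
    proof (rule ccontr)
      assume "\<not> ?thesis"
      then have lt: "\<bar>x $ j - y $ j\<bar> < 1 / N" for j by (auto simp: not_le)
      have "\<bar>x $ j\<bar> \<le> \<bar>y $ j\<bar> + 1 / N" for j
        using lt[of j] abs_triangle_ineq[of "y $ j" "x $ j - y $ j"] by simp
      then have "norm x \<le> (\<Sum>j\<in>UNIV. \<bar>y $ j\<bar> + 1 / N)"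
        by (intro order_trans[OF norm_le_l1_cart] sum_mono)
      then show False using x by simp
    qed
    then obtain j where "\<bar>x $ j - y $ j\<bar> \<ge> 1 / N" by blast
    then have "1 \<le> \<bar>N * (x $ j - y $ j)\<bar>" using assms(2) by (simp add: abs_mult pos_divide_le_eq mult.commute)
    then have "bump (N * (x $ j - y $ j)) = 0" by (rule bump_outside)
    then show "(\<Prod>j\<in>UNIV. of_real (bump (N * (x $ j - y $ j))) * A j (x $ j)) = 0"
      by (intro prod_zero) (auto intro!: bexI[of _ j])
  qed
qed

lemma bump_vec_test_function: "0 < N \<Longrightarrow> bump_vec N y \<in> test_functions"
  using bump_prod_test_function[of "\<lambda>_ _. 1" N y] smooth_const[of 1] by (simp add: bump_vec_def[abs_def])

lemma bump_continuous [continuous_intros]: "continuous_on A f \<Longrightarrow> continuous_on A (\<lambda>x. bump (f x))"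
proof -
  obtain b1 where "\<And>u. (bump has_real_derivative b1 u) (at u)" using bump_derivatives by metis
  then have "continuous_on UNIV bump"
    by (auto intro!: continuous_at_imp_continuous_on DERIV_isCont)
  then show "continuous_on A f \<Longrightarrow> continuous_on A (\<lambda>x. bump (f x))"
    by (rule continuous_on_compose2) auto
qed

text \<open>If the integral vanished, the nonnegative bump would be zero almost everywhere; but the
  open set where it is nonzero contains 0.\<close>

lemma integral_bump_nonzero: "(LINT u|lborel. complex_of_real (bump u)) \<noteq> 0" and integrable_bump: "integrable lborel bump"
proof -
  have "integrable lborel (\<lambda>u. complex_of_real (bump u))"
    by (rule compact_support_integrable(1)[of _ 1]) (auto intro!: continuous_intros bump_outside)
  from integrable_Re[OF this] show int: "integrable lborel bump" by simp
  show "(LINT u|lborel. complex_of_real (bump u)) \<noteq> 0"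
  proof
    assume "(LINT u|lborel. complex_of_real (bump u)) = 0"
    then have "(LINT u|lborel. bump u) = 0" by simp
    then have "AE u in lborel. bump u = 0"
      using int by (subst (asm) integral_nonneg_eq_0_iff_AE) (auto simp: bump_nonneg)
    moreover have op: "open {u. bump u \<noteq> 0}"
      by (intro open_Collect_neq continuous_intros)
    ultimately have "{u. bump u \<noteq> 0} \<in> null_sets lborel"
      by (subst AE_iff_null_sets) (auto simp: borel_open)
    then have "negligible {u. bump u \<noteq> 0}"
      by (simp add: negligible_iff_null_sets null_sets_completionI)
    moreover have "0 \<in> {u. bump u \<noteq> 0}" by simp
    ultimately show False using open_not_negligible[OF op] by blast
  qed
qed

lemma bump_vec_fourier_translate:
  assumes "0 < N"
  shows "fourier_integral (bump_vec N y) \<xi> = cis (- (\<xi> \<bullet> y)) * fourier_integral (bump_vec N 0) (\<xi>::real^'n::finite)"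
proof -
  have [measurable]: "bump_vec N y \<in> borel_measurable borel" for y :: "real^'n"
    by (intro borel_measurable_continuous_onI test_function_facts(3) bump_vec_test_function assms)
  have "(LINT x|lborel. bump_vec N y x * cis (- (\<xi> \<bullet> x)))
      = (LINT x|lborel. bump_vec N y (y + 1 *\<^sub>R x) * cis (- (\<xi> \<bullet> (y + 1 *\<^sub>R x))))"
    by (subst lborel_integral_affine(1)[of _ 1 y]) auto
  also have "\<dots> = (LINT x|lborel. cis (- (\<xi> \<bullet> y)) * (bump_vec N 0 x * cis (- (\<xi> \<bullet> x))))"
  proof (intro Bochner_Integration.integral_cong refl)
    fix x
    have e: "- (\<xi> \<bullet> (y + 1 *\<^sub>R x)) = - (\<xi> \<bullet> y) + - (\<xi> \<bullet> x)" by (simp add: inner_add_right)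
    have "bump_vec N y (y + 1 *\<^sub>R x) = bump_vec N 0 x" by (simp add: bump_vec_def)
    then show "bump_vec N y (y + 1 *\<^sub>R x) * cis (- (\<xi> \<bullet> (y + 1 *\<^sub>R x))) = cis (- (\<xi> \<bullet> y)) * (bump_vec N 0 x * cis (- (\<xi> \<bullet> x)))"
      unfolding e cis_mult[symmetric] by simp
  qed
  finally show ?thesis by (simp add: fourier_integral_def)
qed

text \<open>Rescaling turns the transform of the bump of half-width 1/(n+1) at \<xi> into a multiple
  of that of the unit bump at \<xi>/(n+1). If all of these vanished, so would their limit, the
  integral of the unit bump.\<close>

lemma bump_vec_fourier_nonzero: "\<exists>n. fourier_integral (bump_vec (real (Suc n)) 0) (\<xi>::real^'n::finite) \<noteq> 0"
proof (rule ccontr)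
  assume "\<not> ?thesis"
  then have 0: "fourier_integral (bump_vec (real (Suc n)) 0) \<xi> = 0" for n by blast
  have t: "bump_vec 1 (0::real^'n) \<in> test_functions" by (rule bump_vec_test_function) simp
  note B = test_function_facts[OF t]
  have [measurable]: "bump_vec 1 (0::real^'n) \<in> borel_measurable borel"
    by (intro borel_measurable_continuous_onI B)
  have "(LINT x|lborel. bump_vec 1 0 x * cis (- (\<xi> \<bullet> ((1 / real (Suc n)) *\<^sub>R x)))) = 0" for n
  proof -
    let ?N = "real (Suc n)"
    have m: "bump_vec ?N (0::real^'n) \<in> borel_measurable borel"
      by (intro borel_measurable_continuous_onI test_function_facts(3) bump_vec_test_function) simp
    have "(LINT x|lborel. bump_vec ?N 0 x * cis (- (\<xi> \<bullet> x)))
        = \<bar>1 / ?N\<bar> ^ DIM(real^'n) *\<^sub>R (LINT x|lborel. bump_vec ?N 0 (0 + (1 / ?N) *\<^sub>R x) * cis (- (\<xi> \<bullet> (0 + (1 / ?N) *\<^sub>R x))))"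
      by (rule lborel_integral_affine(1)) (use m in auto)
    moreover have "bump_vec ?N 0 (0 + (1 / ?N) *\<^sub>R x) = bump_vec 1 0 x" for x :: "real^'n"
      by (simp add: bump_vec_def del: of_nat_Suc)
    moreover have "(LINT x|lborel. bump_vec ?N 0 x * cis (- (\<xi> \<bullet> x))) = 0"
      using 0[of n] by (simp add: fourier_integral_def)
    ultimately show ?thesis by simp
  qed
  moreover have "(\<lambda>n. LINT x|lborel. bump_vec 1 0 x * cis (- (\<xi> \<bullet> ((1 / real (Suc n)) *\<^sub>R x)))) \<longlonglongrightarrow> (LINT x|lborel. bump_vec 1 (0::real^'n) x * 1)"
  proof (rule integral_dominated_convergence[where w="\<lambda>x. norm (bump_vec 1 (0::real^'n) x)"])
    show "AE x in lborel. (\<lambda>n. bump_vec 1 0 x * cis (- (\<xi> \<bullet> ((1 / real (Suc n)) *\<^sub>R x)))) \<longlonglongrightarrow> bump_vec 1 0 x * 1"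
    proof (intro AE_I2 tendsto_mult tendsto_const)
      fix x
      have "(\<lambda>n. 1 / real (Suc n)) \<longlonglongrightarrow> 0" by (rule lim_1_over_n[THEN LIMSEQ_Suc])
      from tendsto_scaleR[OF this tendsto_const, of x]
      have "(\<lambda>n. - (\<xi> \<bullet> ((1 / real (Suc n)) *\<^sub>R x))) \<longlonglongrightarrow> - (\<xi> \<bullet> 0)"
        by (intro tendsto_minus tendsto_inner tendsto_const) simp
      from continuous_on_tendsto_compose[OF continuous_on_cis[OF continuous_on_id[of UNIV]] this]
      show "(\<lambda>n. cis (- (\<xi> \<bullet> ((1 / real (Suc n)) *\<^sub>R x)))) \<longlonglongrightarrow> 1" by simp
    qed
    show "integrable lborel (\<lambda>x. norm (bump_vec 1 (0::real^'n) x))" using B(1) by simp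
  qed (auto simp: norm_mult)
  ultimately have "(LINT x|lborel. bump_vec 1 (0::real^'n) x) = 0"
    by (simp add: LIMSEQ_const_iff)
  moreover have "(LINT x|lborel. bump_vec 1 (0::real^'n) x) = (\<Prod>j\<in>(UNIV::'n set). LINT u|lborel. complex_of_real (bump u))"
    unfolding bump_vec_def using integral_lborel_prod_vec[of "\<lambda>_ u. complex_of_real (bump u)"] integrable_bump by simp
  ultimately show False using integral_bump_nonzero by simp
qed

text \<open>The equation is tested with all translates of one bump. By Plancherel this says that an
  integrable function v of the frequency has vanishing Fourier integral at every translation vector
  y, so v = 0 almost everywhere; the transform of the bump is then divided out.\<close>

lemma weak_laplacian_fourier:
  fixes F1 F2 :: "real^'n::finite \<Rightarrow> complex"
  assumes weak: "\<And>b. b \<in> test_functions \<Longrightarrow> L2_inner lborel (\<lambda>x. - laplacian b x) F2 = L2_inner lborel b F1"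
    and f1: "is_fourier_L2 F1 \<Phi>1" and f2: "is_fourier_L2 F2 \<Phi>2"
  shows "AE \<xi> in lborel. of_real ((norm \<xi>)\<^sup>2) * \<Phi>2 \<xi> = \<Phi>1 \<xi>"
proof -
  have L: "\<Phi>1 \<in> L2 lborel" "\<Phi>2 \<in> L2 lborel" using f1 f2 by (auto simp: is_fourier_L2_def)
  have four: "is_fourier_L2 b (fourier_integral b)" if "integrable lborel b" "b \<in> L2 lborel" for b :: "real^'n \<Rightarrow> complex"
    using fourier_integral_L1_L2[OF that] that by (simp add: is_fourier_L2_iff)
  have "AE \<xi> in lborel. fourier_integral (bump_vec (real (Suc n)) 0) \<xi> * cnj (of_real ((norm \<xi>)\<^sup>2) * \<Phi>2 \<xi> - \<Phi>1 \<xi>) = 0" for n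
  proof -
    let ?N = "real (Suc n)"
    let ?b = "\<lambda>y::real^'n. bump_vec ?N y"
    let ?F = "fourier_integral (?b 0)"
    have b: "?b y \<in> test_functions" for y by (rule bump_vec_test_function) simp
    note bt = test_function_facts[OF b] and lt = laplacian_test_function[OF b]
    have FL: "is_fourier_L2 (?b y) (fourier_integral (?b y))" for y by (rule four[OF bt(1,2)])
    have FD: "is_fourier_L2 (laplacian (?b y)) (fourier_integral (laplacian (?b y)))" for y by (rule four[OF lt(1,2)])
    have "fourier_integral (laplacian (?b y)) = (\<lambda>\<xi>. - of_real ((norm \<xi>)\<^sup>2) * fourier_integral (?b y) \<xi>)" for y
      by (rule ext) (rule fourier_integral_laplacian[OF b])
    with FD have FD': "is_fourier_L2 (laplacian (?b y)) (\<lambda>\<xi>. - of_real ((norm \<xi>)\<^sup>2) * fourier_integral (?b y) \<xi>)" for y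
      by simp
    \<comment> \<open>|\<xi>|^2 times the transform of the bump is, up to sign, the transform of its
      Laplacian. This makes v a difference of products of square-integrable functions, hence
      integrable, although |\<xi>|^2 \<Phi>2 need not be square integrable a priori.\<close>
    have m2: "(\<lambda>\<xi>. of_real ((norm \<xi>)\<^sup>2) * ?F \<xi>) \<in> L2 lborel"
    proof -
      have "(\<lambda>\<xi>. - of_real ((norm \<xi>)\<^sup>2) * ?F \<xi>) \<in> L2 lborel" using FD'[of 0] by (simp add: is_fourier_L2_def)
      from L2_cmult[OF this, of "-1"] show ?thesis by simp
    qed
    have m1: "?F \<in> L2 lborel" using FL[of 0] by (simp add: is_fourier_L2_def)
    define v where "v \<xi> = ?F \<xi> * cnj (of_real ((norm \<xi>)\<^sup>2) * \<Phi>2 \<xi> - \<Phi>1 \<xi>)" for \<xi>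
    have v_eq: "v \<xi> = (of_real ((norm \<xi>)\<^sup>2) * ?F \<xi>) * cnj (\<Phi>2 \<xi>) - ?F \<xi> * cnj (\<Phi>1 \<xi>)" for \<xi>
      by (simp add: v_def algebra_simps)
    have i1: "integrable lborel (\<lambda>\<xi>. ?F \<xi> * cnj (\<Phi>1 \<xi>))" "integrable lborel (\<lambda>\<xi>. (of_real ((norm \<xi>)\<^sup>2) * ?F \<xi>) * cnj (\<Phi>2 \<xi>))"
      by (intro L2_inner_integrable L m1 m2)+
    have v_int: "integrable lborel v" unfolding v_eq[abs_def] by (intro Bochner_Integration.integrable_diff i1)
    have "(LINT \<xi>|lborel. v \<xi> * cis (- (y \<bullet> \<xi>))) = 0" for y
    proof -
      have "L2_inner lborel (\<lambda>\<xi>. of_real ((norm \<xi>)\<^sup>2) * fourier_integral (?b y) \<xi>) \<Phi>2 = - L2_inner lborel (\<lambda>\<xi>. - of_real ((norm \<xi>)\<^sup>2) * fourier_integral (?b y) \<xi>) \<Phi>2"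
        by (simp add: L2_inner_def)
      also have "\<dots> = - L2_inner lborel (laplacian (?b y)) F2"
        by (simp only: is_fourier_L2_inner[OF FD' f2])
      also have "\<dots> = L2_inner lborel (\<lambda>x. - laplacian (?b y) x) F2" by (simp add: L2_inner_def)
      also have "\<dots> = L2_inner lborel (fourier_integral (?b y)) \<Phi>1"
        by (simp only: weak[OF b] is_fourier_L2_inner[OF FL f1])
      finally have e: "(LINT \<xi>|lborel. of_real ((norm \<xi>)\<^sup>2) * fourier_integral (?b y) \<xi> * cnj (\<Phi>2 \<xi>)) = (LINT \<xi>|lborel. fourier_integral (?b y) \<xi> * cnj (\<Phi>1 \<xi>))"
        by (simp add: L2_inner_def)
      have tr: "fourier_integral (?b y) \<xi> = cis (- (y \<bullet> \<xi>)) * ?F \<xi>" for \<xi>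
        by (subst bump_vec_fourier_translate) (simp_all add: inner_commute)
      have ic: "integrable lborel (\<lambda>\<xi>. cis (- (y \<bullet> \<xi>)) * g \<xi>)" if "integrable lborel g" for g :: "real^'n \<Rightarrow> complex"
        using that by (rule Bochner_Integration.integrable_bound)
          (use borel_measurable_integrable[OF that] in \<open>auto simp: norm_mult\<close>)
      have "v \<xi> * cis (- (y \<bullet> \<xi>)) = cis (- (y \<bullet> \<xi>)) * ((of_real ((norm \<xi>)\<^sup>2) * ?F \<xi>) * cnj (\<Phi>2 \<xi>)) - cis (- (y \<bullet> \<xi>)) * (?F \<xi> * cnj (\<Phi>1 \<xi>))" for \<xi>
        by (simp add: v_eq algebra_simps)
      then have "(LINT \<xi>|lborel. v \<xi> * cis (- (y \<bullet> \<xi>))) = (LINT \<xi>|lborel. cis (- (y \<bullet> \<xi>)) * ((of_real ((norm \<xi>)\<^sup>2) * ?F \<xi>) * cnj (\<Phi>2 \<xi>)))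
          - (LINT \<xi>|lborel. cis (- (y \<bullet> \<xi>)) * (?F \<xi> * cnj (\<Phi>1 \<xi>)))"
        by (simp only: Bochner_Integration.integral_diff[OF ic[OF i1(2)] ic[OF i1(1)]])
      moreover have "cis (- (y \<bullet> \<xi>)) * ((of_real ((norm \<xi>)\<^sup>2) * ?F \<xi>) * cnj (\<Phi>2 \<xi>)) = of_real ((norm \<xi>)\<^sup>2) * fourier_integral (?b y) \<xi> * cnj (\<Phi>2 \<xi>)"
        "cis (- (y \<bullet> \<xi>)) * (?F \<xi> * cnj (\<Phi>1 \<xi>)) = fourier_integral (?b y) \<xi> * cnj (\<Phi>1 \<xi>)" for \<xi>
        unfolding tr[of \<xi>] by (simp_all only: mult_ac)
      ultimately show ?thesis using e by (simp only: diff_self)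
    qed
    from fourier_L1_injective[OF v_int this] show ?thesis by (simp add: v_def)
  qed
  \<comment> \<open>All widths are treated off one common null set; at each remaining frequency a
    width with nonvanishing transform is selected.\<close>
  then have "AE \<xi> in lborel. \<forall>n. fourier_integral (bump_vec (real (Suc n)) 0) \<xi> * cnj (of_real ((norm \<xi>)\<^sup>2) * \<Phi>2 \<xi> - \<Phi>1 \<xi>) = 0"
    by (intro AE_all_countable[THEN iffD2] allI)
  then show ?thesis
  proof eventually_elim
    case (elim \<xi>)
    obtain n where "fourier_integral (bump_vec (real (Suc n)) 0) \<xi> \<noteq> 0" using bump_vec_fourier_nonzero by blast
    with elim[rule_format, of n] have "cnj (of_real ((norm \<xi>)\<^sup>2) * \<Phi>2 \<xi> - \<Phi>1 \<xi>) = 0" by simp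
    then show ?case by (simp only: complex_cnj_zero_iff right_minus_eq)
  qed
qed

text \<open>The pairing in the first variable alone; it leaves a function of the second variable, to
  which the Fourier argument for the Laplacian applies.\<close>

definition contraction :: "('a \<Rightarrow> complex) \<Rightarrow> ('a::euclidean_space \<times> 'b \<Rightarrow> complex) \<Rightarrow> 'b::euclidean_space \<Rightarrow> complex" where
  "contraction p f y = L2_inner lborel (\<lambda>x. f (x, y)) p"

section \<open>Tensor products and partial pairings\<close>

lemma L2_tensor:
  fixes p :: "'a::euclidean_space \<Rightarrow> complex" and q :: "'b::euclidean_space \<Rightarrow> complex"
  assumes p: "p \<in> L2 lborel" and q: "q \<in> L2 lborel"
  shows "(\<lambda>z. p (fst z) * q (snd z)) \<in> L2 lborel"
proof -
  have [measurable]: "p \<in> borel_measurable borel" "q \<in> borel_measurable borel"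
    using L2_measurable[OF p] L2_measurable[OF q] by auto
  have m: "(\<lambda>z. p (fst z) * q (snd z)) \<in> borel_measurable (lborel \<Otimes>\<^sub>M lborel)" by measurable
  have "integrable (lborel \<Otimes>\<^sub>M lborel) (\<lambda>z. complex_of_real ((norm (p (fst z)))\<^sup>2) * complex_of_real ((norm (q (snd z)))\<^sup>2))"
    by (intro lborel_pair.integrable_tensor integrable_of_real L2_integrable p q)
  from integrable_Re[OF this] have "integrable (lborel \<Otimes>\<^sub>M lborel) (\<lambda>z. (norm (p (fst z) * q (snd z)))\<^sup>2)"
    by (simp add: norm_mult power_mult_distrib)
  with m show ?thesis unfolding L2_def lborel_prod by simp
qed

lemma tensor_inner:
  fixes f :: "'a::euclidean_space \<times> 'b::euclidean_space \<Rightarrow> complex"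
  assumes f: "f \<in> L2 lborel" and p: "p \<in> L2 lborel" and q: "q \<in> L2 lborel"
  shows "L2_inner lborel f (\<lambda>z. p (fst z) * q (snd z)) = L2_inner lborel (contraction p f) q"
    and "L2_inner lborel f (\<lambda>z. p (fst z) * q (snd z)) = (LINT x|lborel. L2_inner lborel (\<lambda>y. f (x, y)) q * cnj (p x))"
proof -
  have int: "integrable lborel (\<lambda>z. f z * cnj (p (fst z) * q (snd z)))"
    by (rule L2_inner_integrable[OF f L2_tensor[OF p q]])
  then have int': "integrable (lborel \<Otimes>\<^sub>M lborel) (case_prod (\<lambda>x y. f (x, y) * cnj (p x * q y)))"
    unfolding lborel_prod by (simp add: case_prod_beta')
  have "L2_inner lborel f (\<lambda>z. p (fst z) * q (snd z)) = integral\<^sup>L (lborel \<Otimes>\<^sub>M lborel) (case_prod (\<lambda>x y. f (x, y) * cnj (p x * q y)))"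
    unfolding lborel_prod by (simp add: L2_inner_def case_prod_beta')
  also have "\<dots> = (LINT y|lborel. LINT x|lborel. f (x, y) * cnj (p x * q y))"
    by (rule lborel_pair.integral_snd[OF int', symmetric])
  also have "\<dots> = L2_inner lborel (contraction p f) q"
  proof -
    have "(LINT x|lborel. f (x, y) * cnj (p x * q y)) = contraction p f y * cnj (q y)" for y
    proof -
      have "f (x, y) * cnj (p x * q y) = (f (x, y) * cnj (p x)) * cnj (q y)" for x by simp
      then show ?thesis by (simp only: integral_mult_left_zero contraction_def L2_inner_def)
    qed
    then show ?thesis by (simp only: L2_inner_def)
  qed
  finally show 1: "L2_inner lborel f (\<lambda>z. p (fst z) * q (snd z)) = L2_inner lborel (contraction p f) q" .
  have "L2_inner lborel f (\<lambda>z. p (fst z) * q (snd z)) = integral\<^sup>L (lborel \<Otimes>\<^sub>M lborel) (case_prod (\<lambda>x y. f (x, y) * cnj (p x * q y)))"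
    unfolding lborel_prod by (simp add: L2_inner_def case_prod_beta')
  also have "\<dots> = (LINT x|lborel. LINT y|lborel. f (x, y) * cnj (p x * q y))"
    using lborel_pair.integral_fst[OF int'] by simp
  also have "\<dots> = (LINT x|lborel. L2_inner lborel (\<lambda>y. f (x, y)) q * cnj (p x))"
  proof -
    have "(LINT y|lborel. f (x, y) * cnj (p x * q y)) = L2_inner lborel (\<lambda>y. f (x, y)) q * cnj (p x)" for x
    proof -
      have "f (x, y) * cnj (p x * q y) = (f (x, y) * cnj (q y)) * cnj (p x)" for y by simp
      then show ?thesis by (simp only: integral_mult_left_zero L2_inner_def)
    qed
    then show ?thesis by (simp only:)
  qed
  finally show "L2_inner lborel f (\<lambda>z. p (fst z) * q (snd z)) = (LINT x|lborel. L2_inner lborel (\<lambda>y. f (x, y)) q * cnj (p x))" .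
qed

lemma contraction_L2:
  fixes f :: "'a::euclidean_space \<times> 'b::euclidean_space \<Rightarrow> complex"
  assumes f: "f \<in> L2 lborel" and p: "p \<in> L2 lborel"
  shows "contraction p f \<in> L2 lborel"
proof -
  have [measurable]: "f \<in> borel_measurable (lborel \<Otimes>\<^sub>M lborel)"
    using L2_measurable[OF f] unfolding lborel_prod .
  have [measurable]: "p \<in> borel_measurable borel" using L2_measurable[OF p] by simp
  have m [measurable]: "contraction p f \<in> borel_measurable lborel"
    unfolding contraction_def[abs_def] L2_inner_def by measurable
  note sw = L2_lborel_swap(1)[OF f]
  have int: "integrable lborel (\<lambda>y. L2_sq lborel (\<lambda>x. f (x, y)) * L2_sq lborel p)"
    using L2_lborel_fibres(2)[OF sw] by simp
  have "integrable lborel (\<lambda>y. (norm (contraction p f y))\<^sup>2)"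
    using int
  proof (rule Bochner_Integration.integrable_bound)
    show "AE y in lborel. norm ((norm (contraction p f y))\<^sup>2) \<le> norm (L2_sq lborel (\<lambda>x. f (x, y)) * L2_sq lborel p)"
      using L2_lborel_fibres(1)[OF sw] by eventually_elim (simp add: contraction_def L2_inner_Cauchy_Schwarz p)
  qed simp
  with m show ?thesis by (simp add: L2_def)
qed

text \<open>Pairing in x' commutes with the transform in x''. Both are compared by Hermite
  coefficients, which \<open>tensor_inner\<close> rewrites by integrating in the other order, so
  that the coefficients of the slices appear.\<close>

lemma contraction_fourier:
  fixes f :: "'a::euclidean_space \<times> (real^'n::finite) \<Rightarrow> complex"
  assumes f: "f \<in> L2 lborel" and p: "p \<in> L2 lborel"
  shows "is_fourier_L2 (contraction p f) (contraction p (partial_fourier f))"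
  unfolding is_fourier_L2_iff
proof (intro conjI contraction_L2 partial_fourier_L2 f p allI)
  fix k :: "nat^'n"
  have [measurable]: "g \<in> borel_measurable (lborel \<Otimes>\<^sub>M lborel)" if "g \<in> L2 lborel" for g :: "'a \<times> (real^'n) \<Rightarrow> complex"
    using L2_measurable[OF that] unfolding lborel_prod .
  note [measurable] = this[OF f] this[OF partial_fourier_L2[OF f]]
  have [measurable]: "p \<in> borel_measurable borel" using L2_measurable[OF p] by simp
  have "L2_inner lborel (contraction p (partial_fourier f)) (herm k) = (LINT x|lborel. L2_inner lborel (\<lambda>y. partial_fourier f (x, y)) (herm k) * cnj (p x))"
    using tensor_inner[OF partial_fourier_L2[OF f] p hermite_multi_L2[of k]] by simp
  also have "\<dots> = (LINT x|lborel. degree_phase k * (L2_inner lborel (\<lambda>y. f (x, y)) (herm k) * cnj (p x)))"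
  proof (rule integral_cong_AE)
    show "(\<lambda>x. L2_inner lborel (\<lambda>y. partial_fourier f (x, y)) (herm k) * cnj (p x)) \<in> borel_measurable lborel"
      "(\<lambda>x. degree_phase k * (L2_inner lborel (\<lambda>y. f (x, y)) (herm k) * cnj (p x))) \<in> borel_measurable lborel"
      unfolding L2_inner_def by measurable
    show "AE x in lborel. L2_inner lborel (\<lambda>y. partial_fourier f (x, y)) (herm k) * cnj (p x)
        = degree_phase k * (L2_inner lborel (\<lambda>y. f (x, y)) (herm k) * cnj (p x))"
      using partial_fourier_fibre[OF f] by eventually_elim (simp add: is_fourier_L2_iff)
  qed
  also have "\<dots> = degree_phase k * L2_inner lborel (contraction p f) (herm k)"
    using tensor_inner[OF f p hermite_multi_L2[of k]] by simp
  finally show "L2_inner lborel (contraction p (partial_fourier f)) (herm k) = degree_phase k * L2_inner lborel (contraction p f) (herm k)" .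
qed

text \<open>For smooth functions the directional derivative, defined by the total derivative, can be
  computed along a line, one variable at a time.\<close>

lemma dir_deriv_line_unique:
  assumes "smooth \<phi>" "((\<lambda>t. \<phi> (x + t *\<^sub>R v)) has_vector_derivative D) (at 0)"
  shows "dir_deriv v \<phi> x = D"
  using vector_derivative_unique_at[OF smooth_line_derivative[OF assms(1)] assms(2)] .

lemma tensor_test_function:
  fixes a :: "'a::euclidean_space \<Rightarrow> complex" and b :: "'b::euclidean_space \<Rightarrow> complex"
  assumes a: "a \<in> test_functions" and b: "b \<in> test_functions"
  shows "(\<lambda>z. a (fst z) * b (snd z)) \<in> test_functions"
  unfolding test_functions_iff
proof
  have sa: "smooth a" and sb: "smooth b" using a b by (auto simp: test_functions_iff)
  have "smooth (\<lambda>z::'a \<times> 'b. a (fst z + 0))" "smooth (\<lambda>z::'a \<times> 'b. b (snd z + 0))"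
    by (rule smooth_compose_affine[OF bounded_linear_fst sa], rule smooth_compose_affine[OF bounded_linear_snd sb])
  then show "smooth (\<lambda>z::'a \<times> 'b. a (fst z) * b (snd z))" by (simp add: smooth_mult)
  obtain R1 R2 where R: "\<forall>x. x \<notin> cball 0 R1 \<longrightarrow> a x = 0" "\<forall>x. x \<notin> cball 0 R2 \<longrightarrow> b x = 0"
    using a b by (auto simp: test_functions_iff)
  have "a (fst z) * b (snd z) = 0" if "z \<notin> cball 0 (R1 + R2)" for z
  proof (rule ccontr)
    assume "a (fst z) * b (snd z) \<noteq> 0"
    then have "norm (fst z) \<le> R1" "norm (snd z) \<le> R2" using R by auto
    then have "norm z \<le> R1 + R2" using norm_Pair_le[of "fst z" "snd z"] by simp
    then show False using that by simp
  qed
  then show "\<exists>R. \<forall>z. z \<notin> cball 0 R \<longrightarrow> a (fst z) * b (snd z) = 0" by blast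
qed

lemma dir_deriv_tensor:
  fixes a :: "'a::euclidean_space \<Rightarrow> complex" and b :: "'b::euclidean_space \<Rightarrow> complex"
  assumes a: "a \<in> test_functions" and b: "b \<in> test_functions"
  shows "dir_deriv (v, 0) (\<lambda>z. a (fst z) * b (snd z)) = (\<lambda>z. dir_deriv v a (fst z) * b (snd z))"
    and "dir_deriv (0, w) (\<lambda>z. a (fst z) * b (snd z)) = (\<lambda>z. a (fst z) * dir_deriv w b (snd z))"
proof -
  have sa: "smooth a" and sb: "smooth b" and s: "smooth (\<lambda>z. a (fst z) * b (snd z))"
    using a b tensor_test_function[OF a b] by (auto simp: test_functions_iff)
  show "dir_deriv (v, 0) (\<lambda>z. a (fst z) * b (snd z)) = (\<lambda>z. dir_deriv v a (fst z) * b (snd z))"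
  proof (rule ext, rule dir_deriv_line_unique[OF s])
    fix z :: "'a \<times> 'b"
    show "((\<lambda>t. a (fst (z + t *\<^sub>R (v, 0))) * b (snd (z + t *\<^sub>R (v, 0)))) has_vector_derivative dir_deriv v a (fst z) * b (snd z)) (at 0)"
      using has_vector_derivative_mult_left[OF smooth_line_derivative[OF sa, of "fst z" v], of "b (snd z)"] by simp
  qed
  show "dir_deriv (0, w) (\<lambda>z. a (fst z) * b (snd z)) = (\<lambda>z. a (fst z) * dir_deriv w b (snd z))"
  proof (rule ext, rule dir_deriv_line_unique[OF s])
    fix z :: "'a \<times> 'b"
    show "((\<lambda>t. a (fst (z + t *\<^sub>R (0, w))) * b (snd (z + t *\<^sub>R (0, w)))) has_vector_derivative a (fst z) * dir_deriv w b (snd z)) (at 0)"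
      using has_vector_derivative_mult_right[OF smooth_line_derivative[OF sb, of "snd z" w], of "a (fst z)"] by simp
  qed
qed

lemma grushin_tensor:
  fixes a :: "real^'m::finite \<Rightarrow> complex" and b :: "real^'n::finite \<Rightarrow> complex"
  assumes a: "a \<in> test_functions" and b: "b \<in> test_functions"
  shows "grushin (\<lambda>z. a (fst z) * b (snd z)) z
    = - (laplacian a (fst z) * b (snd z)) - (of_real ((norm (fst z))\<^sup>2) * a (fst z)) * laplacian b (snd z)"
  unfolding grushin_eq dir_deriv_tensor[OF a b] dir_deriv_tensor[OF test_functions_dir_deriv[OF a] b]
    dir_deriv_tensor[OF a test_functions_dir_deriv[OF b]] laplacian_def
  by (simp only: sum_distrib_right[symmetric] sum_distrib_left[symmetric] mult.assoc)

text \<open>With a fixed and b arbitrary, testing with a(x') b(x'') is a weak Laplace equation in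
  x'' for contractions of f and h, whose transforms can be compared pointwise. The exceptional set
  of frequencies depends on a.\<close>

lemma weak_grushin_contraction:
  fixes f h :: "(real^'m::finite) \<times> (real^'n::finite) \<Rightarrow> complex"
  assumes f: "f \<in> L2 lborel" and weak: "is_weak_grushin f h" and a: "a \<in> test_functions"
  shows "AE \<xi> in lborel. of_real ((norm \<xi>)\<^sup>2) * contraction (\<lambda>x. of_real ((norm x)\<^sup>2) * a x) (partial_fourier f) \<xi>
    = contraction a (partial_fourier h) \<xi> + contraction (laplacian a) (partial_fourier f) \<xi>"
proof -
  have h: "h \<in> L2 lborel" using weak by (simp add: is_weak_grushin_def)
  let ?p = "\<lambda>x. of_real ((norm x)\<^sup>2) * a x"
  note at = test_function_facts[OF a] and la = laplacian_test_function[OF a]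
  obtain R where "\<forall>x. x \<notin> cball 0 R \<longrightarrow> a x = 0" using a by (auto simp: test_functions_iff)
  then have p: "?p \<in> L2 lborel"
    by (intro compact_support_integrable(2)[of _ R]) (auto intro!: continuous_intros at)
  have inner: "L2_inner lborel (\<lambda>z. u (fst z) * v (snd z)) g = L2_inner lborel v (contraction u g)"
    if "g \<in> L2 lborel" "u \<in> L2 lborel" "v \<in> L2 lborel"
    for g :: "(real^'m) \<times> (real^'n) \<Rightarrow> complex" and u v
    using tensor_inner(1)[OF that] L2_inner_cnj by metis
  \<comment> \<open>The factor 1 gives the sum the shape g + c g' in which linearity of the
    transform is stated.\<close>
  let ?F1 = "\<lambda>y. contraction a h y + 1 * contraction (laplacian a) f y"
  have F1: "is_fourier_L2 ?F1 (\<lambda>\<xi>. contraction a (partial_fourier h) \<xi> + 1 * contraction (laplacian a) (partial_fourier f) \<xi>)"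
    by (intro is_fourier_L2_add_cmult contraction_fourier f h at la)
  have "AE \<xi> in lborel. of_real ((norm \<xi>)\<^sup>2) * contraction ?p (partial_fourier f) \<xi>
    = contraction a (partial_fourier h) \<xi> + 1 * contraction (laplacian a) (partial_fourier f) \<xi>"
  proof (rule weak_laplacian_fourier[OF _ F1 contraction_fourier[OF f p]])
    fix b :: "real^'n \<Rightarrow> complex" assume b: "b \<in> test_functions"
    note bt = test_function_facts[OF b] and lb = laplacian_test_function[OF b]
    let ?\<phi> = "\<lambda>z. a (fst z) * b (snd z)"
    have t1: "(\<lambda>z. laplacian a (fst z) * b (snd z)) \<in> L2 lborel" "(\<lambda>z. ?p (fst z) * laplacian b (snd z)) \<in> L2 lborel"
      by (rule L2_tensor[OF la(2) bt(2)], rule L2_tensor[OF p lb(2)])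
    have "L2_inner lborel b (contraction a h) = L2_inner lborel ?\<phi> h"
      by (rule inner[OF h at(2) bt(2), symmetric])
    also have "\<dots> = L2_inner lborel (grushin ?\<phi>) f"
      using weak tensor_test_function[OF a b] by (simp add: is_weak_grushin_def)
    also have "grushin ?\<phi> = (\<lambda>z. (-1) * (laplacian a (fst z) * b (snd z)) - ?p (fst z) * laplacian b (snd z))"
      by (simp add: fun_eq_iff grushin_tensor[OF a b])
    also have "L2_inner lborel \<dots> f = - L2_inner lborel b (contraction (laplacian a) f) - L2_inner lborel (laplacian b) (contraction ?p f)"
      using inner[OF f la(2) bt(2)] inner[OF f p lb(2)]
      by (subst L2_inner_diff_left[OF L2_cmult[OF t1(1)] t1(2) f], subst L2_inner_cmult_left) simp
    finally have e: "L2_inner lborel b (contraction a h) = - L2_inner lborel b (contraction (laplacian a) f) - L2_inner lborel (laplacian b) (contraction ?p f)" .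
    have "L2_inner lborel (\<lambda>x. - laplacian b x) (contraction ?p f) = - L2_inner lborel (laplacian b) (contraction ?p f)"
      by (simp add: L2_inner_def)
    also have "\<dots> = L2_inner lborel b (contraction a h) + L2_inner lborel b (contraction (laplacian a) f)"
      using e by simp
    also have "\<dots> = cnj (L2_inner lborel ?F1 b)"
      by (subst L2_inner_add_left) (auto intro!: contraction_L2 L2_cmult f h at la bt simp: L2_inner_cnj)
    also have "\<dots> = L2_inner lborel b ?F1" by (rule L2_inner_cnj)
    finally show "L2_inner lborel (\<lambda>x. - laplacian b x) (contraction ?p f) = L2_inner lborel b ?F1" .
  qed
  then show ?thesis by simp
qed

section \<open>Truncated Hermite functions: derivatives, domination and limits\<close>

definition bump_d1 :: "real \<Rightarrow> real" where "bump_d1 = deriv bump"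
definition bump_d2 :: "real \<Rightarrow> real" where "bump_d2 = deriv bump_d1"

lemma bump_has_derivative: "(bump has_real_derivative bump_d1 u) (at u)"
  and bump_d1_has_derivative: "(bump_d1 has_real_derivative bump_d2 u) (at u)"
  and bump_d2_continuous: "continuous_on UNIV bump_d2"
  and bump_bounds: "\<exists>C. \<forall>u. \<bar>bump u\<bar> \<le> C \<and> \<bar>bump_d1 u\<bar> \<le> C \<and> \<bar>bump_d2 u\<bar> \<le> C"
proof -
  obtain b1 b2 C where b: "\<And>u. (bump has_real_derivative b1 u) (at u)" "\<And>u. (b1 has_real_derivative b2 u) (at u)"
    "\<And>u. \<bar>bump u\<bar> \<le> C" "\<And>u. \<bar>b1 u\<bar> \<le> C" "\<And>u. \<bar>b2 u\<bar> \<le> C" "continuous_on UNIV b2"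
    using bump_derivatives by metis
  have 1: "bump_d1 = b1" unfolding bump_d1_def using b(1) DERIV_imp_deriv by blast
  have 2: "bump_d2 = b2" unfolding bump_d2_def 1 using b(2) DERIV_imp_deriv by blast
  show "(bump has_real_derivative bump_d1 u) (at u)" "(bump_d1 has_real_derivative bump_d2 u) (at u)"
    "continuous_on UNIV bump_d2"
    unfolding 1 2 using b(1,2,6) by auto
  show "\<exists>C. \<forall>u. \<bar>bump u\<bar> \<le> C \<and> \<bar>bump_d1 u\<bar> \<le> C \<and> \<bar>bump_d2 u\<bar> \<le> C"
    unfolding 1 2 using b(3,4,5) by (intro exI[of _ C]) auto
qed

text \<open>Hermite functions of scale \<open>\<sigma>\<close>, truncated to \<open>\<bar>u\<bar> \<le> 1 / N\<close>; the truncation is removed by \<open>N \<longrightarrow> 0\<close>.\<close>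

definition cutoff_mode :: "nat \<Rightarrow> real \<Rightarrow> real \<Rightarrow> real \<Rightarrow> real" where
  "cutoff_mode n \<sigma> N u = bump (N * u) * hermite_fun n (\<sigma> * u)"

definition cutoff_mode_d1 :: "nat \<Rightarrow> real \<Rightarrow> real \<Rightarrow> real \<Rightarrow> real" where
  "cutoff_mode_d1 n \<sigma> N u = N * (bump_d1 (N * u) * hermite_fun n (\<sigma> * u)) + \<sigma> * (bump (N * u) * hermite_fun_deriv n (\<sigma> * u))"

text \<open>Every term in which the bump is differentiated carries a factor N, so only the
  oscillator term survives as N goes to 0.\<close>

definition cutoff_mode_d2 :: "nat \<Rightarrow> real \<Rightarrow> real \<Rightarrow> real \<Rightarrow> real" where
  "cutoff_mode_d2 n \<sigma> N u = N\<^sup>2 * (bump_d2 (N * u) * hermite_fun n (\<sigma> * u))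
     + 2 * N * \<sigma> * (bump_d1 (N * u) * hermite_fun_deriv n (\<sigma> * u))
     + \<sigma>\<^sup>2 * (bump (N * u) * (((\<sigma> * u)\<^sup>2 - (2 * real n + 1)) * hermite_fun n (\<sigma> * u)))"

lemma DERIV_scaled:
  assumes "\<And>u. (g has_real_derivative g' u) (at u)"
  shows "((\<lambda>u. g (c * u)) has_real_derivative c * g' (c * u)) (at u)"
proof -
  have "((\<lambda>u. c * u) has_real_derivative c) (at u)" by (auto intro!: derivative_eq_intros)
  from DERIV_chain2[OF assms this] show ?thesis by (simp add: mult.commute)
qed

lemma cutoff_mode_has_derivative: "(cutoff_mode n \<sigma> N has_real_derivative cutoff_mode_d1 n \<sigma> N u) (at u)"
proof -
  have "(cutoff_mode n \<sigma> N has_real_derivative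
      (N * bump_d1 (N * u)) * hermite_fun n (\<sigma> * u) + (\<sigma> * hermite_fun_deriv n (\<sigma> * u)) * bump (N * u)) (at u)"
    unfolding cutoff_mode_def[abs_def]
    by (intro DERIV_mult DERIV_scaled bump_has_derivative hermite_fun_has_derivative)
  then show ?thesis by (simp add: cutoff_mode_d1_def mult_ac)
qed

lemma cutoff_mode_d1_has_derivative: "(cutoff_mode_d1 n \<sigma> N has_real_derivative cutoff_mode_d2 n \<sigma> N u) (at u)"
proof -
  have "(cutoff_mode_d1 n \<sigma> N has_real_derivative
      N * ((N * bump_d2 (N * u)) * hermite_fun n (\<sigma> * u) + (\<sigma> * hermite_fun_deriv n (\<sigma> * u)) * bump_d1 (N * u))
      + \<sigma> * ((N * bump_d1 (N * u)) * hermite_fun_deriv n (\<sigma> * u)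
        + (\<sigma> * (((\<sigma> * u)\<^sup>2 - (2 * real n + 1)) * hermite_fun n (\<sigma> * u))) * bump (N * u))) (at u)"
    unfolding cutoff_mode_d1_def[abs_def]
    by (intro DERIV_add DERIV_cmult DERIV_mult DERIV_scaled bump_has_derivative bump_d1_has_derivative
        hermite_fun_has_derivative hermite_fun_deriv_has_derivative)
  moreover have "N * ((N * bump_d2 (N * u)) * hermite_fun n (\<sigma> * u) + (\<sigma> * hermite_fun_deriv n (\<sigma> * u)) * bump_d1 (N * u))
      + \<sigma> * ((N * bump_d1 (N * u)) * hermite_fun_deriv n (\<sigma> * u)
        + (\<sigma> * H) * bump (N * u)) = N\<^sup>2 * (bump_d2 (N * u) * hermite_fun n (\<sigma> * u))
     + 2 * N * \<sigma> * (bump_d1 (N * u) * hermite_fun_deriv n (\<sigma> * u)) + \<sigma>\<^sup>2 * (bump (N * u) * H)" for H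
    by (simp add: power2_eq_square algebra_simps)
  ultimately show ?thesis by (simp only: cutoff_mode_d2_def)
qed

text \<open>One Gaussian for all cutoffs N \<le> 1 and all scales between s/2 and 2s, since
  dominated convergence is applied while both vary. The exponent s^2/16 is (s/2)^2/4, the decay at
  the smallest scale.\<close>

lemma cutoff_mode_bounds:
  assumes s: "0 < s"
  shows "\<exists>C\<ge>0. \<forall>N \<sigma> u. 0 < N \<longrightarrow> N \<le> 1 \<longrightarrow> s / 2 \<le> \<sigma> \<longrightarrow> \<sigma> \<le> 2 * s \<longrightarrow>
    \<bar>cutoff_mode n \<sigma> N u\<bar> \<le> C * exp (- (s\<^sup>2 / 16) * u\<^sup>2) \<and> \<bar>cutoff_mode_d2 n \<sigma> N u\<bar> \<le> C * exp (- (s\<^sup>2 / 16) * u\<^sup>2)"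
proof -
  obtain B where B: "\<And>u. \<bar>bump u\<bar> \<le> B" "\<And>u. \<bar>bump_d1 u\<bar> \<le> B" "\<And>u. \<bar>bump_d2 u\<bar> \<le> B"
    using bump_bounds by blast
  have B0: "0 \<le> B" using B(1)[of 0] by linarith
  obtain D0 where D0: "D0 \<ge> 0" "\<forall>u. \<bar>u\<bar> ^ 0 * \<bar>hermite_fun n u\<bar> \<le> D0 * exp (- u\<^sup>2 / 4)" using hermite_fun_bound by blast
  obtain D1 where D1: "D1 \<ge> 0" "\<forall>u. \<bar>hermite_fun_deriv n u\<bar> \<le> D1 * exp (- u\<^sup>2 / 4)" using hermite_fun_deriv_bound by blast
  obtain D2 where D2: "D2 \<ge> 0" "\<forall>u. \<bar>u\<bar> ^ 2 * \<bar>hermite_fun n u\<bar> \<le> D2 * exp (- u\<^sup>2 / 4)" using hermite_fun_bound by blast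
  \<comment> \<open>M bounds the oscillator factor (v^2 - (2n+1)) h_n(v); C adds the bounds of the
    three terms of \<open>cutoff_mode_d2\<close>, using N \<le> 1 and \<sigma> \<le> 2s.\<close>
  define M where "M = D2 + (2 * real n + 1) * D0"
  define C where "C = B * D0 + 2 * (2 * s) * (B * D1) + (2 * s)\<^sup>2 * (B * M)"
  have M0: "0 \<le> M" using D0 D2 by (simp add: M_def)
  have terms: "0 \<le> B * D0" "0 \<le> 2 * (2 * s) * (B * D1)" "0 \<le> (2 * s)\<^sup>2 * (B * M)" using B0 D0 D1 M0 s by auto
  have "\<bar>cutoff_mode n \<sigma> N u\<bar> \<le> C * exp (- (s\<^sup>2 / 16) * u\<^sup>2) \<and> \<bar>cutoff_mode_d2 n \<sigma> N u\<bar> \<le> C * exp (- (s\<^sup>2 / 16) * u\<^sup>2)"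
    if N: "0 < N" "N \<le> 1" and \<sigma>: "s / 2 \<le> \<sigma>" "\<sigma> \<le> 2 * s" for N \<sigma> u
  proof -
    let ?E = "exp (- (s\<^sup>2 / 16) * u\<^sup>2)"
    have "(s / 2)\<^sup>2 \<le> \<sigma>\<^sup>2" using \<sigma> s by (intro power_mono) auto
    then have "s\<^sup>2 / 16 * u\<^sup>2 \<le> (\<sigma> * u)\<^sup>2 / 4"
      using mult_right_mono[of "(s / 2)\<^sup>2" "\<sigma>\<^sup>2" "u\<^sup>2"] by (simp add: power_mult_distrib power_divide)
    then have E: "exp (- (\<sigma> * u)\<^sup>2 / 4) \<le> ?E" by simp
    have H0: "\<bar>hermite_fun n (\<sigma> * u)\<bar> \<le> D0 * ?E"
      using D0(2)[rule_format, of "\<sigma> * u"] mult_left_mono[OF E D0(1)] by simp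
    have H1: "\<bar>hermite_fun_deriv n (\<sigma> * u)\<bar> \<le> D1 * ?E"
      using D1(2)[rule_format, of "\<sigma> * u"] mult_left_mono[OF E D1(1)] by linarith
    have "\<bar>((\<sigma> * u)\<^sup>2 - (2 * real n + 1)) * hermite_fun n (\<sigma> * u)\<bar>
        \<le> (\<sigma> * u)\<^sup>2 * \<bar>hermite_fun n (\<sigma> * u)\<bar> + (2 * real n + 1) * \<bar>hermite_fun n (\<sigma> * u)\<bar>"
    proof -
      have "\<bar>(\<sigma> * u)\<^sup>2 - (2 * real n + 1)\<bar> \<le> (\<sigma> * u)\<^sup>2 + (2 * real n + 1)"
        using zero_le_power2[of "\<sigma> * u"] by linarith
      from mult_right_mono[OF this abs_ge_zero[of "hermite_fun n (\<sigma> * u)"]] show ?thesis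
        by (simp add: abs_mult distrib_right)
    qed
    also have "\<dots> \<le> D2 * ?E + (2 * real n + 1) * (D0 * ?E)"
      using D2(2)[rule_format, of "\<sigma> * u"] mult_left_mono[OF E D2(1)] H0
      by (intro add_mono mult_left_mono) auto
    finally have H2: "\<bar>((\<sigma> * u)\<^sup>2 - (2 * real n + 1)) * hermite_fun n (\<sigma> * u)\<bar> \<le> M * ?E"
      by (simp add: M_def algebra_simps)
    have p: "\<bar>b * y\<bar> \<le> B * (d * ?E)" if "\<bar>b\<bar> \<le> B" "\<bar>y\<bar> \<le> d * ?E" for b y d
      unfolding abs_mult using that B0 by (intro mult_mono) auto
    have t0: "\<bar>bump (N * u) * hermite_fun n (\<sigma> * u)\<bar> \<le> B * (D0 * ?E)" by (rule p[OF B(1) H0])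
    have N2: "N\<^sup>2 \<le> 1" using N by (simp add: power_le_one)
    have "\<bar>N\<^sup>2 * (bump_d2 (N * u) * hermite_fun n (\<sigma> * u))\<bar> \<le> 1 * (B * (D0 * ?E))"
      unfolding abs_mult[of "N\<^sup>2"] using N2 by (intro mult_mono p[OF B(3) H0]) auto
    moreover have "\<bar>2 * N * \<sigma> * (bump_d1 (N * u) * hermite_fun_deriv n (\<sigma> * u))\<bar> \<le> 2 * (2 * s) * (B * (D1 * ?E))"
    proof -
      have "N * \<sigma> \<le> 1 * (2 * s)" using N \<sigma> s by (intro mult_mono) auto
      then have "\<bar>2 * N * \<sigma>\<bar> \<le> 2 * (2 * s)" using N \<sigma> s by (simp add: abs_mult)
      then show ?thesis
        unfolding abs_mult[of "2 * N * \<sigma>"] using s by (intro mult_mono p[OF B(2) H1]) auto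
    qed
    moreover have "\<bar>\<sigma>\<^sup>2 * (bump (N * u) * (((\<sigma> * u)\<^sup>2 - (2 * real n + 1)) * hermite_fun n (\<sigma> * u)))\<bar> \<le> (2 * s)\<^sup>2 * (B * (M * ?E))"
    proof -
      have "\<sigma>\<^sup>2 \<le> (2 * s)\<^sup>2" using \<sigma> s by (intro power_mono) auto
      then show ?thesis
        unfolding abs_mult[of "\<sigma>\<^sup>2"] by (intro mult_mono p[OF B(1) H2]) auto
    qed
    ultimately have "\<bar>cutoff_mode_d2 n \<sigma> N u\<bar> \<le> 1 * (B * (D0 * ?E)) + 2 * (2 * s) * (B * (D1 * ?E)) + (2 * s)\<^sup>2 * (B * (M * ?E))"
      unfolding cutoff_mode_d2_def by linarith
    then have 2: "\<bar>cutoff_mode_d2 n \<sigma> N u\<bar> \<le> C * ?E" by (simp add: C_def algebra_simps)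
    have "B * D0 * ?E \<le> C * ?E" using terms unfolding C_def by (intro mult_right_mono) auto
    then have "\<bar>cutoff_mode n \<sigma> N u\<bar> \<le> C * ?E"
      using order_trans[OF t0[folded mult.assoc]] by (simp only: cutoff_mode_def)
    with 2 show ?thesis by blast
  qed
  moreover have "0 \<le> C" using terms by (simp add: C_def)
  ultimately show ?thesis by blast
qed

lemma cutoff_mode_limits:
  assumes "N \<longlonglongrightarrow> 0" "\<sigma> \<longlonglongrightarrow> s"
  shows "(\<lambda>j. cutoff_mode n (\<sigma> j) (N j) u) \<longlonglongrightarrow> hermite_fun n (s * u)"
    and "(\<lambda>j. cutoff_mode_d2 n (\<sigma> j) (N j) u) \<longlonglongrightarrow> s\<^sup>2 * (((s * u)\<^sup>2 - (2 * real n + 1)) * hermite_fun n (s * u))"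
proof -
  have c: "continuous_on UNIV bump" "continuous_on UNIV bump_d1" "continuous_on UNIV bump_d2"
    "continuous_on UNIV (hermite_fun n)" "continuous_on UNIV (hermite_fun_deriv n)"
    using bump_has_derivative bump_d1_has_derivative bump_d2_continuous
      hermite_fun_continuous[OF continuous_on_id] hermite_fun_deriv_continuous[OF continuous_on_id]
    by (auto intro!: continuous_at_imp_continuous_on intro: DERIV_isCont)
  have t: "(\<lambda>j. g (a j * u)) \<longlonglongrightarrow> g (l * u)" if "continuous_on UNIV g" "a \<longlonglongrightarrow> l" for g :: "real \<Rightarrow> real" and a l
    using that by (intro continuous_on_tendsto_compose[OF that(1)] tendsto_mult tendsto_const) auto
  have "(\<lambda>j. cutoff_mode n (\<sigma> j) (N j) u) \<longlonglongrightarrow> bump (0 * u) * hermite_fun n (s * u)"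
    unfolding cutoff_mode_def by (intro tendsto_mult t c assms)
  then show "(\<lambda>j. cutoff_mode n (\<sigma> j) (N j) u) \<longlonglongrightarrow> hermite_fun n (s * u)" by simp
  have "(\<lambda>j. cutoff_mode_d2 n (\<sigma> j) (N j) u) \<longlonglongrightarrow> 0\<^sup>2 * (bump_d2 (0 * u) * hermite_fun n (s * u))
     + 2 * 0 * s * (bump_d1 (0 * u) * hermite_fun_deriv n (s * u))
     + s\<^sup>2 * (bump (0 * u) * (((s * u)\<^sup>2 - (2 * real n + 1)) * hermite_fun n (s * u)))"
    unfolding cutoff_mode_d2_def by (intro tendsto_intros t c assms)
  then show "(\<lambda>j. cutoff_mode_d2 n (\<sigma> j) (N j) u) \<longlonglongrightarrow> s\<^sup>2 * (((s * u)\<^sup>2 - (2 * real n + 1)) * hermite_fun n (s * u))" by simp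
qed

definition cutoff_vec :: "nat^'m::finite \<Rightarrow> real \<Rightarrow> real \<Rightarrow> real^'m \<Rightarrow> complex" where
  "cutoff_vec k \<sigma> N x = (\<Prod>l\<in>UNIV. of_real (cutoff_mode (k $ l) \<sigma> N (x $ l)))"

lemma cutoff_vec_test_function: "0 < N \<Longrightarrow> cutoff_vec k \<sigma> N \<in> test_functions"
proof -
  assume N: "0 < N"
  have "smooth (\<lambda>u. complex_of_real (hermite_fun (k $ l) (\<sigma> * u + 0)))" for l
    by (rule smooth_compose_affine[OF bounded_linear_const_mult[OF bounded_linear_ident] smooth_hermite_fun])
  then have "(\<lambda>x. \<Prod>l\<in>UNIV. of_real (bump (N * (x $ l - 0 $ l))) * of_real (hermite_fun (k $ l) (\<sigma> * x $ l))) \<in> test_functions"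
    using N by (intro bump_prod_test_function) auto
  then show ?thesis by (simp add: cutoff_vec_def[abs_def] cutoff_mode_def)
qed

lemma laplacian_cutoff_vec:
  assumes "0 < N"
  shows "laplacian (cutoff_vec k \<sigma> N) x = (\<Sum>i\<in>UNIV. of_real (cutoff_mode_d2 (k $ i) \<sigma> N (x $ i)) *
    (\<Prod>l\<in>UNIV - {i}. of_real (cutoff_mode (k $ l) \<sigma> N (x $ l))))"
  unfolding laplacian_def
proof (rule sum.cong[OF refl])
  fix i :: 'a
  let ?A = "\<lambda>l u. complex_of_real (cutoff_mode (k $ l) \<sigma> N u)"
  let ?A1 = "\<lambda>u. complex_of_real (cutoff_mode_d1 (k $ i) \<sigma> N u)"
  let ?B = "\<lambda>l. if l = i then ?A1 else ?A l"
  have s: "smooth (cutoff_vec k \<sigma> N)"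
    using cutoff_vec_test_function[OF assms] by (auto simp: test_functions_iff)
  have dA: "(?A i has_vector_derivative ?A1 u) (at u)" "(?A1 has_vector_derivative of_real (cutoff_mode_d2 (k $ i) \<sigma> N u)) (at u)" for u
    by (rule has_vector_derivative_of_real[OF cutoff_mode_has_derivative],
        rule has_vector_derivative_of_real[OF cutoff_mode_d1_has_derivative])
  have B: "(\<Prod>l\<in>UNIV. ?B l (x $ l)) = ?A1 (x $ i) * (\<Prod>l\<in>UNIV - {i}. ?A l (x $ l))" for x :: "real^'a"
    by (subst prod.remove[of UNIV i]) (auto intro!: prod.cong)
  have B': "(\<Prod>l\<in>UNIV - {i}. ?B l (x $ l)) = (\<Prod>l\<in>UNIV - {i}. ?A l (x $ l))" for x :: "real^'a"
    by (auto intro!: prod.cong)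
  have D: "dir_deriv (axis i 1) (cutoff_vec k \<sigma> N) = (\<lambda>x. \<Prod>l\<in>UNIV. ?B l (x $ l))"
  proof (rule ext, rule dir_deriv_line_unique[OF s])
    fix x
    show "((\<lambda>t. cutoff_vec k \<sigma> N (x + t *\<^sub>R axis i 1)) has_vector_derivative (\<Prod>l\<in>UNIV. ?B l (x $ l))) (at 0)"
      unfolding cutoff_vec_def B by (rule prod_line_derivative[where A="?A" and i=i]) (rule dA(1))
  qed
  show "dir_deriv (axis i 1) (dir_deriv (axis i 1) (cutoff_vec k \<sigma> N)) x
    = of_real (cutoff_mode_d2 (k $ i) \<sigma> N (x $ i)) * (\<Prod>l\<in>UNIV - {i}. ?A l (x $ l))"
  proof (rule dir_deriv_line_unique[OF smooth_dir_deriv[OF s]])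
    have "((\<lambda>t. \<Prod>l\<in>UNIV. ?B l ((x + t *\<^sub>R axis i 1) $ l)) has_vector_derivative
        of_real (cutoff_mode_d2 (k $ i) \<sigma> N (x $ i)) * (\<Prod>l\<in>UNIV - {i}. ?B l (x $ l))) (at 0)"
      by (rule prod_line_derivative) (simp add: dA(2))
    then show "((\<lambda>t. dir_deriv (axis i 1) (cutoff_vec k \<sigma> N) (x + t *\<^sub>R axis i 1)) has_vector_derivative
      of_real (cutoff_mode_d2 (k $ i) \<sigma> N (x $ i)) * (\<Prod>l\<in>UNIV - {i}. ?A l (x $ l))) (at 0)"
      unfolding D B' .
  qed
qed

lemma gaussian_dominated_limit:
  fixes w :: "real^'m::finite \<Rightarrow> complex"
  assumes w: "w \<in> L2 lborel" and g: "\<And>j. g j \<in> borel_measurable borel"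
    and b: "\<And>j x. norm (g j x) \<le> C * exp (- c * (norm x)\<^sup>2)" and c: "0 < c"
    and lim: "\<And>x. (\<lambda>j. g j x) \<longlonglongrightarrow> g' x"
  shows "(\<lambda>j. L2_inner lborel w (g j)) \<longlonglongrightarrow> L2_inner lborel w g'"
  unfolding L2_inner_def
proof (rule integral_dominated_convergence[where w="\<lambda>x. norm (C * (w x * complex_of_real (exp (- c * (norm x)\<^sup>2))))"])
  note [measurable] = g
  have [measurable]: "w \<in> borel_measurable borel" using L2_measurable[OF w] by simp
  have [measurable]: "g' \<in> borel_measurable borel" by (rule borel_measurable_LIMSEQ_metric[OF g lim])
  show "(\<lambda>x. w x * cnj (g' x)) \<in> borel_measurable lborel" "(\<lambda>x. w x * cnj (g j x)) \<in> borel_measurable lborel" for j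
    by measurable
  show "integrable lborel (\<lambda>x. norm (C * (w x * complex_of_real (exp (- c * (norm x)\<^sup>2)))))"
    by (intro integrable_norm integrable_mult_right L2_mult_integrable w gaussian_L2 c)
  show "AE x in lborel. (\<lambda>j. w x * cnj (g j x)) \<longlonglongrightarrow> w x * cnj (g' x)"
    by (intro AE_I2 tendsto_mult tendsto_const tendsto_cnj lim)
  show "AE x in lborel. norm (w x * cnj (g j x)) \<le> norm (C * (w x * complex_of_real (exp (- c * (norm x)\<^sup>2))))" for j
  proof (intro AE_I2)
    fix x
    have "norm (w x) * norm (g j x) \<le> norm (w x) * \<bar>C * exp (- c * (norm x)\<^sup>2)\<bar>"
      using b[of j x] by (intro mult_left_mono) auto
    then show "norm (w x * cnj (g j x)) \<le> norm (C * (w x * complex_of_real (exp (- c * (norm x)\<^sup>2))))"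
      by (simp add: norm_mult abs_mult mult_ac)
  qed
qed


section \<open>Passage from rational scales to the exact scale\<close>

lemma L2_inner_cmult_right: "L2_inner M f (\<lambda>x. of_real c * g x) = of_real c * L2_inner M f g"
  unfolding L2_inner_def by (subst integral_mult_right_zero[symmetric]) (simp add: mult.left_commute)

lemma L2_inner_diff_right:
  "f \<in> L2 M \<Longrightarrow> g \<in> L2 M \<Longrightarrow> h \<in> L2 M \<Longrightarrow> L2_inner M f (\<lambda>x. g x - h x) = L2_inner M f g - L2_inner M f h"
  by (simp add: L2_inner_def right_diff_distrib L2_inner_integrable)

lemma gaussian_bound_L2:
  fixes g :: "real^'m::finite \<Rightarrow> complex"
  assumes "g \<in> borel_measurable borel" "\<And>x. norm (g x) \<le> C * exp (- c * (norm x)\<^sup>2)" "0 < c"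
  shows "g \<in> L2 lborel"
proof (rule L2_bound[OF L2_cmult[OF gaussian_L2[OF assms(3)], of C]])
  have "norm (g x) \<le> \<bar>C * exp (- c * (norm x)\<^sup>2)\<bar>" for x
    by (rule order_trans[OF assms(2) abs_ge_self])
  then show "AE x in lborel. norm (g x) \<le> norm (complex_of_real C * complex_of_real (exp (- c * (norm x)\<^sup>2)))"
    by (simp only: norm_of_real flip: of_real_mult) simp
qed (use assms(1) in simp)

lemma rational_approximation_above:
  assumes "0 < (s::real)"
  obtains r :: "nat \<Rightarrow> rat" where "\<And>j. s < of_rat (r j)" "\<And>j. of_rat (r j) < 2 * s" "(\<lambda>j. real_of_rat (r j)) \<longlonglongrightarrow> s"
proof -
  \<comment> \<open>The minimum with s keeps the approximations below 2s, inside the range of scales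
    with a common Gaussian bound.\<close>
  have "\<forall>j::nat. \<exists>q::rat. s < of_rat q \<and> of_rat q < s + min s (1 / real (Suc j))"
    using assms by (intro allI of_rat_dense) auto
  from choice[OF this] obtain r :: "nat \<Rightarrow> rat" where r: "\<And>j. s < of_rat (r j)" "\<And>j. of_rat (r j) < s + min s (1 / real (Suc j))"
    by auto
  have r2: "of_rat (r j) < s + 1 / real (Suc j)" for j
    using r(2)[of j] min.cobounded2[of s "1 / real (Suc j)"] by linarith
  have "(\<lambda>j. s + 1 / real (Suc j)) \<longlonglongrightarrow> s + 0"
    by (intro tendsto_add tendsto_const lim_1_over_n[THEN LIMSEQ_Suc])
  then have lim: "(\<lambda>j. s + 1 / real (Suc j)) \<longlonglongrightarrow> s" by simp
  have "(\<lambda>j. real_of_rat (r j)) \<longlonglongrightarrow> s"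
    by (rule tendsto_sandwich[OF _ _ tendsto_const lim])
       (use r(1) r2 in \<open>auto intro!: always_eventually less_imp_le\<close>)
  moreover have "of_rat (r j) < 2 * s" for j using r(2)[of j] by (auto simp: min_def split: if_splits)
  ultimately show thesis using r(1) that by blast
qed

text \<open>Collects the limits of the three pairings that occur in the contracted weak equation. S
  is the Hermite product at the exact scale, equal to the scaled Hermite function up to a power of
  the scale; the limit of the Laplacians is the oscillator equation for S.\<close>

lemma cutoff_vec_convergence:
  fixes k :: "nat^'m::finite"
  assumes s: "0 < s" and N: "\<And>j. 0 < N j" "\<And>j. N j \<le> 1" "N \<longlonglongrightarrow> 0"
    and \<sigma>: "\<And>j. s < \<sigma> j" "\<And>j. \<sigma> j < 2 * s" "\<sigma> \<longlonglongrightarrow> s"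
    and u: "u \<in> L2 lborel"
  defines "S \<equiv> (\<lambda>x::real^'m. \<Prod>l\<in>UNIV. complex_of_real (hermite_fun (k $ l) (s * x $ l)))"
  shows "(\<lambda>j. L2_inner lborel u (cutoff_vec k (\<sigma> j) (N j))) \<longlonglongrightarrow> L2_inner lborel u S"
    and "(\<lambda>j. L2_inner lborel u (\<lambda>x. of_real ((norm x)\<^sup>2) * cutoff_vec k (\<sigma> j) (N j) x)) \<longlonglongrightarrow> L2_inner lborel u (\<lambda>x. of_real ((norm x)\<^sup>2) * S x)"
    and "(\<lambda>j. L2_inner lborel u (laplacian (cutoff_vec k (\<sigma> j) (N j)))) \<longlonglongrightarrow>
      L2_inner lborel u (\<lambda>x. of_real (s\<^sup>2 * (s\<^sup>2 * (norm x)\<^sup>2 - (2 * real (\<Sum>i\<in>UNIV. k $ i) + real CARD('m)))) * S x)"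
    and "S \<in> L2 lborel" and "(\<lambda>x. of_real ((norm x)\<^sup>2) * S x) \<in> L2 lborel"
proof -
  have "\<forall>n. \<exists>C. C \<ge> 0 \<and> (\<forall>N \<sigma> u. 0 < N \<longrightarrow> N \<le> 1 \<longrightarrow> s / 2 \<le> \<sigma> \<longrightarrow> \<sigma> \<le> 2 * s \<longrightarrow>
    \<bar>cutoff_mode n \<sigma> N u\<bar> \<le> C * exp (- (s\<^sup>2 / 16) * u\<^sup>2) \<and> \<bar>cutoff_mode_d2 n \<sigma> N u\<bar> \<le> C * exp (- (s\<^sup>2 / 16) * u\<^sup>2))"
    using cutoff_mode_bounds[OF s] by blast
  from choice[OF this] obtain C where C': "\<forall>n. C n \<ge> 0 \<and> (\<forall>N \<sigma> u. 0 < N \<longrightarrow> N \<le> 1 \<longrightarrow> s / 2 \<le> \<sigma> \<longrightarrow> \<sigma> \<le> 2 * s \<longrightarrow>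
    \<bar>cutoff_mode n \<sigma> N u\<bar> \<le> C n * exp (- (s\<^sup>2 / 16) * u\<^sup>2) \<and> \<bar>cutoff_mode_d2 n \<sigma> N u\<bar> \<le> C n * exp (- (s\<^sup>2 / 16) * u\<^sup>2))" ..
  then have C0: "\<And>n. C n \<ge> 0" by blast
  have C: "\<And>n N \<sigma> u. 0 < N \<Longrightarrow> N \<le> 1 \<Longrightarrow> s / 2 \<le> \<sigma> \<Longrightarrow> \<sigma> \<le> 2 * s \<Longrightarrow>
    \<bar>cutoff_mode n \<sigma> N u\<bar> \<le> C n * exp (- (s\<^sup>2 / 16) * u\<^sup>2) \<and> \<bar>cutoff_mode_d2 n \<sigma> N u\<bar> \<le> C n * exp (- (s\<^sup>2 / 16) * u\<^sup>2)"
    using C' by blast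
  define c where "c = s\<^sup>2 / 16"
  have c: "0 < c" using s by (simp add: c_def)
  let ?E = "\<lambda>x::real^'m. exp (- c * (norm x)\<^sup>2)"
  define P where "P = (\<Prod>l\<in>UNIV. C (k $ l))"
  have P0: "0 \<le> P" unfolding P_def by (intro prod_nonneg) (simp add: C0)
  let ?a = "\<lambda>j. cutoff_vec k (\<sigma> j) (N j)"
  have b: "\<bar>cutoff_mode n (\<sigma> j) (N j) v\<bar> \<le> C n * exp (- c * v\<^sup>2)" "\<bar>cutoff_mode_d2 n (\<sigma> j) (N j) v\<bar> \<le> C n * exp (- c * v\<^sup>2)" for n j v
    using C[OF N(1)[of j] N(2)[of j], of "\<sigma> j" n v] \<sigma>(1,2)[of j] s by (auto simp: c_def)
  have PE: "(\<Prod>l\<in>UNIV. C (k $ l) * exp (- c * (x $ l)\<^sup>2)) = P * ?E x" for x :: "real^'m"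
    unfolding prod.distrib P_def exp_norm_vec_sq ..
  have bA: "norm (?a j x) \<le> P * ?E x" for j x
    unfolding cutoff_vec_def prod_norm[symmetric] PE[symmetric] using b(1) by (intro prod_mono) auto
  have bL: "norm (laplacian (?a j) x) \<le> (real CARD('m) * P) * ?E x" for j x
  proof -
    have "norm (laplacian (?a j) x) \<le> (\<Sum>i\<in>(UNIV::'m set). P * ?E x)"
      unfolding laplacian_cutoff_vec[OF N(1)]
    proof (rule sum_norm_le)
      fix i :: 'm
      have "norm (of_real (cutoff_mode_d2 (k $ i) (\<sigma> j) (N j) (x $ i)) * (\<Prod>l\<in>UNIV - {i}. complex_of_real (cutoff_mode (k $ l) (\<sigma> j) (N j) (x $ l))))
          \<le> (C (k $ i) * exp (- c * (x $ i)\<^sup>2)) * (\<Prod>l\<in>UNIV - {i}. C (k $ l) * exp (- c * (x $ l)\<^sup>2))"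
        unfolding norm_mult prod_norm[symmetric] using b C0
        by (intro mult_mono prod_mono) (auto intro!: prod_nonneg)
      also have "\<dots> = P * ?E x" unfolding PE[symmetric] by (rule prod.remove[symmetric]) auto
      finally show "norm (of_real (cutoff_mode_d2 (k $ i) (\<sigma> j) (N j) (x $ i)) * (\<Prod>l\<in>UNIV - {i}. complex_of_real (cutoff_mode (k $ l) (\<sigma> j) (N j) (x $ l)))) \<le> P * ?E x" .
    qed
    then show ?thesis by simp
  qed
  \<comment> \<open>The weight |x|^2 is absorbed by half of the Gaussian, through y \<le> e^y at y =
    c|x|^2/2.\<close>
  have bQ: "norm (of_real ((norm x)\<^sup>2) * ?a j x) \<le> (2 / c * P) * exp (- (c / 2) * (norm x)\<^sup>2)" for j x
  proof -
    have "c / 2 * (norm x)\<^sup>2 \<le> exp (c / 2 * (norm x)\<^sup>2)"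
      using exp_ge_add_one_self[of "c / 2 * (norm x)\<^sup>2"] by linarith
    then have "(norm x)\<^sup>2 \<le> 2 / c * exp (c / 2 * (norm x)\<^sup>2)" using c by (simp add: field_simps)
    then have "(norm x)\<^sup>2 * norm (?a j x) \<le> (2 / c * exp (c / 2 * (norm x)\<^sup>2)) * (P * ?E x)"
      using bA c by (intro mult_mono) auto
    also have "\<dots> = (2 / c * P) * (exp (c / 2 * (norm x)\<^sup>2) * ?E x)" by (simp only: mult_ac)
    also have "exp (c / 2 * (norm x)\<^sup>2) * ?E x = exp (- (c / 2) * (norm x)\<^sup>2)"
      by (simp flip: exp_add)
    finally show ?thesis by (simp add: norm_mult norm_power)
  qed
  have lA: "(\<lambda>j. ?a j x) \<longlonglongrightarrow> S x" for x
    unfolding cutoff_vec_def S_def by (intro tendsto_prod tendsto_of_real cutoff_mode_limits(1) N \<sigma>)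
  have lQ: "(\<lambda>j. of_real ((norm x)\<^sup>2) * ?a j x) \<longlonglongrightarrow> of_real ((norm x)\<^sup>2) * S x" for x
    by (intro tendsto_mult tendsto_const lA)
  have lL: "(\<lambda>j. laplacian (?a j) x) \<longlonglongrightarrow> of_real (s\<^sup>2 * (s\<^sup>2 * (norm x)\<^sup>2 - (2 * real (\<Sum>i\<in>UNIV. k $ i) + real CARD('m)))) * S x" for x
  proof -
    let ?h = "\<lambda>l. complex_of_real (hermite_fun (k $ l) (s * x $ l))"
    let ?q = "\<lambda>i. s\<^sup>2 * ((s * x $ i)\<^sup>2 - (2 * real (k $ i) + 1))"
    have "(\<lambda>j. laplacian (?a j) x) \<longlonglongrightarrow> (\<Sum>i\<in>UNIV. of_real (s\<^sup>2 * (((s * x $ i)\<^sup>2 - (2 * real (k $ i) + 1)) * hermite_fun (k $ i) (s * x $ i))) * (\<Prod>l\<in>UNIV - {i}. ?h l))"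
      unfolding laplacian_cutoff_vec[OF N(1)]
      by (intro tendsto_sum tendsto_mult tendsto_prod tendsto_of_real cutoff_mode_limits N \<sigma>)
    also have "(\<Sum>i\<in>UNIV. of_real (s\<^sup>2 * (((s * x $ i)\<^sup>2 - (2 * real (k $ i) + 1)) * hermite_fun (k $ i) (s * x $ i))) * (\<Prod>l\<in>UNIV - {i}. ?h l))
        = (\<Sum>i\<in>UNIV. of_real (?q i) * S x)"
    proof (intro sum.cong refl)
      fix i
      have "S x = ?h i * (\<Prod>l\<in>UNIV - {i}. ?h l)" unfolding S_def by (rule prod.remove) auto
      then show "of_real (s\<^sup>2 * (((s * x $ i)\<^sup>2 - (2 * real (k $ i) + 1)) * hermite_fun (k $ i) (s * x $ i))) * (\<Prod>l\<in>UNIV - {i}. ?h l) = of_real (?q i) * S x"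
        by (simp only: of_real_mult mult.assoc)
    qed
    also have "\<dots> = of_real (\<Sum>i\<in>UNIV. ?q i) * S x" by (simp only: of_real_sum sum_distrib_right)
    also have "(\<Sum>i\<in>UNIV. ?q i) = s\<^sup>2 * (s\<^sup>2 * (norm x)\<^sup>2 - (2 * real (\<Sum>i\<in>UNIV. k $ i) + real CARD('m)))"
      by (simp add: norm_vec_sq power_mult_distrib sum_distrib_left[symmetric] sum_subtractf sum.distrib)
    finally show ?thesis .
  qed
  have at: "?a j \<in> test_functions" for j by (rule cutoff_vec_test_function[OF N(1)])
  have mA: "?a j \<in> borel_measurable borel" for j
    by (intro borel_measurable_continuous_onI test_function_facts(3) at)
  have mQ: "(\<lambda>x. of_real ((norm x)\<^sup>2) * ?a j x) \<in> borel_measurable borel" for j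
    by (intro borel_measurable_continuous_onI continuous_intros test_function_facts(3) at)
  have mL: "laplacian (?a j) \<in> borel_measurable borel" for j
    by (intro borel_measurable_continuous_onI laplacian_test_function(3) at)
  show "(\<lambda>j. L2_inner lborel u (?a j)) \<longlonglongrightarrow> L2_inner lborel u S"
    by (rule gaussian_dominated_limit[OF u mA bA c lA])
  show "(\<lambda>j. L2_inner lborel u (\<lambda>x. of_real ((norm x)\<^sup>2) * ?a j x)) \<longlonglongrightarrow> L2_inner lborel u (\<lambda>x. of_real ((norm x)\<^sup>2) * S x)"
    by (rule gaussian_dominated_limit[OF u mQ bQ _ lQ]) (use c in simp)
  show "(\<lambda>j. L2_inner lborel u (laplacian (?a j))) \<longlonglongrightarrow>
      L2_inner lborel u (\<lambda>x. of_real (s\<^sup>2 * (s\<^sup>2 * (norm x)\<^sup>2 - (2 * real (\<Sum>i\<in>UNIV. k $ i) + real CARD('m)))) * S x)"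
    by (rule gaussian_dominated_limit[OF u mL bL c lL])
  \<comment> \<open>The Gaussian bounds pass to the pointwise limits and show that these are square
    integrable.\<close>
  have "norm (S x) \<le> P * ?E x" for x
    by (rule LIMSEQ_le_const2[OF tendsto_norm[OF lA]]) (use bA in auto)
  then show "S \<in> L2 lborel"
    by (rule gaussian_bound_L2[OF borel_measurable_LIMSEQ_metric[OF mA lA] _ c])
  have "norm (of_real ((norm x)\<^sup>2) * S x) \<le> (2 / c * P) * exp (- (c / 2) * (norm x)\<^sup>2)" for x
    by (rule LIMSEQ_le_const2[OF tendsto_norm[OF lQ]]) (use bQ in blast)
  then show "(\<lambda>x. of_real ((norm x)\<^sup>2) * S x) \<in> L2 lborel"
    by (rule gaussian_bound_L2[OF borel_measurable_LIMSEQ_metric[OF mQ lQ]]) (use c in simp)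
qed

text \<open>The contracted equation holds off one null set for countably many truncated modes. At a
  remaining frequency the limit of these identities is the equation tested with the exact Hermite
  function, which lies outside the countable family.\<close>

lemma weak_grushin_calG:
  fixes f h :: "(real^'m::finite) \<times> (real^'n::finite) \<Rightarrow> complex"
  assumes f: "f \<in> L2 lborel" and weak: "is_weak_grushin f h"
  shows "AE q in Gamma_measure. calG h q = mult_Theta (calG f) q"
proof -
  have h: "h \<in> L2 lborel" using weak by (simp add: is_weak_grushin_def)
  \<comment> \<open>The index consists of the degree, a rational scale and the cutoff parameter; its
    type is countable, so the exceptional sets can be united.\<close>
  let ?a = "\<lambda>i::(nat^'m) \<times> rat \<times> nat. cutoff_vec (fst i) (of_rat (fst (snd i))) (1 / real (Suc (snd (snd i))))"
  have "AE \<xi> in lborel. \<forall>i. of_real ((norm \<xi>)\<^sup>2) * contraction (\<lambda>x. of_real ((norm x)\<^sup>2) * ?a i x) (partial_fourier f) \<xi>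
    = contraction (?a i) (partial_fourier h) \<xi> + contraction (laplacian (?a i)) (partial_fourier f) \<xi>"
    by (intro AE_all_countable[THEN iffD2] allI weak_grushin_contraction[OF f weak] cutoff_vec_test_function) simp
  then show ?thesis
    unfolding AE_Gamma using AE_partial_fourier_slice[OF f] AE_partial_fourier_slice[OF h] AE_frequency_nonzero
  proof eventually_elim
    case (elim \<xi>)
    show ?case
    proof
      fix k :: "nat^'m"
      let ?f = "\<lambda>x. partial_fourier f (x, \<xi>)" and ?h = "\<lambda>x. partial_fourier h (x, \<xi>)"
      define s where "s = sqrt (norm \<xi>)"
      have s: "0 < s" and s2: "s\<^sup>2 = norm \<xi>" using elim(4) by (auto simp: s_def)
      obtain r :: "nat \<Rightarrow> rat" where r: "\<And>j. s < of_rat (r j)" "\<And>j. of_rat (r j) < 2 * s" "(\<lambda>j. real_of_rat (r j)) \<longlonglongrightarrow> s"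
        using rational_approximation_above[OF s] by metis
      define N where "N j = 1 / real (Suc j)" for j
      have N: "\<And>j. 0 < N j" "\<And>j. N j \<le> 1" "N \<longlonglongrightarrow> 0"
        unfolding N_def[abs_def] using lim_1_over_n[THEN LIMSEQ_Suc] by (auto simp del: of_nat_Suc)
      define S where "S = (\<lambda>x::real^'m. \<Prod>l\<in>UNIV. complex_of_real (hermite_fun (k $ l) (s * x $ l)))"
      have Sx: "(\<Prod>l\<in>UNIV. complex_of_real (hermite_fun (k $ l) (s * x $ l))) = S x" for x by (simp add: S_def)
      note conv = cutoff_vec_convergence[where k=k, OF s N r(1) r(2) r(3), unfolded Sx]
      note convf = conv[OF elim(2)] and convh = conv[OF elim(3)]
      define d where "d = 2 * real (\<Sum>i\<in>UNIV. k $ i) + real CARD('m)"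
      have eq: "of_real ((norm \<xi>)\<^sup>2) * L2_inner lborel ?f (\<lambda>x. of_real ((norm x)\<^sup>2) * cutoff_vec k (of_rat (r j)) (N j) x)
          = L2_inner lborel ?h (cutoff_vec k (of_rat (r j)) (N j)) + L2_inner lborel ?f (laplacian (cutoff_vec k (of_rat (r j)) (N j)))" for j
        using elim(1)[rule_format, of "(k, r j, j)"] by (simp add: contraction_def N_def)
      have "of_real ((norm \<xi>)\<^sup>2) * L2_inner lborel ?f (\<lambda>x. of_real ((norm x)\<^sup>2) * S x)
          = L2_inner lborel ?h S + L2_inner lborel ?f (\<lambda>x. of_real (s\<^sup>2 * (s\<^sup>2 * (norm x)\<^sup>2 - d)) * S x)"
      proof (rule LIMSEQ_unique)
        show "(\<lambda>j. of_real ((norm \<xi>)\<^sup>2) * L2_inner lborel ?f (\<lambda>x. of_real ((norm x)\<^sup>2) * cutoff_vec k (of_rat (r j)) (N j) x))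
            \<longlonglongrightarrow> of_real ((norm \<xi>)\<^sup>2) * L2_inner lborel ?f (\<lambda>x. of_real ((norm x)\<^sup>2) * S x)"
          by (rule tendsto_mult[OF tendsto_const convf(2)])
        show "(\<lambda>j. of_real ((norm \<xi>)\<^sup>2) * L2_inner lborel ?f (\<lambda>x. of_real ((norm x)\<^sup>2) * cutoff_vec k (of_rat (r j)) (N j) x))
            \<longlonglongrightarrow> L2_inner lborel ?h S + L2_inner lborel ?f (\<lambda>x. of_real (s\<^sup>2 * (s\<^sup>2 * (norm x)\<^sup>2 - d)) * S x)"
          unfolding eq by (intro tendsto_add convh(1) convf(3)[folded d_def])
      qed
      \<comment> \<open>As s^2 = |\<xi>|, the quadratic term of the oscillator has the coefficient
        |\<xi>|^2 and cancels the left-hand side; what remains is the eigenvalue |\<xi>| (2|k| +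
        d').\<close>
      also have "(\<lambda>x. of_real (s\<^sup>2 * (s\<^sup>2 * (norm x)\<^sup>2 - d)) * S x)
          = (\<lambda>x. of_real ((norm \<xi>)\<^sup>2) * (of_real ((norm x)\<^sup>2) * S x) - of_real (norm \<xi> * d) * S x)"
        unfolding s2 by (simp add: fun_eq_iff algebra_simps power2_eq_square)
      also have "L2_inner lborel ?f \<dots> = of_real ((norm \<xi>)\<^sup>2) * L2_inner lborel ?f (\<lambda>x. of_real ((norm x)\<^sup>2) * S x)
          - of_real (norm \<xi> * d) * L2_inner lborel ?f S"
        using elim(2) convf(4,5) by (subst L2_inner_diff_right) (auto simp only: L2_inner_cmult_right intro!: L2_cmult)
      finally have key: "L2_inner lborel ?h S = of_real (norm \<xi> * d) * L2_inner lborel ?f S" by simp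
      have sherm: "sherm k \<xi> = (\<lambda>x. of_real (norm \<xi> powr (real CARD('m) / 4)) * S x)"
        by (simp only: hermite_scaled_prod S_def s_def)
      have "calG h (k, \<xi>) = of_real (norm \<xi> powr (real CARD('m) / 4)) * (of_real (norm \<xi> * d) * L2_inner lborel ?f S)"
        unfolding calG_eq sherm L2_inner_cmult_right key ..
      also have "\<dots> = of_real (norm \<xi> * d) * calG f (k, \<xi>)"
        unfolding calG_eq sherm L2_inner_cmult_right by (simp only: mult.left_commute)
      also have "norm \<xi> * d = Theta (k, \<xi>)" by (simp add: Theta_def d_def mult.commute)
      finally show "calG h (k, \<xi>) = mult_Theta (calG f) (k, \<xi>)" by (simp add: mult_Theta_def)
    qed
  qed
qed

theorem proposition4p2:
  shows "(Dom_bbG :: ((real ^ 'm::finite) \<times> (real ^ 'n::finite) \<Rightarrow> complex) set) = W2_G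
    \<and> (\<forall>f \<in> (Dom_bbG :: ((real ^ 'm) \<times> (real ^ 'n) \<Rightarrow> complex) set).
          AE x in lborel. bbG f x = weak_grushin f x)"
proof (intro conjI ballI set_eqI iffI)
  fix f :: "(real ^ 'm) \<times> (real ^ 'n) \<Rightarrow> complex"
  assume "f \<in> Dom_bbG"
  then show "f \<in> W2_G"
    using Dom_bbG_weak_grushin[of f] by (auto simp: W2_G_def Dom_bbG_def)
next
  fix f :: "(real ^ 'm) \<times> (real ^ 'n) \<Rightarrow> complex"
  assume "f \<in> W2_G"
  then obtain h where f: "f \<in> L2 lborel" and weak: "is_weak_grushin f h" by (auto simp: W2_G_def)
  have h: "h \<in> L2 lborel" using weak by (simp add: is_weak_grushin_def)
  \<comment> \<open>\<Theta> times the transform of f agrees almost everywhere with the transform of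
    h, which is square integrable.\<close>
  have "mult_Theta (calG f) \<in> L2 Gamma_measure"
    using weak_grushin_calG[OF f weak]
    by (intro L2_cong_AE[OF calG_L2[OF h]] mult_Theta_measurable calG_measurable f) auto
  with f show "f \<in> Dom_bbG" by (simp add: Dom_bbG_def)
next
  fix f :: "(real ^ 'm) \<times> (real ^ 'n) \<Rightarrow> complex"
  assume dom: "f \<in> Dom_bbG"
  then have f: "f \<in> L2 lborel" and weak: "is_weak_grushin f (bbG f)"
    using Dom_bbG_weak_grushin by (auto simp: Dom_bbG_def)
  \<comment> \<open>\<open>weak_grushin\<close> picks some weak image. Every weak image has the
    transform \<Theta> \<open>calG f\<close>, so injectivity of \<open>calG\<close> makes the choice
    unique up to a null set.\<close>
  have weak': "is_weak_grushin f (weak_grushin f)"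
    unfolding weak_grushin_def by (rule someI[of "is_weak_grushin f", OF weak])
  show "AE x in lborel. bbG f x = weak_grushin f x"
  proof (rule calG_injective)
    show "bbG f \<in> L2 lborel" "weak_grushin f \<in> L2 lborel"
      using weak weak' by (auto simp: is_weak_grushin_def)
    show "AE q in Gamma_measure. calG (bbG f) q = calG (weak_grushin f) q"
      using weak_grushin_calG[OF f weak] weak_grushin_calG[OF f weak'] by eventually_elim simp
  qed
qed

end
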